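(* Let $\Omega=(0,1)$, $T>0$, $u_0,v_0\in L^2(\Omega)$, $m_1,m_2\in L^2(\Omega)$ and $\gamma>0$. Then there exists $d^*\in\mathcal{D}$ such that $$J_\gamma(d^* )=\min_{d\in\mathcal{D}}J_\gamma(d),\qquad J_\gamma(d)=\frac12\int_\Omega\left(u(x,T;d)-m_1(x)\right)^2dx+\frac12\int_\Omega\left(v(x,T;d)-m_2(x)\right)^2dx+\frac{\gamma}{2}\|d\|^2_{H^1(\Omega)}.$$
   Context: For fixed constants $0<\alpha_0\le\alpha_1$ and $\alpha_2>0$, $\mathcal{D}=\{d\in H^1(\Omega):\ \alpha_0\le d(x)\le\alpha_1\ \forall x\in\Omega,\ \|d\|_{H^1(\Omega)}\le\alpha_2\}$. For $d\in\mathcal{D}$, $(u(\cdot,\cdot;d),v(\cdot,\cdot;d))$ is the unique weak solution of $u_t+u_{xxxx}=v$, $v_t-(d(x)v_x)_x=0$ in $\Omega\times(0,T)$, $u(\cdot,0)=u_0$, $v(\cdot,0)=v_0$, $u=u_{xx}=0$, $v=0$ on $\partial\Omega\times(0,T)$; weak solution: $(u,v)\in L^2(0,T;V_0^2(\Omega))\times L^2(0,T;H_0^1(\Omega))$, $(u_t,v_t)\in L^2(0,T;V_0^2(\Omega)^* )\times L^2(0,T;H^{-1}(\Omega))$, initial conditions, and for all $\phi\in V_0^2(\Omega)=\{z\in H^2(\Omega):z=0\text{ on }\partial\Omega\}$ and a.e. $t$: $\langle u_t,\phi\rangle+(u_{xx},\phi_{xx})=(v,\phi)$, $\langle v_t,\phi\rangle+(dv_x,\phi_x)=0$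 ($(\cdot,\cdot)$ the $L^2(\Omega)$ inner product).
   Formalization: The formal theorem additionally assumes that the admissible set D is nonempty; for α2 < α0 the set D is empty (since the H^1 norm of d is at least α0), so no minimizer can exist there. *)

theory Defs
  imports "HOL-Analysis.Analysis"
begin

definition Omega :: "real set" where
  "Omega = {0<..<1}"

definition L2 :: "(real \<Rightarrow> real) \<Rightarrow> bool" where
  "L2 f \<longleftrightarrow> f \<in> borel_measurable (lebesgue_on Omega)
      \<and> integrable (lebesgue_on Omega) (\<lambda>x. (f x)\<^sup>2)"

definition ip :: "(real \<Rightarrow> real) \<Rightarrow> (real \<Rightarrow> real) \<Rightarrow> real" where
  "ip f g = integral\<^sup>L (lebesgue_on Omega) (\<lambda>x. f x * g x)"

definition test_fun :: "real \<Rightarrow> real \<Rightarrow> (real \<Rightarrow> real) \<Rightarrow> bool" where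
  "test_fun a b \<phi> \<longleftrightarrow>
     (\<forall>n x. ((deriv ^^ n) \<phi>) differentiable (at x))
     \<and> (\<exists>c e. a < c \<and> c \<le> e \<and> e < b \<and> (\<forall>x. x \<notin> {c..e} \<longrightarrow> \<phi> x = 0))"

definition has_weak_deriv :: "(real \<Rightarrow> real) \<Rightarrow> (real \<Rightarrow> real) \<Rightarrow> bool" where
  "has_weak_deriv f g \<longleftrightarrow>
     (\<forall>\<phi>. test_fun 0 1 \<phi> \<longrightarrow>
        integral\<^sup>L (lebesgue_on Omega) (\<lambda>x. f x * deriv \<phi> x)
        = - integral\<^sup>L (lebesgue_on Omega) (\<lambda>x. g x * \<phi> x))"

text \<open>A chosen weak derivative (unique up to null sets when it exists in L2)\<close>
definition wd :: "(real \<Rightarrow> real) \<Rightarrow> (real \<Rightarrow> real)" where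
  "wd f = (SOME g. L2 g \<and> has_weak_deriv f g)"

definition H1 :: "(real \<Rightarrow> real) \<Rightarrow> bool" where
  "H1 f \<longleftrightarrow> L2 f \<and> (\<exists>g. L2 g \<and> has_weak_deriv f g)"

definition H2 :: "(real \<Rightarrow> real) \<Rightarrow> bool" where
  "H2 f \<longleftrightarrow> L2 f \<and> (\<exists>g h. L2 g \<and> L2 h \<and> has_weak_deriv f g \<and> has_weak_deriv g h)"

definition H1_norm :: "(real \<Rightarrow> real) \<Rightarrow> real" where
  "H1_norm f = sqrt (ip f f + ip (wd f) (wd f))"

definition H2_norm :: "(real \<Rightarrow> real) \<Rightarrow> real" where
  "H2_norm f = sqrt (ip f f + ip (wd f) (wd f) + ip (wd (wd f)) (wd (wd f)))"

text \<open>Vanishing on the boundary of Omega = {0,1}, via the continuous representative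
  (H1 and H2 functions on an interval have one)\<close>
definition zero_bdry :: "(real \<Rightarrow> real) \<Rightarrow> bool" where
  "zero_bdry z \<longleftrightarrow> (\<exists>w. continuous_on {0..1} w \<and> (AE x in lebesgue_on Omega. w x = z x)
                         \<and> w 0 = 0 \<and> w 1 = 0)"

definition H01 :: "(real \<Rightarrow> real) \<Rightarrow> bool" where
  "H01 z \<longleftrightarrow> H1 z \<and> zero_bdry z"

definition V02 :: "(real \<Rightarrow> real) \<Rightarrow> bool" where
  "V02 z \<longleftrightarrow> H2 z \<and> zero_bdry z"

definition QT :: "real \<Rightarrow> (real \<times> real) set" where
  "QT T = {0<..<T} \<times> Omega"

definition jmeas :: "real \<Rightarrow> (real \<Rightarrow> real \<Rightarrow> real) \<Rightarrow> bool" where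
  "jmeas T u \<longleftrightarrow> (\<lambda>p. u (fst p) (snd p)) \<in> borel_measurable (lebesgue_on (QT T))
      \<and> integrable (lebesgue_on (QT T)) (\<lambda>p. (u (fst p) (snd p))\<^sup>2)"

definition L2_V02 :: "real \<Rightarrow> (real \<Rightarrow> real \<Rightarrow> real) \<Rightarrow> bool" where
  "L2_V02 T u \<longleftrightarrow> (\<exists>u1 u2. jmeas T u \<and> jmeas T u1 \<and> jmeas T u2
      \<and> (AE t in lebesgue_on {0<..<T}.
            has_weak_deriv (u t) (u1 t) \<and> has_weak_deriv (u1 t) (u2 t) \<and> zero_bdry (u t)))"

definition L2_H01 :: "real \<Rightarrow> (real \<Rightarrow> real \<Rightarrow> real) \<Rightarrow> bool" where
  "L2_H01 T v \<longleftrightarrow> (\<exists>v1. jmeas T v \<and> jmeas T v1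
      \<and> (AE t in lebesgue_on {0<..<T}. has_weak_deriv (v t) (v1 t) \<and> zero_bdry (v t)))"

definition dual_norm ::
  "((real \<Rightarrow> real) \<Rightarrow> bool) \<Rightarrow> ((real \<Rightarrow> real) \<Rightarrow> real) \<Rightarrow> ((real \<Rightarrow> real) \<Rightarrow> real) \<Rightarrow> real" where
  "dual_norm V N w = (SUP \<phi>\<in>{\<phi>. V \<phi> \<and> N \<phi> \<noteq> 0}. \<bar>w \<phi>\<bar> / N \<phi>)"

definition bounded_lin_fun ::
  "((real \<Rightarrow> real) \<Rightarrow> bool) \<Rightarrow> ((real \<Rightarrow> real) \<Rightarrow> real) \<Rightarrow> ((real \<Rightarrow> real) \<Rightarrow> real) \<Rightarrow> bool" where
  "bounded_lin_fun V N w \<longleftrightarrow>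
     (\<forall>\<phi> \<psi> a b. V \<phi> \<and> V \<psi> \<longrightarrow> w (\<lambda>x. a * \<phi> x + b * \<psi> x) = a * w \<phi> + b * w \<psi>)
     \<and> (\<exists>C. \<forall>\<phi>. V \<phi> \<longrightarrow> \<bar>w \<phi>\<bar> \<le> C * N \<phi>)"

definition L2_dual ::
  "real \<Rightarrow> ((real \<Rightarrow> real) \<Rightarrow> bool) \<Rightarrow> ((real \<Rightarrow> real) \<Rightarrow> real)
     \<Rightarrow> (real \<Rightarrow> (real \<Rightarrow> real) \<Rightarrow> real) \<Rightarrow> bool" where
  "L2_dual T V N w \<longleftrightarrow>
     (AE t in lebesgue_on {0<..<T}. bounded_lin_fun V N (w t))
     \<and> (\<forall>\<phi>. V \<phi> \<longrightarrow> (\<lambda>t. w t \<phi>) \<in> borel_measurable (lebesgue_on {0<..<T}))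
     \<and> integrable (lebesgue_on {0<..<T}) (\<lambda>t. (dual_norm V N (w t))\<^sup>2)"

text \<open>w is the weak time derivative of u (Gelfand triple V \<subset> L2 \<subset> V^*)\<close>
definition is_time_deriv ::
  "real \<Rightarrow> ((real \<Rightarrow> real) \<Rightarrow> bool) \<Rightarrow> (real \<Rightarrow> real \<Rightarrow> real)
     \<Rightarrow> (real \<Rightarrow> (real \<Rightarrow> real) \<Rightarrow> real) \<Rightarrow> bool" where
  "is_time_deriv T V u w \<longleftrightarrow>
     (\<forall>\<phi> \<psi>. V \<phi> \<and> test_fun 0 T \<psi> \<longrightarrow>
        integral\<^sup>L (lebesgue_on {0<..<T}) (\<lambda>t. ip (u t) \<phi> * deriv \<psi> t)
        = - integral\<^sup>L (lebesgue_on {0<..<T}) (\<lambda>t. w t \<phi> * \<psi> t))"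

text \<open>The representative u is continuous [0,T] -> L^2(Omega), so u t is meaningful for every t
  (in particular initial and final values)\<close>
definition cont_L2 :: "real \<Rightarrow> (real \<Rightarrow> real \<Rightarrow> real) \<Rightarrow> bool" where
  "cont_L2 T u \<longleftrightarrow> (\<forall>t\<in>{0..T}. L2 (u t))
     \<and> (\<forall>t0\<in>{0..T}. ((\<lambda>t. ip (\<lambda>x. u t x - u t0 x) (\<lambda>x. u t x - u t0 x)) \<longlongrightarrow> 0)
                       (at t0 within {0..T}))"

definition weak_sol ::
  "real \<Rightarrow> (real \<Rightarrow> real) \<Rightarrow> (real \<Rightarrow> real) \<Rightarrow> (real \<Rightarrow> real)
     \<Rightarrow> (real \<Rightarrow> real \<Rightarrow> real) \<Rightarrow> (real \<Rightarrow> real \<Rightarrow> real) \<Rightarrow> bool" where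
  "weak_sol T u0 v0 d u v \<longleftrightarrow>
     L2_V02 T u \<and> L2_H01 T v \<and> cont_L2 T u \<and> cont_L2 T v
     \<and> (\<exists>ut vt. L2_dual T V02 H2_norm ut \<and> L2_dual T H01 H1_norm vt
          \<and> is_time_deriv T V02 u ut \<and> is_time_deriv T H01 v vt
          \<and> (AE t in lebesgue_on {0<..<T}. \<forall>\<phi>. V02 \<phi> \<longrightarrow>
                ut t \<phi> + ip (wd (wd (u t))) (wd (wd \<phi>)) = ip (v t) \<phi>
              \<and> vt t \<phi> + ip (\<lambda>x. d x * wd (v t) x) (wd \<phi>) = 0))
     \<and> (AE x in lebesgue_on Omega. u 0 x = u0 x)
     \<and> (AE x in lebesgue_on Omega. v 0 x = v0 x)"

definition Dset :: "real \<Rightarrow> real \<Rightarrow> real \<Rightarrow> (real \<Rightarrow> real) set" where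
  "Dset \<alpha>0 \<alpha>1 \<alpha>2 = {d. H1 d \<and> (\<forall>x\<in>Omega. \<alpha>0 \<le> d x \<and> d x \<le> \<alpha>1) \<and> H1_norm d \<le> \<alpha>2}"

text \<open>J_gamma(d), evaluated at the (unique up to null sets) weak solution for d\<close>
definition Jgam ::
  "real \<Rightarrow> (real \<Rightarrow> real) \<Rightarrow> (real \<Rightarrow> real) \<Rightarrow> (real \<Rightarrow> real) \<Rightarrow> (real \<Rightarrow> real)
     \<Rightarrow> real \<Rightarrow> (real \<Rightarrow> real) \<Rightarrow> real" where
  "Jgam T u0 v0 m1 m2 \<gamma> d = (THE j. \<exists>u v. weak_sol T u0 v0 d u v \<and>
      j = 1/2 * integral\<^sup>L (lebesgue_on Omega) (\<lambda>x. (u T x - m1 x)\<^sup>2)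
        + 1/2 * integral\<^sup>L (lebesgue_on Omega) (\<lambda>x. (v T x - m2 x)\<^sup>2)
        + \<gamma>/2 * (H1_norm d)\<^sup>2)"

end

theory Submission
  imports Defs "HOL-Complex_Analysis.Great_Picard"
begin

text \<open>
  Two weak solutions with the same initial data satisfy an energy estimate: testing the equations
  with the modes \<open>sin (k pi x)\<close>, which lie in \<open>V02\<close>, gives scalar integral equations
  whose products sum up (Parseval for the sine and cosine bases and dominated convergence in time)
  to the energy identities, with no regularisation in time. The estimate is linear in the sup
  distance of the coefficients. Hence weak solutions are unique, and if coefficients converge
  uniformly then their solutions converge strongly and the limit is again a weak solution.

  A minimising sequence has a uniformly convergent subsequence (Arzela-Ascoli), and the \<open>H1\<close>
  norm is lower semicontinuous along it (Mazur). This yields a minimiser among the coefficients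
  for which a weak solution exists. At all other coefficients \<open>Jgam\<close>, being a \<open>THE\<close> over an
  empty predicate, takes one and the same value, so a comparison with that value finishes the
  proof, and the solvability of the initial-boundary value problem is never needed.
\<close>

section \<open>Square-integrable functions\<close>

text \<open>The coupling runs one way: \<open>v\<close> does not see \<open>u\<close>. So the
  difference of two \<open>v\<close> is estimated first, the change of coefficient acting as a
  source weighted by the gradient of one of the two solutions; that difference is then the
  right-hand side in the equation for \<open>u\<close>.

  Three features of the formulation shape the passage to the limit. \<open>wd\<close> selects a
  derivative separately on each time slice, so joint measurability must come from representatives on
  the cylinder. The dual norm is a supremum over an uncountable family, so its measurability in time
  is obtained for the limit from the dual norms of the approximating solutions. And only
  \<open>u\<close> and \<open>v\<close> converge at every time; their derivatives converge on the
  cylinder and, along a subsequence, on almost every slice.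

  Coefficients are extracted with geometrically decaying distances, so that the solutions have
  summable increments. Since \<gamma> > 0, convergence of the functional along the minimising
  sequence forces the H1 norms to converge, and their limit bounds the norm of the limiting
  coefficient.\<close>

definition sqint :: "'a measure \<Rightarrow> ('a \<Rightarrow> real) \<Rightarrow> bool" where
  "sqint M f \<longleftrightarrow> f \<in> borel_measurable M \<and> integrable M (\<lambda>x. (f x)\<^sup>2)"

text \<open>The measure is a parameter because three instances occur: the space interval, the time
  interval and the space-time cylinder. Fubini links them in \<open>jmeas_nrm\<close>.\<close>

definition l2n :: "'a measure \<Rightarrow> ('a \<Rightarrow> real) \<Rightarrow> real" where
  "l2n M f = sqrt (\<integral>x. (f x)\<^sup>2 \<partial>M)"

lemma sqint_measurable: "sqint M f \<Longrightarrow> f \<in> borel_measurable M"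
  by (simp add: sqint_def)

lemma sqint_sq_integrable: "sqint M f \<Longrightarrow> integrable M (\<lambda>x. (f x)\<^sup>2)"
  by (simp add: sqint_def)

lemma sqint_mult_integrable:
  assumes "sqint M f" "sqint M g"
  shows "integrable M (\<lambda>x. f x * g x)"
proof (rule Bochner_Integration.integrable_bound)
  show "integrable M (\<lambda>x. (f x)\<^sup>2 + (g x)\<^sup>2)"
    using assms by (auto simp: sqint_def)
  show "(\<lambda>x. f x * g x) \<in> borel_measurable M"
    using assms by (auto simp: sqint_def)
  have "\<bar>a * b\<bar> \<le> a\<^sup>2 + b\<^sup>2" for a b :: real
    using sum_squares_bound[of "\<bar>a\<bar>" "\<bar>b\<bar>"] abs_ge_zero[of "a * b"]
    unfolding abs_mult power2_abs by linarith
  then show "AE x in M. norm (f x * g x) \<le> norm ((f x)\<^sup>2 + (g x)\<^sup>2)"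
    by auto
qed

lemma sqint_add:
  assumes "sqint M f" "sqint M g"
  shows "sqint M (\<lambda>x. f x + g x)"
  unfolding sqint_def power2_sum
  using assms sqint_mult_integrable[OF assms] unfolding sqint_def
  by (auto simp: mult.assoc)

lemma sqint_cmult: "sqint M f \<Longrightarrow> sqint M (\<lambda>x. c * f x)"
  by (auto simp: sqint_def power_mult_distrib)

lemma sqint_minus: "sqint M f \<Longrightarrow> sqint M (\<lambda>x. - f x)"
  by (auto simp: sqint_def)

lemma sqint_diff:
  assumes "sqint M f" "sqint M g"
  shows "sqint M (\<lambda>x. f x - g x)"
  using sqint_add[OF assms(1) sqint_minus[OF assms(2)]] by simp

lemma sqint_zero: "sqint M (\<lambda>x. 0)"
  by (simp add: sqint_def)

lemma sqint_sum: "(\<And>i. i \<in> I \<Longrightarrow> sqint M (f i)) \<Longrightarrow> sqint M (\<lambda>x. \<Sum>i\<in>I. f i x)"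
  by (induction I rule: infinite_finite_induct) (auto intro: sqint_zero sqint_add)

lemma sqint_bound:
  assumes "sqint M f" "g \<in> borel_measurable M" "AE x in M. \<bar>g x\<bar> \<le> \<bar>f x\<bar>"
  shows "sqint M g"
  unfolding sqint_def
proof
  show "integrable M (\<lambda>x. (g x)\<^sup>2)"
    by (rule Bochner_Integration.integrable_bound[OF sqint_sq_integrable[OF assms(1)]])
       (use assms in \<open>auto simp: abs_le_square_iff\<close>)
qed (fact assms)

lemma sqint_bounded_mult:
  assumes "sqint M f" "g \<in> borel_measurable M" "AE x in M. \<bar>g x\<bar> \<le> C"
  shows "sqint M (\<lambda>x. g x * f x)"
proof (rule sqint_bound[OF sqint_cmult[OF assms(1), of C]])
  show "AE x in M. \<bar>g x * f x\<bar> \<le> \<bar>C * f x\<bar>"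
    using assms(3) by eventually_elim (auto simp: abs_mult intro!: mult_right_mono)
qed (use assms in \<open>auto simp: sqint_def\<close>)

lemma (in finite_measure) sqint_bounded:
  assumes "g \<in> borel_measurable M" "AE x in M. \<bar>g x\<bar> \<le> C"
  shows "sqint M g"
  using sqint_bounded_mult[of M "\<lambda>_. 1" g C] assms by (simp add: sqint_def)

lemma (in finite_measure) sqint_integrable: "sqint M f \<Longrightarrow> integrable M f"
  using sqint_mult_integrable[of M f "\<lambda>_. 1"] by (simp add: sqint_def)

lemma l2n_nonneg [simp]: "0 \<le> l2n M f"
  by (simp add: l2n_def)

lemma l2n_sq: "(l2n M f)\<^sup>2 = (\<integral>x. (f x)\<^sup>2 \<partial>M)"
  by (simp add: l2n_def)

lemma l2n_cmult: "l2n M (\<lambda>x. c * f x) = \<bar>c\<bar> * l2n M f"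
  by (simp add: l2n_def power_mult_distrib real_sqrt_mult)

lemma l2n_minus: "l2n M (\<lambda>x. - f x) = l2n M f"
  by (simp add: l2n_def)

lemma l2n_minus_commute: "l2n M (\<lambda>x. f x - g x) = l2n M (\<lambda>x. g x - f x)"
  by (simp add: l2n_def power2_commute)

lemma l2n_cong_AE:
  assumes "f \<in> borel_measurable M" "g \<in> borel_measurable M" "AE x in M. f x = g x"
  shows "l2n M f = l2n M g"
proof -
  have "(\<integral>x. (f x)\<^sup>2 \<partial>M) = (\<integral>x. (g x)\<^sup>2 \<partial>M)"
    by (rule integral_cong_AE) (use assms in auto)
  then show ?thesis by (simp add: l2n_def)
qed

lemma l2n_mono:
  assumes "sqint M f" "g \<in> borel_measurable M" "AE x in M. \<bar>g x\<bar> \<le> \<bar>f x\<bar>"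
  shows "l2n M g \<le> l2n M f"
proof -
  have "(\<integral>x. (g x)\<^sup>2 \<partial>M) \<le> (\<integral>x. (f x)\<^sup>2 \<partial>M)"
    by (rule integral_mono_AE)
       (use assms sqint_bound[OF assms] in \<open>auto simp: sqint_def abs_le_square_iff\<close>)
  then show ?thesis by (simp add: l2n_def)
qed

lemma l2n_eq_0_AE:
  assumes "sqint M f" "l2n M f = 0"
  shows "AE x in M. f x = 0"
proof -
  have "(\<integral>x. (f x)\<^sup>2 \<partial>M) = 0"
    using assms by (simp add: l2n_def)
  then show ?thesis
    using integral_nonneg_eq_0_iff_AE[OF sqint_sq_integrable[OF assms(1)]] by simp
qed

section \<open>Cauchy-Schwarz and convergence in the norm\<close>

lemma CS_l2n:
  assumes f: "sqint M f" and g: "sqint M g"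
  shows "\<bar>\<integral>x. f x * g x \<partial>M\<bar> \<le> l2n M f * l2n M g"
proof -
  define a b c where "a = (\<integral>x. (f x)\<^sup>2 \<partial>M)" "b = (\<integral>x. (g x)\<^sup>2 \<partial>M)" "c = (\<integral>x. f x * g x \<partial>M)"
  have int: "integrable M (\<lambda>x. (f x)\<^sup>2)" "integrable M (\<lambda>x. (g x)\<^sup>2)" "integrable M (\<lambda>x. f x * g x)"
    using f g sqint_mult_integrable[OF f g] by (auto simp: sqint_def)
  have "(\<integral>x. (s * f x - t * g x)\<^sup>2 \<partial>M) = s\<^sup>2 * a - 2 * s * t * c + t\<^sup>2 * b" for s t
  proof -
    have "(\<integral>x. (s * f x - t * g x)\<^sup>2 \<partial>M)
        = (\<integral>x. s\<^sup>2 * (f x)\<^sup>2 - (2 * s * t) * (f x * g x) + t\<^sup>2 * (g x)\<^sup>2 \<partial>M)"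
      by (rule Bochner_Integration.integral_cong) (auto simp: power2_diff power_mult_distrib)
    also have "\<dots> = s\<^sup>2 * a - 2 * s * t * c + t\<^sup>2 * b"
      using int by (simp add: a_b_c_def)
    finally show ?thesis .
  qed
  note ex = this
  have q: "0 \<le> s\<^sup>2 * a - 2 * s * t * c + t\<^sup>2 * b" for s t
    unfolding ex[symmetric] by simp
  have a0: "0 \<le> a" "0 \<le> b" by (auto simp: a_b_c_def)
  have "c\<^sup>2 \<le> a * b"
  proof (cases "b = 0")
    case True
    have "c = 0"
    proof (rule ccontr)
      assume "c \<noteq> 0"
      \<comment> \<open>With b = 0 the form is affine in t, and this t gives it the value
        -1.\<close>
      then show False using q[of 1 "(a + 1) / (2 * c)"] True by simp
    qed
    then show ?thesis using a0 by simp
  next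
    case False
    \<comment> \<open>For s = b the form is minimal in t at t = c.\<close>
    have "0 \<le> b * (a * b - c\<^sup>2)"
      using q[of b c] by (simp add: power2_eq_square algebra_simps)
    with False a0 show ?thesis by (simp add: zero_le_mult_iff)
  qed
  then have "\<bar>c\<bar> \<le> sqrt (a * b)"
    using real_le_rsqrt by (simp add: real_le_rsqrt)
  then show ?thesis by (simp add: l2n_def a_b_c_def real_sqrt_mult)
qed

lemma l2n_add_sq:
  assumes f: "sqint M f" and g: "sqint M g"
  shows "(l2n M (\<lambda>x. f x + g x))\<^sup>2 = (l2n M f)\<^sup>2 + 2 * (\<integral>x. f x * g x \<partial>M) + (l2n M g)\<^sup>2"
proof -
  have "(l2n M (\<lambda>x. f x + g x))\<^sup>2 = (\<integral>x. (f x)\<^sup>2 + 2 * (f x * g x) + (g x)\<^sup>2 \<partial>M)"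
    unfolding l2n_sq by (rule Bochner_Integration.integral_cong) (auto simp: power2_sum)
  then show ?thesis
    using assms sqint_mult_integrable[OF f g] by (simp add: l2n_sq sqint_def)
qed

lemma l2n_triangle:
  assumes f: "sqint M f" and g: "sqint M g"
  shows "l2n M (\<lambda>x. f x + g x) \<le> l2n M f + l2n M g"
proof (rule power2_le_imp_le)
  show "(l2n M (\<lambda>x. f x + g x))\<^sup>2 \<le> (l2n M f + l2n M g)\<^sup>2"
    unfolding l2n_add_sq[OF f g] power2_sum using CS_l2n[OF f g] by simp
qed simp

lemma l2n_triangle_diff:
  assumes "sqint M f" and "sqint M g"
  shows "l2n M (\<lambda>x. f x - g x) \<le> l2n M f + l2n M g"
  using l2n_triangle[OF assms(1) sqint_minus[OF assms(2)]] by (simp add: l2n_minus)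

lemma l2n_triangle3:
  assumes "sqint M f" "sqint M g" "sqint M h"
  shows "l2n M (\<lambda>x. f x - h x) \<le> l2n M (\<lambda>x. f x - g x) + l2n M (\<lambda>x. g x - h x)"
  using l2n_triangle[OF sqint_diff[OF assms(1,2)] sqint_diff[OF assms(2,3)]] by simp

lemma l2n_reverse_triangle:
  assumes "sqint M f" "sqint M g"
  shows "\<bar>l2n M f - l2n M g\<bar> \<le> l2n M (\<lambda>x. f x - g x)"
  using l2n_triangle[OF sqint_diff[OF assms] assms(2)]
    l2n_triangle[OF sqint_diff[OF assms(2,1)] assms(1)]
  by (simp add: l2n_minus_commute[of M f g])

lemma l2n_sum_le:
  "(\<And>i. i \<in> I \<Longrightarrow> sqint M (f i)) \<Longrightarrow> l2n M (\<lambda>x. \<Sum>i\<in>I. f i x) \<le> (\<Sum>i\<in>I. l2n M (f i))"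
proof (induction I rule: infinite_finite_induct)
  case (insert i I)
  then show ?case
    using l2n_triangle[of M "f i" "\<lambda>x. \<Sum>i\<in>I. f i x"] sqint_sum[of I M f] by fastforce
qed (auto simp: l2n_def)

lemma l2n_tendsto:
  assumes "\<And>n. sqint M (f n)" "sqint M g" "(\<lambda>n. l2n M (\<lambda>x. f n x - g x)) \<longlonglongrightarrow> 0"
  shows "(\<lambda>n. l2n M (f n)) \<longlonglongrightarrow> l2n M g"
proof -
  have "(\<lambda>n. l2n M (f n) - l2n M g) \<longlonglongrightarrow> 0"
    by (rule tendsto_rabs_zero_cancel, rule tendsto_sandwich[OF _ _ tendsto_const assms(3)])
       (use l2n_reverse_triangle[OF assms(1,2)] in auto)
  then show ?thesis by (rule LIM_zero_cancel)
qed

lemma l2ip_tendsto: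
  assumes "\<And>n. sqint M (f n)" "sqint M g" "sqint M h" "(\<lambda>n. l2n M (\<lambda>x. f n x - g x)) \<longlonglongrightarrow> 0"
  shows "(\<lambda>n. \<integral>x. f n x * h x \<partial>M) \<longlonglongrightarrow> (\<integral>x. g x * h x \<partial>M)"
proof -
  have "\<bar>(\<integral>x. f n x * h x \<partial>M) - (\<integral>x. g x * h x \<partial>M)\<bar> \<le> l2n M (\<lambda>x. f n x - g x) * l2n M h" for n
  proof -
    have "(\<integral>x. f n x * h x \<partial>M) - (\<integral>x. g x * h x \<partial>M) = (\<integral>x. (f n x - g x) * h x \<partial>M)"
      using sqint_mult_integrable[OF assms(1,3)] sqint_mult_integrable[OF assms(2,3)]
      by (simp add: left_diff_distrib)
    then show ?thesis
      using CS_l2n[OF sqint_diff[OF assms(1,2)] assms(3)] by simp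
  qed
  then have "(\<lambda>n. (\<integral>x. f n x * h x \<partial>M) - (\<integral>x. g x * h x \<partial>M)) \<longlonglongrightarrow> 0"
    by (intro tendsto_rabs_zero_cancel[OF tendsto_sandwich[OF _ _ tendsto_const
          tendsto_mult_left_zero[OF assms(4), of "l2n M h"]]]) auto
  then show ?thesis by (rule LIM_zero_cancel)
qed

lemma l2n_limit_unique:
  assumes "\<And>n. sqint M (f n)" "sqint M g" "sqint M h"
    "(\<lambda>n. l2n M (\<lambda>x. f n x - g x)) \<longlonglongrightarrow> 0" "(\<lambda>n. l2n M (\<lambda>x. f n x - h x)) \<longlonglongrightarrow> 0"
  shows "AE x in M. g x = h x"
proof -
  have "l2n M (\<lambda>x. g x - h x) \<le> l2n M (\<lambda>x. f n x - g x) + l2n M (\<lambda>x. f n x - h x)" for n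
    using l2n_triangle3[OF assms(2,1,3)] by (simp add: l2n_minus_commute[of M g])
  then have "l2n M (\<lambda>x. g x - h x) \<le> 0"
    by (intro LIMSEQ_le_const[OF tendsto_add[OF assms(4,5), simplified]]) auto
  then have "l2n M (\<lambda>x. g x - h x) = 0"
    using l2n_nonneg[of M] by (meson order_antisym)
  from l2n_eq_0_AE[OF sqint_diff[OF assms(2,3)] this] show ?thesis by simp
qed

text \<open>The limit is the pointwise one, so that the same formula gives the limit on a product
  space and on its sections.\<close>

theorem riesz_fischer_fast:
  assumes f: "\<And>n. sqint M (f n)"
    and fast: "\<And>n. l2n M (\<lambda>x. f (Suc n) x - f n x) \<le> c n" and "summable c"
  shows "sqint M (\<lambda>x. lim (\<lambda>n. f n x))"
    and "(\<lambda>n. l2n M (\<lambda>x. f n x - lim (\<lambda>n. f n x))) \<longlonglongrightarrow> 0"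
    and "AE x in M. (\<lambda>n. f n x) \<longlonglongrightarrow> lim (\<lambda>n. f n x)"
proof -
  define D where "D n x = \<bar>f (Suc n) x - f n x\<bar>" for n x
  define S where "S N x = (\<Sum>n<N. D n x)" for N x
  have fm: "f n \<in> borel_measurable M" for n using f by (simp add: sqint_def)
  have D: "sqint M (D n)" for n
    unfolding D_def by (rule sqint_bound[OF sqint_diff[OF f f]]) (use fm in auto)
  have lD: "l2n M (D n) \<le> c n" for n
    using fast[of n] by (simp add: D_def l2n_def)
  have S: "sqint M (S N)" for N
    unfolding S_def by (rule sqint_sum) (rule D)
  have c0: "0 \<le> c n" for n using lD[of n] l2n_nonneg order_trans by blast
  \<comment> \<open>Monotone convergence turns this bound, uniform in N, into finiteness of the
    total square, and thus into boundedness of the partial sums at almost every point.\<close>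
  have lS: "l2n M (S N) \<le> suminf c" for N
  proof -
    have "l2n M (S N) \<le> (\<Sum>n<N. l2n M (D n))"
      unfolding S_def by (rule l2n_sum_le) (rule D)
    also have "\<dots> \<le> (\<Sum>n<N. c n)" by (rule sum_mono) (rule lD)
    also have "\<dots> \<le> suminf c" by (rule sum_le_suminf) (use assms c0 in auto)
    finally show ?thesis .
  qed
  have Smono: "mono (\<lambda>N. S N x)" for x
    unfolding S_def by (rule monoI, rule sum_mono2) (auto simp: D_def)
  have S0: "0 \<le> S N x" for N x by (auto simp: S_def D_def intro!: sum_nonneg)
  have "(\<integral>\<^sup>+ x. (SUP N. ennreal ((S N x)\<^sup>2)) \<partial>M) = (SUP N. \<integral>\<^sup>+ x. ennreal ((S N x)\<^sup>2) \<partial>M)"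
  proof (rule nn_integral_monotone_convergence_SUP)
    show "incseq (\<lambda>N x. ennreal ((S N x)\<^sup>2))"
      using Smono S0 by (auto simp: incseq_def le_fun_def mono_def intro!: ennreal_leI power_mono)
    show "(\<lambda>x. ennreal ((S N x)\<^sup>2)) \<in> borel_measurable M" for N
      using S[of N] by (auto simp: sqint_def)
  qed
  also have "\<dots> \<le> ennreal ((suminf c)\<^sup>2)"
  proof (rule SUP_least)
    fix N
    have "(\<integral>\<^sup>+ x. ennreal ((S N x)\<^sup>2) \<partial>M) = ennreal ((l2n M (S N))\<^sup>2)"
      unfolding l2n_sq by (rule nn_integral_eq_integral) (use S in \<open>auto simp: sqint_def\<close>)
    also have "\<dots> \<le> ennreal ((suminf c)\<^sup>2)"
      by (intro ennreal_leI power_mono lS) simp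
    finally show "(\<integral>\<^sup>+ x. ennreal ((S N x)\<^sup>2) \<partial>M) \<le> ennreal ((suminf c)\<^sup>2)" .
  qed
  finally have fin: "(\<integral>\<^sup>+ x. (SUP N. ennreal ((S N x)\<^sup>2)) \<partial>M) < \<infinity>"
    using le_less_trans by fastforce
  have Sm: "S N \<in> borel_measurable M" for N using S by (simp add: sqint_def)
  have AEb: "AE x in M. \<exists>B. \<forall>N. S N x \<le> B"
  proof -
    have "AE x in M. (SUP N. ennreal ((S N x)\<^sup>2)) \<noteq> \<infinity>"
      by (rule nn_integral_PInf_AE) (use fin Sm in auto)
    then show ?thesis
    proof eventually_elim
      case (elim x)
      then obtain B where B: "(SUP N. ennreal ((S N x)\<^sup>2)) = ennreal B" "0 \<le> B"
        by (cases "SUP N. ennreal ((S N x)\<^sup>2)") auto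
      have "ennreal ((S N x)\<^sup>2) \<le> ennreal B" for N
        unfolding B(1)[symmetric] by (rule SUP_upper) simp
      then have "(S N x)\<^sup>2 \<le> B" for N using B(2) by simp
      then have "S N x \<le> sqrt B" for N by (rule real_le_rsqrt)
      then show ?case by blast
    qed
  qed
  have sumD: "summable (\<lambda>n. D n x)" if "\<exists>B. \<forall>N. S N x \<le> B" for x
  proof -
    from that obtain B where "\<forall>N. S N x \<le> B" ..
    then have "(\<Sum>k\<le>n. D k x) \<le> B" for n
      unfolding S_def lessThan_Suc_atMost[symmetric] by blast
    then show ?thesis
      by (intro bounded_imp_summable[of _ B]) (auto simp: D_def)
  qed
  \<comment> \<open>\<open>G\<close> dominates the distance of every \<open>f n\<close> from the
    limit, so it is the majorant both for square integrability of the limit and in the final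
    dominated convergence.\<close>
  define G where "G x = suminf (\<lambda>n. D n x)" for x
  have Gm [measurable]: "G \<in> borel_measurable M"
    unfolding G_def using D by (intro borel_measurable_suminf) (auto simp: sqint_def)
  have Glim: "(\<lambda>N. S N x) \<longlonglongrightarrow> G x" if "\<exists>B. \<forall>N. S N x \<le> B" for x
    unfolding S_def G_def by (rule summable_LIMSEQ[OF sumD[OF that]])
  have G2: "integrable M (\<lambda>x. (G x)\<^sup>2)"
  proof (rule integrableI_bounded)
    have "(\<integral>\<^sup>+ x. ennreal (norm ((G x)\<^sup>2)) \<partial>M) \<le> (\<integral>\<^sup>+ x. (SUP N. ennreal ((S N x)\<^sup>2)) \<partial>M)"
    proof (rule nn_integral_mono_AE, use AEb in eventually_elim)
      case (elim x)
      have "(\<lambda>N. ennreal ((S N x)\<^sup>2)) \<longlonglongrightarrow> ennreal ((G x)\<^sup>2)"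
        by (intro tendsto_ennrealI tendsto_power Glim elim)
      then have "ennreal ((G x)\<^sup>2) \<le> (SUP N. ennreal ((S N x)\<^sup>2))"
        by (rule LIMSEQ_le_const2) (auto intro!: exI[of _ 0] SUP_upper)
      then show ?case by simp
    qed
    with fin show "(\<integral>\<^sup>+ x. ennreal (norm ((G x)\<^sup>2)) \<partial>M) < \<infinity>" by simp
  qed auto
  let ?F = "\<lambda>x. lim (\<lambda>n. f n x)"
  have Fm [measurable]: "?F \<in> borel_measurable M"
    by (rule borel_measurable_lim_metric) (rule fm)
  have conv: "(\<lambda>n. f n x) \<longlonglongrightarrow> ?F x" and bnd: "\<bar>f n x - ?F x\<bar> \<le> G x"
    if B: "\<exists>B. \<forall>N. S N x \<le> B" for x n
  proof -
    have tele: "(\<Sum>k<N. f (Suc k) x - f k x) = f N x - f 0 x" for N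
      by (rule sum_lessThan_telescope)
    have s: "summable (\<lambda>k. f (Suc k) x - f k x)"
      by (rule summable_rabs_cancel) (use sumD[OF B] in \<open>simp add: D_def\<close>)
    have "(\<lambda>N. f N x - f 0 x) \<longlonglongrightarrow> (\<Sum>k. f (Suc k) x - f k x)"
      using summable_LIMSEQ[OF s] by (simp only: tele)
    then have "convergent (\<lambda>N. f N x)"
      using convergent_diff_const_right_iff[of "\<lambda>N. f N x" "f 0 x"] by (auto simp: convergent_def)
    then show c: "(\<lambda>n. f n x) \<longlonglongrightarrow> ?F x" by (simp add: convergent_LIMSEQ_iff)
    have b: "\<bar>f n x - f (n + m) x\<bar> \<le> G x" for m
    proof -
      have "\<bar>f (n + m) x - f n x\<bar> \<le> (\<Sum>k=n..<n+m. D k x)"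
      proof -
        have "f (n + m) x - f n x = (\<Sum>k=n..<n+m. f (Suc k) x - f k x)"
          using sum_Suc_diff'[of n "n + m" "\<lambda>k. f k x"] by simp
        then show ?thesis by (simp add: D_def sum_abs)
      qed
      also have "\<dots> \<le> G x" unfolding G_def
        by (rule sum_le_suminf[OF sumD[OF B]]) (auto simp: D_def)
      finally show ?thesis by linarith
    qed
    have "(\<lambda>m. \<bar>f n x - f (n + m) x\<bar>) \<longlonglongrightarrow> \<bar>f n x - ?F x\<bar>"
      using LIMSEQ_ignore_initial_segment[OF c, of n]
      by (intro tendsto_intros) (simp add: add.commute)
    then show "\<bar>f n x - ?F x\<bar> \<le> G x"
      by (rule LIMSEQ_le_const2) (use b in auto)
  qed
  show AEc: "AE x in M. (\<lambda>n. f n x) \<longlonglongrightarrow> ?F x"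
    using AEb by eventually_elim (rule conv)
  have Gs: "sqint M G" using G2 by (simp add: sqint_def)
  have diff: "sqint M (\<lambda>x. f n x - ?F x)" for n
  proof (rule sqint_bound[OF Gs])
    show "AE x in M. \<bar>f n x - ?F x\<bar> \<le> \<bar>G x\<bar>"
      using AEb by eventually_elim (rule order_trans[OF bnd abs_ge_self])
  qed (use fm in auto)
  show "sqint M ?F"
    using sqint_diff[OF f[of 0] diff[of 0]] by simp
  have "(\<lambda>n. \<integral>x. (f n x - ?F x)\<^sup>2 \<partial>M) \<longlonglongrightarrow> (\<integral>x. 0 \<partial>M)"
  proof (rule integral_dominated_convergence[OF _ _ G2])
    show "AE x in M. (\<lambda>n. (f n x - ?F x)\<^sup>2) \<longlonglongrightarrow> 0"
      using AEc
    proof eventually_elim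
      case (elim x)
      show ?case using tendsto_power[OF LIM_zero[OF elim], of 2] by simp
    qed
    show "AE x in M. norm ((f n x - ?F x)\<^sup>2) \<le> (G x)\<^sup>2" for n
      using AEb
    proof eventually_elim
      case (elim x)
      show ?case using power_mono[OF bnd[OF elim, of n], of 2] by simp
    qed
  qed (use fm in auto)
  then show "(\<lambda>n. l2n M (\<lambda>x. f n x - ?F x)) \<longlonglongrightarrow> 0"
    unfolding l2n_def using tendsto_real_sqrt[of _ 0] by fastforce
qed

text \<open>Reduction to the fast case along indices \<open>r j\<close> whose increments are below
  (1/2)^j; the Cauchy property then carries the limit over to the full sequence.\<close>

theorem riesz_fischer:
  assumes f: "\<And>n. sqint M (f n)"
    and cauchy: "\<And>e. e > 0 \<Longrightarrow> \<exists>N. \<forall>m\<ge>N. \<forall>n\<ge>N. l2n M (\<lambda>x. f m x - f n x) < e"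
  obtains g where "sqint M g" "(\<lambda>n. l2n M (\<lambda>x. f n x - g x)) \<longlonglongrightarrow> 0"
proof -
  obtain K where K: "\<And>j m n. m \<ge> K j \<Longrightarrow> n \<ge> K j \<Longrightarrow> l2n M (\<lambda>x. f m x - f n x) < (1/2)^j"
  proof -
    have "\<forall>j. \<exists>N. \<forall>m\<ge>N. \<forall>n\<ge>N. l2n M (\<lambda>x. f m x - f n x) < (1/2)^j"
      by (intro allI cauchy) simp
    from choice[OF this] show thesis using that by blast
  qed
  define r where "r j = (\<Sum>i\<le>j. K i)" for j
  have r: "K j \<le> r j" "r j \<le> r (Suc j)" for j
    unfolding r_def by (auto intro: member_le_sum)
  let ?h = "\<lambda>j. f (r j)"
  have "l2n M (\<lambda>x. f (r (Suc j)) x - f (r j) x) \<le> (1/2)^j" for j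
    using K[of j "r (Suc j)" "r j"] r[of j] by simp
  note RF = riesz_fischer_fast[where f = ?h and c = "\<lambda>j. (1/2)^j", OF f this summable_geometric]
  let ?g = "\<lambda>x. lim (\<lambda>n. ?h n x)"
  have g: "sqint M ?g" "(\<lambda>n. l2n M (\<lambda>x. ?h n x - ?g x)) \<longlonglongrightarrow> 0" using RF by auto
  have "(\<lambda>n. l2n M (\<lambda>x. f n x - ?g x)) \<longlonglongrightarrow> 0"
  proof (rule LIMSEQ_I)
    fix e :: real assume "e > 0"
    then obtain N where N: "\<And>m n. m \<ge> N \<Longrightarrow> n \<ge> N \<Longrightarrow> l2n M (\<lambda>x. f m x - f n x) < e/2"
      using cauchy[of "e/2"] by auto
    obtain J where J: "\<And>j. j \<ge> J \<Longrightarrow> l2n M (\<lambda>x. ?h j x - ?g x) < e/2"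
      using LIMSEQ_D[OF g(2), of "e/2"] \<open>e > 0\<close> by auto
    have "l2n M (\<lambda>x. f n x - ?g x) < e" if n: "n \<ge> max N (K 0)" for n
    proof -
      obtain i where i: "(1/2::real)^i < e/2"
        using \<open>e > 0\<close> real_arch_pow_inv[of "e/2" "1/2"] by auto
      have "\<exists>N'. \<forall>j\<ge>N'. \<forall>n\<ge>N. l2n M (\<lambda>x. f n x - f (r j) x) < e/2"
      proof -
        have mono: "r a \<le> r b" if "a \<le> b" for a b
          using that r(2) by (rule lift_Suc_mono_le[of r, rotated])
        show ?thesis
        proof (cases "\<exists>j. r j \<ge> N")
          case True
          then show ?thesis using N mono by (meson order_trans)
        next
          \<comment> \<open>\<open>r\<close> increases only weakly and may stay below N. Then every
            \<open>K i\<close> is below N as well, so the threshold of level i already covers all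
            indices in question.\<close>
          case False
          then have lt: "r j < N" for j by (simp add: not_le)
          have "l2n M (\<lambda>x. f n x - f (r j) x) < e/2" if "j \<ge> i" "n \<ge> N" for j n
          proof -
            have "K i \<le> r j" using r(1)[of i] mono[OF \<open>j \<ge> i\<close>] by simp
            moreover have "K i \<le> n" using r(1)[of i] lt[of i] \<open>n \<ge> N\<close> by simp
            ultimately show ?thesis using K[of i n "r j"] i by force
          qed
          then show ?thesis by blast
        qed
      qed
      then obtain N' where N': "\<And>j n. j \<ge> N' \<Longrightarrow> n \<ge> N \<Longrightarrow> l2n M (\<lambda>x. f n x - f (r j) x) < e/2"
        by blast
      show ?thesis
        using l2n_triangle3[OF f[of n] f[of "r (max J N')"] g(1)] N'[of "max J N'" n] J[of "max J N'"] n
        by fastforce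
    qed
    then show "\<exists>no. \<forall>n\<ge>no. norm (l2n M (\<lambda>x. f n x - ?g x) - 0) < e"
      by (intro exI[of _ "max N (K 0)"]) auto
  qed
  with g(1) show thesis using that by blast
qed

section \<open>Integration on bounded open intervals\<close>

abbreviation Lon :: "real \<Rightarrow> real \<Rightarrow> real measure" where
  "Lon a b \<equiv> lebesgue_on {a<..<b}"

lemma finite_measure_Lon: "finite_measure (Lon a b)"
  by (rule finite_measure_lebesgue_on) simp

lemma sigma_finite_Lon: "sigma_finite_measure (Lon a b)"
proof -
  interpret finite_measure "Lon a b" by (rule finite_measure_Lon)
  show ?thesis ..
qed

lemma AE_Lon_iff: "(AE x in Lon a b. P x) \<longleftrightarrow> (AE x in lebesgue. a < x \<and> x < b \<longrightarrow> P x)"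
  by (subst AE_restrict_space_iff) auto

lemma AE_Lon_neq: "AE x in Lon a b. x \<noteq> c"
proof -
  have "AE x in lebesgue. x \<noteq> c"
    using AE_lborel_singleton[of c] by (rule AE_completion)
  then show ?thesis unfolding AE_Lon_iff by eventually_elim auto
qed

lemma AE_Lon_subset: "AE x in Lon a b. P x \<Longrightarrow> a \<le> c \<Longrightarrow> e \<le> b \<Longrightarrow> AE x in Lon c e. P x"
  unfolding AE_Lon_iff by (erule eventually_mono) auto

lemma Lon_measurable_id [measurable]: "(\<lambda>x. x) \<in> borel_measurable (Lon a b)"
  by (rule continuous_imp_measurable_on_sets_lebesgue) (auto intro: continuous_on_id)

lemma continuous_on_measurable_Lon: "continuous_on {a<..<b} f \<Longrightarrow> f \<in> borel_measurable (Lon a b)"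
  by (rule continuous_imp_measurable_on_sets_lebesgue) auto

lemma integrable_Lon_sub:
  fixes f :: "real \<Rightarrow> real"
  assumes "integrable (Lon a b) f" "a \<le> c" "e \<le> b"
  shows "integrable (Lon c e) f"
proof -
  have "integrable lebesgue (\<lambda>x. if x \<in> {a<..<b} then f x else 0)"
    using Lebesgue_Measure.integrable_restrict_UNIV[of "{a<..<b}" f] assms(1) by simp
  then have "integrable lebesgue (\<lambda>x. indicator {c<..<e} x *\<^sub>R (if x \<in> {a<..<b} then f x else 0))"
    by (intro integrable_mult_indicator) auto
  also have "(\<lambda>x. indicator {c<..<e} x *\<^sub>R (if x \<in> {a<..<b} then f x else 0))
      = (\<lambda>x. if x \<in> {c<..<e} then f x else 0)"
    using assms by (auto simp: indicator_def)
  finally show ?thesis using Lebesgue_Measure.integrable_restrict_UNIV[of "{c<..<e}" f] by simp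
qed

text \<open>Moves integrals over varying subintervals to one fixed measure, where linearity and
  Fubini apply.\<close>

lemma Lint_sub:
  fixes f :: "real \<Rightarrow> real"
  assumes "a \<le> c" "e \<le> b"
  shows "(\<integral>x. (if c < x \<and> x < e then f x else 0) \<partial>Lon a b) = integral\<^sup>L (Lon c e) f"
proof -
  have "{c<..<e} \<subseteq> {a<..<b}" using assms by auto
  from integral_restrict[OF this, of f] show ?thesis by simp
qed

lemma Lint_split:
  fixes f :: "real \<Rightarrow> real"
  assumes f: "integrable (Lon a b) f" and c: "a \<le> c" "c \<le> b"
  shows "integral\<^sup>L (Lon a b) f = integral\<^sup>L (Lon a c) f + integral\<^sup>L (Lon c b) f"
proof -
  have i: "integrable (Lon a b) (\<lambda>x. if p x then f x else 0)"
    if [measurable]: "Measurable.pred (Lon a b) p" for p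
    by (rule Bochner_Integration.integrable_bound[OF f]) (use f in auto)
  have "integral\<^sup>L (Lon a b) f = (\<integral>x. (if a < x \<and> x < c then f x else 0) + (if c < x \<and> x < b then f x else 0) \<partial>Lon a b)"
  proof (rule integral_cong_AE)
    show "AE x in Lon a b. f x = (if a < x \<and> x < c then f x else 0) + (if c < x \<and> x < b then f x else 0)"
      using AE_Lon_neq[of c a b] AE_space by eventually_elim auto
    show "f \<in> borel_measurable (Lon a b)" using f by auto
    show "(\<lambda>x. (if a < x \<and> x < c then f x else 0) + (if c < x \<and> x < b then f x else 0)) \<in> borel_measurable (Lon a b)"
      by (intro borel_measurable_add borel_measurable_integrable i) auto
  qed
  also have "\<dots> = integral\<^sup>L (Lon a c) f + integral\<^sup>L (Lon c b) f"
    using c by (subst Bochner_Integration.integral_add) (auto intro!: i simp: Lint_sub)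
  finally show ?thesis .
qed

section \<open>Primitives and integration by parts\<close>

lemma prim_continuous:
  fixes f :: "real \<Rightarrow> real"
  assumes f: "integrable (Lon a b) f"
  shows "continuous_on {a..b} (\<lambda>x. integral\<^sup>L (Lon a x) f)"
proof -
  have "integral\<^sup>L (Lon a x) f = integral {a..x} f" if "x \<in> {a..b}" for x
    using lebesgue_integral_eq_integral[OF integrable_Lon_sub[OF f, of a x]] that
    by (simp add: integral_open_interval_real)
  moreover have "f integrable_on {a..b}"
    using integrable_on_lebesgue_on[OF f] by (simp add: integrable_on_Icc_iff_Ioo)
  ultimately show ?thesis
    using indefinite_integral_continuous_1[of f a b]
      continuous_on_cong[OF refl, of "{a..b}" "\<lambda>x. integral\<^sup>L (Lon a x) f" "\<lambda>x. integral {a..x} f"]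
    by simp
qed

lemma FTC_Lon:
  fixes f :: "real \<Rightarrow> real"
  assumes "a \<le> b" and d: "\<And>x. x \<in> {a..b} \<Longrightarrow> (f has_real_derivative f' x) (at x)"
    and c: "continuous_on {a..b} f'"
  shows "integrable (Lon a b) f'" "integral\<^sup>L (Lon a b) f' = f b - f a"
proof -
  have h: "(f' has_integral (f b - f a)) {a..b}"
    by (rule fundamental_theorem_of_calculus[OF \<open>a \<le> b\<close>])
       (use d in \<open>auto simp: has_real_derivative_iff_has_vector_derivative[symmetric] intro: has_field_derivative_at_within\<close>)
  have "f' absolutely_integrable_on {a..b}"
    using c by (rule absolutely_integrable_continuous_real)
  then have "f' absolutely_integrable_on {a<..<b}"
    by (rule set_integrable_subset) auto
  then show i: "integrable (Lon a b) f'"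
    by (simp add: integrable_restrict_space set_integrable_def)
  show "integral\<^sup>L (Lon a b) f' = f b - f a"
    using lebesgue_integral_eq_integral[OF i] h
    by (simp add: integral_open_interval_real[symmetric] integral_unique)
qed

text \<open>Fubini for f(s) g(t) on the triangle s < t. Since only integrability of \<open>f\<close>
  and \<open>g\<close> enters, it serves weak derivatives in space and integral equations in time
  alike.\<close>

lemma ibp_prim:
  fixes f g :: "real \<Rightarrow> real"
  assumes f: "integrable (Lon a b) f" and g: "integrable (Lon a b) g"
  defines "F \<equiv> \<lambda>x. integral\<^sup>L (Lon a x) f" and "G \<equiv> \<lambda>x. integral\<^sup>L (Lon a x) g"
  shows "(\<integral>x. F x * g x \<partial>Lon a b) = F b * G b - (\<integral>x. f x * G x \<partial>Lon a b)"
proof -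
  let ?M = "Lon a b"
  interpret sigma_finite_measure ?M by (rule sigma_finite_Lon)
  interpret pair_sigma_finite ?M ?M ..
  have [measurable]: "f \<in> borel_measurable ?M" "g \<in> borel_measurable ?M" using f g by auto
  define K where "K s t = (if s < t then f s * g t else 0)" for s t
  have fg: "integrable (?M \<Otimes>\<^sub>M ?M) (\<lambda>p. f (fst p) * g (snd p))"
  proof (rule Fubini_integrable)
    show "integrable ?M (\<lambda>x. \<integral>y. norm (f (fst (x, y)) * g (snd (x, y))) \<partial>?M)"
      using f by (simp add: abs_mult)
    show "AE x in ?M. integrable ?M (\<lambda>y. f (fst (x, y)) * g (snd (x, y)))"
      using g by simp
  qed measurable
  have K: "integrable (?M \<Otimes>\<^sub>M ?M) (case_prod K)"
    by (rule Bochner_Integration.integrable_bound[OF fg]) (auto simp: K_def split_beta')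
  have "(\<integral>t. (\<integral>s. K s t \<partial>?M) \<partial>?M) = (\<integral>s. (\<integral>t. K s t \<partial>?M) \<partial>?M)"
    by (rule Fubini_integral[OF K])
  moreover have "(\<integral>s. K s t \<partial>?M) = F t * g t" if "t \<in> space ?M" for t
  proof -
    have "(\<integral>s. K s t \<partial>?M) = (\<integral>s. (if a < s \<and> s < t then f s else 0) * g t \<partial>?M)"
      by (rule Bochner_Integration.integral_cong) (auto simp: K_def)
    then show ?thesis using that by (simp add: Lint_sub F_def)
  qed
  then have "(\<integral>t. (\<integral>s. K s t \<partial>?M) \<partial>?M) = (\<integral>x. F x * g x \<partial>?M)"
    by (rule Bochner_Integration.integral_cong[OF refl])
  moreover have Ks: "(\<integral>t. K s t \<partial>?M) = f s * G b - f s * G s" if "s \<in> space ?M" for s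
  proof -
    have "(\<integral>t. K s t \<partial>?M) = (\<integral>t. f s * (if s < t \<and> t < b then g t else 0) \<partial>?M)"
      by (rule Bochner_Integration.integral_cong) (auto simp: K_def)
    also have "\<dots> = f s * integral\<^sup>L (Lon s b) g"
      using that by (simp add: Lint_sub)
    also have "integral\<^sup>L (Lon s b) g = G b - G s"
      using Lint_split[OF g, of s] that by (simp add: G_def)
    finally show ?thesis by (simp add: algebra_simps)
  qed
  moreover have "(\<integral>s. (\<integral>t. K s t \<partial>?M) \<partial>?M) = F b * G b - (\<integral>x. f x * G x \<partial>?M)"
  proof -
    have i: "integrable ?M (\<lambda>s. f s * G b)" using f by simp
    have "integrable ?M (\<lambda>s. \<integral>t. K s t \<partial>?M)" by (rule integrable_fst[OF K])
    then have "integrable ?M (\<lambda>s. f s * G b - f s * G s)"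
      by (subst Bochner_Integration.integrable_cong[OF refl Ks[symmetric]]) auto
    from Bochner_Integration.integrable_diff[OF i this]
    have j: "integrable ?M (\<lambda>s. f s * G s)" by simp
    have "(\<integral>s. (\<integral>t. K s t \<partial>?M) \<partial>?M) = (\<integral>s. f s * G b - f s * G s \<partial>?M)"
      by (rule Bochner_Integration.integral_cong[OF refl Ks])
    also have "\<dots> = F b * G b - (\<integral>x. f x * G x \<partial>?M)"
      using Bochner_Integration.integral_diff[OF i j] by (simp add: F_def)
    finally show ?thesis .
  qed
  ultimately show ?thesis by simp
qed

lemma prim_mult_integrable:
  fixes f F :: "real \<Rightarrow> real"
  assumes f: "integrable (Lon a b) f" and F: "continuous_on {a..b} F"
  shows "integrable (Lon a b) (\<lambda>x. F x * f x)"
proof -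
  obtain B where B: "\<And>x. x \<in> {a..b} \<Longrightarrow> \<bar>F x\<bar> \<le> B"
    using compact_imp_bounded[OF compact_continuous_image[OF F compact_Icc]]
    unfolding bounded_iff by fastforce
  have m: "F \<in> borel_measurable (Lon a b)"
    by (rule continuous_on_measurable_Lon) (rule continuous_on_subset[OF F], auto)
  show ?thesis
  proof (rule Bochner_Integration.integrable_bound[OF integrable_mult_right[OF f, of B]])
    show "AE x in Lon a b. norm (F x * f x) \<le> norm (B * f x)"
      using AE_space
    proof eventually_elim
      case (elim x)
      then have "\<bar>F x\<bar> \<le> \<bar>B\<bar>" using B[of x] by auto
      then show ?case by (auto simp: abs_mult intro!: mult_right_mono)
    qed
  qed (use m f in auto)
qed

text \<open>Open intervals form an intersection-stable generator of the Borel sets, and the sets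
  over which \<open>f\<close> has integral zero form a Dynkin system.\<close>

lemma AE_zero_if_interval_integrals_zero:
  fixes f :: "real \<Rightarrow> real"
  assumes f: "integrable (Lon a b) f"
    and z: "\<And>c e. a \<le> c \<Longrightarrow> c \<le> e \<Longrightarrow> e \<le> b \<Longrightarrow> integral\<^sup>L (Lon c e) f = 0"
  shows "AE x in Lon a b. f x = 0"
proof (cases "a < b")
  case False
  then show ?thesis by (intro AE_I2) auto
next
  case True
  let ?M = "Lon a b"
  have [measurable]: "f \<in> borel_measurable ?M" using f by auto
  have total: "integral\<^sup>L ?M f = 0" using z True by auto
  have sM: "A \<inter> {a<..<b} \<in> sets ?M" if "A \<in> sets borel" for A
    using that by (auto simp: sets_restrict_space)
  have si: "integrable ?M (\<lambda>x. indicator A x * f x)" if "A \<in> sets borel" for A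
  proof -
    have "integrable ?M (\<lambda>x. indicator (A \<inter> {a<..<b}) x *\<^sub>R f x)"
      by (rule integrable_mult_indicator[OF sM[OF that] f])
    then show ?thesis
      by (rule Bochner_Integration.integrable_cong[OF refl, THEN iffD1, rotated]) (auto simp: indicator_def)
  qed
  have beq: "(borel :: real measure) = sigma UNIV (range (\<lambda>(a, b). {a<..<b}))"
    using borel_eq_box[where 'a = real] by (simp add: box_real)
  have borel0: "(\<integral>x. indicator A x * f x \<partial>?M) = 0" if "A \<in> sets borel" for A
  proof -
    have A: "A \<in> sigma_sets UNIV (range (\<lambda>(a, b). {a <..< b :: real}))"
      using that unfolding beq by simp
    have stable: "Int_stable (range (\<lambda>(a, b). {a <..< b :: real}))"
    proof (rule Int_stableI)
      fix A B :: "real set"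
      assume "A \<in> range (\<lambda>(a, b). {a <..< b})" "B \<in> range (\<lambda>(a, b). {a <..< b})"
      then obtain p q r s where "A = {p<..<q}" "B = {r<..<s}" by auto
      then have "A \<inter> B = (\<lambda>(a, b). {a <..< b}) (max p r, min q s)" by auto
      then show "A \<inter> B \<in> range (\<lambda>(a, b). {a <..< b})" by blast
    qed
    have sb: "sigma_sets UNIV (range (\<lambda>(a, b). {a <..< b :: real})) = sets borel"
      unfolding beq by simp
    have P: "range (\<lambda>(a, b). {a <..< b :: real}) \<subseteq> Pow UNIV" by auto
    from stable P A show ?thesis
    proof (induction rule: sigma_sets_induct_disjoint)
      case (basic A)
      then obtain p q where "A = {p<..<q}" by auto
      then have "(\<integral>x. indicator A x * f x \<partial>?M) = (\<integral>x. (if max a p < x \<and> x < min b q then f x else 0) \<partial>?M)"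
        by (intro Bochner_Integration.integral_cong) (auto simp: indicator_def)
      also have "\<dots> = integral\<^sup>L (Lon (max a p) (min b q)) f"
        by (rule Lint_sub) auto
      also have "\<dots> = 0"
      proof (cases "max a p \<le> min b q")
        case True
        then show ?thesis by (intro z) auto
      next
        case False
        then have "{max a p<..<min b q} = {}" by auto
        then show ?thesis by (simp only: integral_lebesgue_on_empty)
      qed
      finally show ?case .
    next
      case (compl A)
      then have "A \<in> sets borel" by (simp add: sb)
      note i = si[OF this]
      have "(\<integral>x. indicator (UNIV - A) x * f x \<partial>?M) = (\<integral>x. f x - indicator A x * f x \<partial>?M)"
        by (intro Bochner_Integration.integral_cong) (auto simp: indicator_def)
      also have "\<dots> = 0" using i f compl total by simp
      finally show ?case .
    next
      case (union A)
      have Ab: "A i \<in> sets borel" for i using union(2) sb by auto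
      have "(LINT x:(\<Union>i. A i \<inter> {a<..<b})|?M. f x) = (\<Sum>i. (LINT x:(A i \<inter> {a<..<b})|?M. f x))"
      proof (rule lebesgue_integral_countable_add)
        show "A i \<inter> {a<..<b} \<in> sets ?M" for i by (rule sM[OF Ab])
        show "A i \<inter> {a<..<b} \<inter> (A j \<inter> {a<..<b}) = {}" if "i \<noteq> j" for i j
          using union(1) that by (auto simp: disjoint_family_on_def)
        show "set_integrable ?M (\<Union>i. A i \<inter> {a<..<b}) f"
          unfolding set_integrable_def
          by (rule integrable_mult_indicator[OF _ f]) (use sM[OF Ab] in blast)
      qed
      moreover have "(LINT x:(A i \<inter> {a<..<b})|?M. f x) = 0" for i
        unfolding set_lebesgue_integral_def union(3)[of i, symmetric]
        by (intro Bochner_Integration.integral_cong) (auto simp: indicator_def)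
      moreover have "(LINT x:(\<Union>i. A i \<inter> {a<..<b})|?M. f x) = (\<integral>x. indicator (\<Union>i. A i) x * f x \<partial>?M)"
        unfolding set_lebesgue_integral_def
        by (intro Bochner_Integration.integral_cong) (auto simp: indicator_def)
      ultimately show ?case by simp
    qed auto
  qed
  show ?thesis
  proof (rule density_unique_real[OF f])
    show "integrable ?M (\<lambda>x. 0::real)" by simp
    fix A assume "A \<in> sets ?M"
    then have A: "A \<in> sets lebesgue" "A \<subseteq> {a<..<b}" by (auto simp: sets_restrict_space_iff)
    \<comment> \<open>Uniqueness of densities is tested on Lebesgue sets; each of them agrees with a
      Borel set up to a null set.\<close>
    let ?B = "main_part lborel A"
    have B: "?B \<in> sets borel" using main_part_sets[OF A(1)] by simp
    have "A = ?B \<union> null_part lborel A" using main_part_null_part_Un[OF A(1)] by simp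
    then have Beq: "AE x in lborel. x \<in> A \<longleftrightarrow> x \<in> ?B"
      using AE_notin_null_part[OF A(1)] by (elim eventually_mono) blast
    from Beq have "AE x in lebesgue. x \<in> A \<longleftrightarrow> x \<in> ?B" by (rule AE_completion)
    then have "AE x in ?M. x \<in> A \<longleftrightarrow> x \<in> ?B" unfolding AE_Lon_iff by eventually_elim auto
    then have "(\<integral>x. indicator A x * f x \<partial>?M) = (\<integral>x. indicator ?B x * f x \<partial>?M)"
    proof (intro integral_cong_AE, goal_cases)
      case 1
      then show ?case using \<open>A \<in> sets ?M\<close> by measurable
    next
      case 2
      then show ?case using si[OF B] by auto
    next
      case 3
      then show ?case by eventually_elim (auto simp: indicator_def)
    qed
    then show "(LINT x:A|?M. f x) = (LINT x:A|?M. 0)"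
      using borel0[OF B] by (simp add: set_lebesgue_integral_def)
  qed
qed

section \<open>Test functions\<close>

text \<open>\<open>flat 0\<close> is the classical smooth function exp(-1/y), extended by zero. The
  powers of y in the denominator make the family closed under differentiation, up to linear
  combinations.\<close>

definition flat :: "nat \<Rightarrow> real \<Rightarrow> real" where
  "flat k y = (if y > 0 then exp (- (1 / y)) / y ^ k else 0)"

text \<open>One term of the exponential series is at most the whole sum.\<close>

lemma power_le_fact_exp:
  fixes x :: real
  assumes "0 \<le> x"
  shows "x ^ n \<le> fact n * exp x"
proof -
  have "(\<Sum>k\<in>{n}. x ^ k /\<^sub>R fact k) \<le> (\<Sum>k. x ^ k /\<^sub>R fact k)"
    using assms by (intro sum_le_suminf summable_exp_generic) auto
  also have "\<dots> = exp x" by (simp add: exp_def)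
  finally show ?thesis by (simp add: field_simps)
qed

text \<open>The previous bound at 1/y with exponent k + 1 leaves one spare factor y. This linear
  decay is what makes the difference quotients at the origin tend to 0.\<close>

lemma flat_bound: "\<bar>flat k y\<bar> \<le> fact (Suc k) * \<bar>y\<bar>"
proof (cases "y > 0")
  case True
  have "(1 / y) ^ Suc k \<le> fact (Suc k) * exp (1 / y)"
    using True by (intro power_le_fact_exp) auto
  then have "exp (- (1 / y)) * (1 / y) ^ Suc k \<le> exp (- (1 / y)) * (fact (Suc k) * exp (1 / y))"
    by (intro mult_left_mono) auto
  also have "\<dots> = fact (Suc k)" by (simp add: exp_minus)
  finally have "exp (- (1 / y)) / y ^ k \<le> fact (Suc k) * y"
    using True by (simp add: field_simps power_one_over)
  then show ?thesis using True by (simp add: flat_def)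
next
  case False
  then have "flat k y = 0" by (simp add: flat_def)
  then show ?thesis by (simp only: abs_zero) (intro mult_nonneg_nonneg; simp)
qed

lemma flat_DERIV:
  "(flat k has_real_derivative (flat (k + 2) y - real k * flat (k + 1) y)) (at y)"
proof -
  consider "y > 0" | "y < 0" | "y = 0" by linarith
  then show ?thesis
  proof cases
    case 1
    have "((\<lambda>y. exp (- (1 / y)) / y ^ k) has_real_derivative (flat (k + 2) y - real k * flat (k + 1) y)) (at y)"
    proof -
      have "((\<lambda>y. exp (- (1 / y))) has_real_derivative exp (- (1 / y)) / y\<^sup>2) (at y)"
        using 1 by (auto intro!: derivative_eq_intros simp: power2_eq_square)
      moreover have "((\<lambda>y. y ^ k) has_real_derivative real k * y ^ k / y) (at y)"
        by (rule DERIV_cong[OF DERIV_pow]) (use 1 in \<open>cases k; simp\<close>)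
      ultimately have "((\<lambda>y. exp (- (1 / y)) / y ^ k) has_real_derivative
          (exp (- (1 / y)) / y\<^sup>2 * y ^ k - exp (- (1 / y)) * (real k * y ^ k / y)) / (y ^ k * y ^ k)) (at y)"
        by (rule DERIV_divide) (use 1 in simp)
      then show ?thesis
        by (rule DERIV_cong) (use 1 in \<open>simp add: flat_def field_simps power2_eq_square\<close>)
    qed
    moreover have "\<forall>\<^sub>F x in nhds y. x > 0" using 1 by (rule order_tendstoD[OF filterlim_ident])
    then have "\<forall>\<^sub>F x in nhds y. flat k x = exp (- (1 / x)) / x ^ k"
      by eventually_elim (simp add: flat_def)
    ultimately show ?thesis by (subst DERIV_cong_ev[OF refl _ refl]) auto
  next
    case 2
    have "\<forall>\<^sub>F x in nhds y. x < 0" using 2 by (rule order_tendstoD[OF filterlim_ident])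
    then have "\<forall>\<^sub>F x in nhds y. flat k x = 0"
      by eventually_elim (simp add: flat_def)
    then show ?thesis using 2 by (subst DERIV_cong_ev[OF refl _ refl]) (auto simp: flat_def)
  next
    case 3
    \<comment> \<open>At the origin the difference quotient of one member is the next member of the
      family.\<close>
    have q: "(flat k h - flat k 0) / h = flat (k + 1) h" for h
      by (simp add: flat_def)
    have "((\<lambda>h. flat (k + 1) h) \<longlongrightarrow> 0) (at 0)"
    proof (rule tendsto_rabs_zero_cancel, rule tendsto_sandwich[OF _ _ tendsto_const])
      show "((\<lambda>h::real. fact (Suc (k + 1)) * \<bar>h\<bar>) \<longlongrightarrow> 0) (at 0)"
        by (intro tendsto_eq_intros) auto
    qed (use flat_bound[of "k + 1"] in auto)
    then show ?thesis using 3 unfolding DERIV_def by (simp add: q) (simp add: flat_def)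
  qed
qed

text \<open>An algebra of functions that is closed under differentiation and contains the bumps.\<close>

inductive_set flat_algebra :: "(real \<Rightarrow> real) set" where
  flat: "(\<lambda>x. flat k (c * x + b)) \<in> flat_algebra"
| const: "(\<lambda>x. c) \<in> flat_algebra"
| add: "f \<in> flat_algebra \<Longrightarrow> g \<in> flat_algebra \<Longrightarrow> (\<lambda>x. f x + g x) \<in> flat_algebra"
| mult: "f \<in> flat_algebra \<Longrightarrow> g \<in> flat_algebra \<Longrightarrow> (\<lambda>x. f x * g x) \<in> flat_algebra"

lemma flat_algebra_DERIV:
  "f \<in> flat_algebra \<Longrightarrow> \<exists>f'\<in>flat_algebra. \<forall>x. (f has_real_derivative f' x) (at x)"
proof (induction rule: flat_algebra.induct)
  case (flat k c b)
  have "(\<lambda>x. c * (flat (k + 2) (c * x + b) + (- real k) * flat (k + 1) (c * x + b))) \<in> flat_algebra"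
    by (intro flat_algebra.intros)
  moreover have "((\<lambda>x. flat k (c * x + b)) has_real_derivative
      c * (flat (k + 2) (c * x + b) + (- real k) * flat (k + 1) (c * x + b))) (at x)" for x
    by (rule DERIV_cong[OF DERIV_chain2[where f = "flat k" and g = "\<lambda>x. c * x + b" and Db = c, OF flat_DERIV]])
       (auto intro!: derivative_eq_intros simp: algebra_simps)
  ultimately show ?case by (intro bexI allI)
next
  case (const c)
  have "((\<lambda>x. c) has_real_derivative 0) (at x)" for x by simp
  then show ?case by (intro bexI[of _ "\<lambda>x. 0"] allI flat_algebra.const)
next
  case (add f g)
  then obtain f' g' where "f' \<in> flat_algebra" "g' \<in> flat_algebra"
    "\<And>x. (f has_real_derivative f' x) (at x)" "\<And>x. (g has_real_derivative g' x) (at x)" by blast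
  then show ?case
    by (intro bexI[of _ "\<lambda>x. f' x + g' x"]) (auto intro!: derivative_intros flat_algebra.intros)
next
  case (mult f g)
  then obtain f' g' where "f' \<in> flat_algebra" "g' \<in> flat_algebra"
    "\<And>x. (f has_real_derivative f' x) (at x)" "\<And>x. (g has_real_derivative g' x) (at x)" by blast
  then show ?case using mult.hyps
    by (intro bexI[of _ "\<lambda>x. f' x * g x + g' x * f x"]) (auto intro!: derivative_intros flat_algebra.intros)
qed

lemma flat_algebra_smooth:
  assumes "f \<in> flat_algebra"
  shows "(deriv ^^ n) f differentiable (at x)"
proof -
  have "(deriv ^^ n) f \<in> flat_algebra"
  proof (induction n)
    case (Suc n)
    obtain f' where f': "f' \<in> flat_algebra" "\<And>x. ((deriv ^^ n) f has_real_derivative f' x) (at x)"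
      using flat_algebra_DERIV[OF Suc] by blast
    then have "deriv ((deriv ^^ n) f) = f'" by (auto intro: DERIV_imp_deriv)
    then show ?case using f' by simp
  qed (use assms in simp)
  from flat_algebra_DERIV[OF this] show ?thesis
    using real_differentiable_def by blast
qed

text \<open>Two opposed smooth steps are multiplied and their steepness \<open>m n\<close> is sent
  to infinity: \<open>flat 0\<close> tends to 1 when its argument tends to infinity.\<close>

lemma test_fun_approx_indicator:
  assumes "a \<le> c" "c < e" "e \<le> b"
  obtains \<phi> where "\<And>n. test_fun a b (\<phi> n)" "\<And>n x. 0 \<le> \<phi> n x" "\<And>n x. \<phi> n x \<le> 1"
    "\<And>x. (\<lambda>n. \<phi> n x) \<longlonglongrightarrow> (if c < x \<and> x < e then 1 else 0)"
proof
  \<comment> \<open>The summand 3 / (e - c) keeps the shrunken support, from c + 1/m to e - 1/m,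
    nonempty for every n, including n = 0.\<close>
  define m where "m n = real n + 1 + 3 / (e - c)" for n
  have m: "m n > 0" "3 < (e - c) * m n" for n
  proof -
    have "0 < 3 / (e - c)" using assms by simp
    then show "m n > 0" unfolding m_def by linarith
    have "(e - c) * m n = (e - c) * (real n + 1) + 3" using assms by (simp add: m_def field_simps)
    moreover have "0 < (e - c) * (real n + 1)" using assms by (intro mult_pos_pos) auto
    ultimately show "3 < (e - c) * m n" by simp
  qed
  have mtop: "filterlim m at_top sequentially"
    unfolding m_def
    by (rule filterlim_tendsto_add_at_top[where f = "\<lambda>_. 1 + 3 / (e - c)", THEN filterlim_cong[OF refl refl, THEN iffD1, rotated]])
       (auto intro: filterlim_real_sequentially simp: algebra_simps)
  \<comment> \<open>The offset -1 in both arguments moves the support away from c and e, which may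
    coincide with a and b.\<close>
  let ?\<phi> = "\<lambda>n x. flat 0 (m n * x + (- m n * c - 1)) * flat 0 ((- m n) * x + (m n * e - 1))"
  show "test_fun a b (?\<phi> n)" for n
    unfolding test_fun_def
  proof (intro conjI allI)
    show "(deriv ^^ k) (?\<phi> n) differentiable at x" for k x
      by (rule flat_algebra_smooth) (intro flat_algebra.intros)
    have "c + 1 / m n \<le> e - 1 / m n"
    proof -
      have "2 / m n \<le> e - c" using m[of n] by (simp add: pos_divide_le_eq)
      then show ?thesis by simp
    qed
    moreover have "0 < 1 / m n" using m[of n] by simp
    then have "a < c + 1 / m n" "e - 1 / m n < b"
      using assms by linarith+
    moreover have "?\<phi> n x = 0" if "x \<notin> {c + 1 / m n..e - 1 / m n}" for x
    proof -
      from that have "x < c + 1 / m n \<or> e - 1 / m n < x" by auto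
      then have "m n * x + (- m n * c - 1) < 0 \<or> (- m n) * x + (m n * e - 1) < 0"
        using m[of n] by (auto simp: field_simps)
      then show ?thesis by (auto simp: flat_def)
    qed
    ultimately show "\<exists>c e. a < c \<and> c \<le> e \<and> e < b \<and> (\<forall>x. x \<notin> {c..e} \<longrightarrow> ?\<phi> n x = 0)" by blast
  qed
  have f01: "0 \<le> flat 0 y" "flat 0 y \<le> 1" for y by (auto simp: flat_def)
  show "0 \<le> ?\<phi> n x" "?\<phi> n x \<le> 1" for n x
    using f01 by (auto intro: mult_le_one)
  show "(\<lambda>n. ?\<phi> n x) \<longlonglongrightarrow> (if c < x \<and> x < e then 1 else 0)" for x
  proof -
    have lim1: "(\<lambda>n. flat 0 (m n * y - 1)) \<longlonglongrightarrow> 1" if "y > 0" for y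
    proof -
      have top: "filterlim (\<lambda>n. m n * y - 1) at_top sequentially"
        using filterlim_tendsto_add_at_top[OF tendsto_const[of "- 1"]
            filterlim_tendsto_pos_mult_at_top[OF tendsto_const \<open>y > 0\<close> mtop]]
        by (simp add: algebra_simps)
      have "(\<lambda>n. exp (- (1 / (m n * y - 1)))) \<longlonglongrightarrow> exp (- 0)"
        by (intro tendsto_intros tendsto_divide_0[OF tendsto_const] filterlim_at_top_imp_at_infinity top)
      moreover have "\<forall>\<^sub>F n in sequentially. m n * y - 1 > 0"
        using top unfolding filterlim_at_top_dense by blast
      then have "\<forall>\<^sub>F n in sequentially. exp (- (1 / (m n * y - 1))) = flat 0 (m n * y - 1)"
        by eventually_elim (simp add: flat_def)
      ultimately show ?thesis by (simp add: tendsto_cong)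
    qed
    consider "c < x" "x < e" | "x \<le> c" | "e \<le> x" by linarith
    then show ?thesis
    proof cases
      case 1
      have "(\<lambda>n. flat 0 (m n * (x - c) - 1) * flat 0 (m n * (e - x) - 1)) \<longlonglongrightarrow> 1 * 1"
        using 1 by (intro tendsto_mult lim1) auto
      then show ?thesis using 1 by (simp add: algebra_simps)
    next
      case 2
      have "m n * x + (- m n * c - 1) \<le> 0" for n
        using mult_left_mono[OF 2, of "m n"] m(1)[of n] unfolding mult_minus_left by linarith
      then have "?\<phi> n x = 0" for n by (simp only: flat_def not_less[symmetric] if_False mult_zero_left mult_zero_right)
      then show ?thesis using 2 by (simp only:) simp
    next
      case 3
      have "(- m n) * x + (m n * e - 1) \<le> 0" for n
        using mult_left_mono[OF 3, of "m n"] m(1)[of n] unfolding mult_minus_left by linarith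
      then have "?\<phi> n x = 0" for n by (simp only: flat_def not_less[symmetric] if_False mult_zero_left mult_zero_right)
      then show ?thesis using 3 by (simp only:) simp
    qed
  qed
qed

section \<open>Variational lemmas: testing with smooth functions\<close>

lemma test_funD:
  assumes "test_fun a b \<phi>"
  shows "(\<phi> has_real_derivative deriv \<phi> x) (at x)" "continuous_on S \<phi>" "continuous_on S (deriv \<phi>)"
    "x \<le> a \<Longrightarrow> \<phi> x = 0" "b \<le> x \<Longrightarrow> \<phi> x = 0"
proof -
  have d: "(deriv ^^ n) \<phi> differentiable at x" for n x using assms by (auto simp: test_fun_def)
  have d0: "\<phi> differentiable at x" "deriv \<phi> differentiable at x" for x
    using d[of 0 x] d[of 1 x] by auto
  show "(\<phi> has_real_derivative deriv \<phi> x) (at x)"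
    using d0(1) by (metis DERIV_imp_deriv real_differentiable_def)
  show "continuous_on S \<phi>" "continuous_on S (deriv \<phi>)"
    using d0 by (auto intro!: continuous_at_imp_continuous_on differentiable_imp_continuous_within)
  obtain c e where "a < c" "e < b" "\<And>x. x \<notin> {c..e} \<Longrightarrow> \<phi> x = 0"
    using assms by (auto simp: test_fun_def)
  then show "x \<le> a \<Longrightarrow> \<phi> x = 0" "b \<le> x \<Longrightarrow> \<phi> x = 0" by auto
qed

text \<open>Bumps converge pointwise and boundedly to indicators of subintervals, with |f| as
  majorant, so all integrals of \<open>f\<close> over subintervals vanish.\<close>

lemma fundamental_lemma:
  fixes f :: "real \<Rightarrow> real"
  assumes f: "integrable (Lon a b) f"
    and z: "\<And>\<phi>. test_fun a b \<phi> \<Longrightarrow> (\<integral>x. f x * \<phi> x \<partial>Lon a b) = 0"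
  shows "AE x in Lon a b. f x = 0"
proof (rule AE_zero_if_interval_integrals_zero[OF f])
  fix c e assume ce: "a \<le> c" "c \<le> e" "e \<le> b"
  show "integral\<^sup>L (Lon c e) f = 0"
  proof (cases "c = e")
    case False
    then obtain \<phi> where \<phi>: "\<And>n. test_fun a b (\<phi> n)" "\<And>n x. 0 \<le> \<phi> n x" "\<And>n x. \<phi> n x \<le> 1"
      "\<And>x. (\<lambda>n. \<phi> n x) \<longlonglongrightarrow> (if c < x \<and> x < e then 1 else 0)"
      using test_fun_approx_indicator[of a c e b] ce by auto
    have "(\<lambda>n. \<integral>x. f x * \<phi> n x \<partial>Lon a b) \<longlonglongrightarrow> (\<integral>x. f x * (if c < x \<and> x < e then 1 else 0) \<partial>Lon a b)"
    proof (rule integral_dominated_convergence[where w = "\<lambda>x. \<bar>f x\<bar>"])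
      have [measurable]: "f \<in> borel_measurable (Lon a b)" using f by auto
      have [measurable]: "\<phi> n \<in> borel_measurable (Lon a b)" for n
        by (rule continuous_on_measurable_Lon[OF test_funD(2)[OF \<phi>(1)]])
      show "(\<lambda>x. f x * \<phi> n x) \<in> borel_measurable (Lon a b)" for n by measurable
      show "(\<lambda>x. f x * (if c < x \<and> x < e then 1 else 0)) \<in> borel_measurable (Lon a b)" by measurable
      show "AE x in Lon a b. (\<lambda>n. f x * \<phi> n x) \<longlonglongrightarrow> f x * (if c < x \<and> x < e then 1 else 0)"
        by (intro AE_I2 tendsto_intros \<phi>(4))
      show "AE x in Lon a b. norm (f x * \<phi> n x) \<le> \<bar>f x\<bar>" for n
        using \<phi>(2,3) by (intro AE_I2) (simp add: abs_mult mult_left_le)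
    qed (use f in auto)
    also have "(\<lambda>n. \<integral>x. f x * \<phi> n x \<partial>Lon a b) = (\<lambda>n. 0)" using z[OF \<phi>(1)] by simp
    also have "(\<integral>x. f x * (if c < x \<and> x < e then 1 else 0) \<partial>Lon a b) = integral\<^sup>L (Lon c e) f"
      using Lint_sub[OF ce(1,3), of f] by (simp add: if_distrib cong: if_cong)
    finally show ?thesis by (simp add: LIMSEQ_const_iff)
  qed simp
qed

lemma test_fun_bounded_mult:
  assumes "integrable (Lon a b) f" "test_fun a b \<phi>"
  shows "integrable (Lon a b) (\<lambda>x. f x * \<phi> x)" "integrable (Lon a b) (\<lambda>x. f x * deriv \<phi> x)"
  using prim_mult_integrable[OF assms(1) test_funD(2)[OF assms(2)]]
    prim_mult_integrable[OF assms(1) test_funD(3)[OF assms(2)]] by (simp_all add: mult.commute)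

lemma prim_weak_deriv:
  fixes g :: "real \<Rightarrow> real"
  assumes g: "integrable (Lon a b) g" and \<phi>: "test_fun a b \<phi>" and "a < b"
  shows "(\<integral>x. (C + integral\<^sup>L (Lon a x) g) * deriv \<phi> x \<partial>Lon a b) = - (\<integral>x. g x * \<phi> x \<partial>Lon a b)"
proof -
  have i: "integrable (Lon a b) (deriv \<phi>)" and
    ph: "integral\<^sup>L (Lon a x) (deriv \<phi>) = \<phi> x" if "a \<le> x" for x
    using FTC_Lon[of a _ \<phi> "deriv \<phi>"] test_funD[OF \<phi>] that \<open>a < b\<close> by auto
  note i = i[OF order_refl]
  have b0: "\<phi> b = 0" using test_funD(5)[OF \<phi>] by simp
  have "(\<integral>x. integral\<^sup>L (Lon a x) g * deriv \<phi> x \<partial>Lon a b)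
      = - (\<integral>x. g x * integral\<^sup>L (Lon a x) (deriv \<phi>) \<partial>Lon a b)"
    using ibp_prim[OF g i] ph[of b] b0 \<open>a < b\<close> by simp
  also have "(\<integral>x. g x * integral\<^sup>L (Lon a x) (deriv \<phi>) \<partial>Lon a b) = (\<integral>x. g x * \<phi> x \<partial>Lon a b)"
    by (rule Bochner_Integration.integral_cong) (auto simp: ph)
  finally have 1: "(\<integral>x. integral\<^sup>L (Lon a x) g * deriv \<phi> x \<partial>Lon a b) = - (\<integral>x. g x * \<phi> x \<partial>Lon a b)" .
  have "(\<integral>x. (C + integral\<^sup>L (Lon a x) g) * deriv \<phi> x \<partial>Lon a b)
      = (\<integral>x. C * deriv \<phi> x + integral\<^sup>L (Lon a x) g * deriv \<phi> x \<partial>Lon a b)"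
    by (simp add: algebra_simps)
  also have "\<dots> = C * integral\<^sup>L (Lon a b) (deriv \<phi>) + (\<integral>x. integral\<^sup>L (Lon a x) g * deriv \<phi> x \<partial>Lon a b)"
    using i prim_mult_integrable[OF i prim_continuous[OF g]] by (subst Bochner_Integration.integral_add) auto
  finally show ?thesis using 1 ph[of b] b0 \<open>a < b\<close> by simp
qed

text \<open>Zero mean makes an antiderivative take the same constant value on both sides of the
  support; subtracting this value restores compact support.\<close>

lemma test_fun_antiderivative:
  assumes \<psi>: "test_fun a b \<psi>" and "a < b" and z: "integral\<^sup>L (Lon a b) \<psi> = 0"
  obtains \<phi> where "test_fun a b \<phi>" "deriv \<phi> = \<psi>"
proof -
  have "\<exists>F. \<forall>x::real. - \<infinity> < ereal x \<longrightarrow> ereal x < \<infinity> \<longrightarrow> (F has_vector_derivative \<psi> x) (at x)"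
    by (rule einterval_antiderivative)
       (use test_funD(2)[OF \<psi>, of UNIV] in \<open>auto simp: continuous_on_eq_continuous_at\<close>)
  then obtain F where F: "\<And>x. (F has_real_derivative \<psi> x) (at x)"
    by (auto simp: has_real_derivative_iff_has_vector_derivative)
  obtain c e where ce: "a < c" "c \<le> e" "e < b" "\<And>x. x \<notin> {c..e} \<Longrightarrow> \<psi> x = 0"
    using \<psi> by (auto simp: test_fun_def)
  have left: "F x = F a" if "x < c" for x
  proof (rule DERIV_zero_connected_constant[of "{..<c}" "{}" F])
    show "\<forall>x\<in>{..<c} - {}. (F has_real_derivative 0) (at x)"
      using F ce(4) by (metis Diff_empty atLeastAtMost_iff lessThan_iff not_le)
  qed (use that ce F in \<open>auto intro!: DERIV_continuous_on[of _ F \<psi>] has_field_derivative_at_within[OF F]\<close>)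
  have right: "F x = F b" if "x > e" for x
  proof (rule DERIV_zero_connected_constant[of "{e<..}" "{}" F])
    show "\<forall>x\<in>{e<..} - {}. (F has_real_derivative 0) (at x)"
      using F ce(4) by (metis Diff_empty atLeastAtMost_iff greaterThan_iff not_le)
  qed (use that ce F in \<open>auto intro!: DERIV_continuous_on[of _ F \<psi>] has_field_derivative_at_within[OF F]\<close>)
  have "F b = F a"
    using FTC_Lon(2)[of a b F \<psi>] F test_funD(2)[OF \<psi>] z \<open>a < b\<close> by auto
  define \<phi> where "\<phi> x = F x - F a" for x
  have d: "(\<phi> has_real_derivative \<psi> x) (at x)" for x
    unfolding \<phi>_def using F by (auto intro!: derivative_eq_intros)
  then have D: "deriv \<phi> = \<psi>" by (auto intro: DERIV_imp_deriv)
  have "(deriv ^^ n) \<phi> differentiable at x" for n x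
  proof (cases n)
    case 0
    then show ?thesis using d real_differentiable_def by auto
  next
    case (Suc k)
    then have "(deriv ^^ n) \<phi> = (deriv ^^ k) \<psi>" by (simp add: funpow_Suc_right D del: funpow.simps)
    then show ?thesis using \<psi> by (simp add: test_fun_def)
  qed
  moreover have "\<phi> x = 0" if "x \<notin> {c..e}" for x
    using that left right \<open>F b = F a\<close> by (cases "x < c") (auto simp: \<phi>_def)
  ultimately have "test_fun a b \<phi>" using ce unfolding test_fun_def by blast
  with D show thesis using that by blast
qed

lemma test_fun_add_cmult:
  assumes "test_fun a b \<phi>" "test_fun a b \<psi>"
  shows "test_fun a b (\<lambda>x. \<phi> x + k * \<psi> x)"
proof -
  have d: "(deriv ^^ n) \<phi> differentiable at x" "(deriv ^^ n) \<psi> differentiable at x" for n x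
    using assms by (auto simp: test_fun_def)
  have eq: "(deriv ^^ n) (\<lambda>x. \<phi> x + k * \<psi> x) = (\<lambda>x. (deriv ^^ n) \<phi> x + k * (deriv ^^ n) \<psi> x)" for n
  proof (induction n)
    case (Suc n)
    have "(((deriv ^^ n) \<phi>) has_real_derivative deriv ((deriv ^^ n) \<phi>) x) (at x)"
      "(((deriv ^^ n) \<psi>) has_real_derivative deriv ((deriv ^^ n) \<psi>) x) (at x)" for x
      using d[of n x] by (metis DERIV_imp_deriv real_differentiable_def)+
    then have "((\<lambda>x. (deriv ^^ n) \<phi> x + k * (deriv ^^ n) \<psi> x) has_real_derivative
        deriv ((deriv ^^ n) \<phi>) x + k * deriv ((deriv ^^ n) \<psi>) x) (at x)" for x
      by (auto intro!: derivative_eq_intros)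
    then show ?case unfolding funpow.simps comp_def Suc by (auto intro: DERIV_imp_deriv)
  qed simp
  obtain c e where 1: "a < c" "c \<le> e" "e < b" "\<And>x. x \<notin> {c..e} \<Longrightarrow> \<phi> x = 0"
    using assms(1) by (auto simp: test_fun_def)
  obtain c' e' where 2: "a < c'" "c' \<le> e'" "e' < b" "\<And>x. x \<notin> {c'..e'} \<Longrightarrow> \<psi> x = 0"
    using assms(2) by (auto simp: test_fun_def)
  have "a < min c c' \<and> min c c' \<le> max e e' \<and> max e e' < b \<and>
      (\<forall>x. x \<notin> {min c c'..max e e'} \<longrightarrow> \<phi> x + k * \<psi> x = 0)"
  proof (intro conjI allI impI)
    fix x assume "x \<notin> {min c c'..max e e'}"
    then have "x \<notin> {c..e}" "x \<notin> {c'..e'}" by auto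
    then show "\<phi> x + k * \<psi> x = 0" using 1(4) 2(4) by simp
  qed (use 1 2 in auto)
  then have "\<exists>c e. a < c \<and> c \<le> e \<and> e < b \<and> (\<forall>x. x \<notin> {c..e} \<longrightarrow> \<phi> x + k * \<psi> x = 0)"
    by blast
  moreover have "(deriv ^^ n) (\<lambda>x. \<phi> x + k * \<psi> x) differentiable at x" for n x
    unfolding eq using d by (auto intro!: derivative_intros)
  ultimately show ?thesis unfolding test_fun_def by blast
qed

text \<open>Derivatives of test functions are exactly the test functions of mean zero. An arbitrary
  \<open>\<psi>\<close> becomes one after adding a multiple of a fixed \<open>\<eta>\<close> with
  nonzero integral; \<open>C\<close> is the \<open>\<eta>\<close>-weighted mean of the difference
  between \<open>f\<close> and the primitive of \<open>g\<close>.\<close>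

theorem du_Bois_Reymond:
  fixes f g :: "real \<Rightarrow> real"
  assumes f: "integrable (Lon a b) f" and g: "integrable (Lon a b) g" and "a < b"
    and w: "\<And>\<phi>. test_fun a b \<phi> \<Longrightarrow> (\<integral>x. f x * deriv \<phi> x \<partial>Lon a b) = - (\<integral>x. g x * \<phi> x \<partial>Lon a b)"
  shows "\<exists>C. AE x in Lon a b. f x = C + integral\<^sup>L (Lon a x) g"
proof -
  interpret finite_measure "Lon a b" by (rule finite_measure_Lon)
  let ?G = "\<lambda>x. integral\<^sup>L (Lon a x) g"
  have one: "integrable (Lon a b) (\<lambda>x. 1)" by simp
  have tint: "integrable (Lon a b) \<phi>" if "test_fun a b \<phi>" for \<phi>
    using test_fun_bounded_mult(1)[OF one that] by simp
  \<comment> \<open>If all test functions had mean zero, the fundamental lemma would make the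
    constant 1 vanish almost everywhere.\<close>
  have "\<exists>\<eta>. test_fun a b \<eta> \<and> integral\<^sup>L (Lon a b) \<eta> \<noteq> 0"
  proof (rule ccontr)
    assume "\<not> ?thesis"
    then have "AE x in Lon a b. (1::real) = 0" by (intro fundamental_lemma[OF one]) auto
    then obtain N where N: "N \<in> null_sets (Lon a b)" "{x \<in> space (Lon a b). (1::real) \<noteq> 0} \<subseteq> N"
      unfolding eventually_ae_filter by blast
    have "{a<..<b} \<subseteq> N" using N(2) by auto
    then have "emeasure (Lon a b) {a<..<b} = 0"
      using emeasure_mono[of "{a<..<b}" N "Lon a b"] null_setsD1[OF N(1)] null_setsD2[OF N(1)] by simp
    then show False using \<open>a < b\<close> by (simp add: emeasure_restrict_space)
  qed
  then obtain \<eta> where \<eta>: "test_fun a b \<eta>" "integral\<^sup>L (Lon a b) \<eta> \<noteq> 0" by blast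
  define h where "h x = f x - ?G x" for x
  have Gi: "integrable (Lon a b) ?G"
    using prim_mult_integrable[OF one prim_continuous[OF g]] by simp
  have h: "integrable (Lon a b) h" unfolding h_def using f Gi by simp
  define C where "C = (\<integral>x. h x * \<eta> x \<partial>Lon a b) / integral\<^sup>L (Lon a b) \<eta>"
  have hphi: "(\<integral>x. h x * deriv \<phi> x \<partial>Lon a b) = 0" if \<phi>: "test_fun a b \<phi>" for \<phi>
  proof -
    have "(\<integral>x. h x * deriv \<phi> x \<partial>Lon a b) = (\<integral>x. f x * deriv \<phi> x \<partial>Lon a b) - (\<integral>x. ?G x * deriv \<phi> x \<partial>Lon a b)"
      unfolding h_def left_diff_distrib
      by (rule Bochner_Integration.integral_diff[OF test_fun_bounded_mult(2)[OF f \<phi>] test_fun_bounded_mult(2)[OF Gi \<phi>]])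
    then show ?thesis using w[OF \<phi>] prim_weak_deriv[OF g \<phi> \<open>a < b\<close>, of 0] by simp
  qed
  have "AE x in Lon a b. h x - C = 0"
  proof (rule fundamental_lemma)
    show "integrable (Lon a b) (\<lambda>x. h x - C)" using h by simp
    fix \<psi> assume \<psi>: "test_fun a b \<psi>"
    define k where "k = - integral\<^sup>L (Lon a b) \<psi> / integral\<^sup>L (Lon a b) \<eta>"
    have t: "test_fun a b (\<lambda>x. \<psi> x + k * \<eta> x)" by (rule test_fun_add_cmult[OF \<psi> \<eta>(1)])
    have "integral\<^sup>L (Lon a b) (\<lambda>x. \<psi> x + k * \<eta> x) = 0"
      using tint[OF \<psi>] tint[OF \<eta>(1)] \<eta>(2) by (simp add: k_def)
    then obtain \<phi> where \<phi>: "test_fun a b \<phi>" "deriv \<phi> = (\<lambda>x. \<psi> x + k * \<eta> x)"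
      using test_fun_antiderivative[OF t \<open>a < b\<close>] by blast
    have "0 = (\<integral>x. h x * \<psi> x + k * (h x * \<eta> x) \<partial>Lon a b)"
      using hphi[OF \<phi>(1)] unfolding \<phi>(2) by (simp add: algebra_simps)
    also have "\<dots> = (\<integral>x. h x * \<psi> x \<partial>Lon a b) + k * (\<integral>x. h x * \<eta> x \<partial>Lon a b)"
      using test_fun_bounded_mult(1)[OF h \<psi>] test_fun_bounded_mult(1)[OF h \<eta>(1)] by simp
    also have "k * (\<integral>x. h x * \<eta> x \<partial>Lon a b) = - C * integral\<^sup>L (Lon a b) \<psi>"
      by (simp add: k_def C_def)
    finally show "(\<integral>x. (h x - C) * \<psi> x \<partial>Lon a b) = 0"
      using test_fun_bounded_mult(1)[OF h \<psi>] tint[OF \<psi>] by (simp add: left_diff_distrib)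
  qed
  then have "AE x in Lon a b. f x = C + ?G x" by eventually_elim (simp add: h_def)
  then show ?thesis ..
qed

section \<open>Weak derivatives on the unit interval\<close>

abbreviation nrm :: "(real \<Rightarrow> real) \<Rightarrow> real" where
  "nrm \<equiv> l2n (Lon 0 1)"

lemma L2_iff_sqint: "L2 f \<longleftrightarrow> sqint (Lon 0 1) f"
  by (simp add: L2_def sqint_def Omega_def)

lemma ip_Lon: "ip f g = (\<integral>x. f x * g x \<partial>Lon 0 1)"
  by (simp add: ip_def Omega_def)

lemma ip_self: "ip f f = (nrm f)\<^sup>2"
  by (simp add: ip_Lon l2n_sq flip: power2_eq_square)

lemma ip_commute: "ip f g = ip g f"
  by (simp add: ip_Lon mult.commute)

lemma has_weak_deriv_Lon: "has_weak_deriv f g \<longleftrightarrow>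
   (\<forall>\<phi>. test_fun 0 1 \<phi> \<longrightarrow> (\<integral>x. f x * deriv \<phi> x \<partial>Lon 0 1) = - (\<integral>x. g x * \<phi> x \<partial>Lon 0 1))"
  by (simp add: has_weak_deriv_def Omega_def)

lemma L2_integrable: "L2 f \<Longrightarrow> integrable (Lon 0 1) f"
  unfolding L2_iff_sqint by (rule finite_measure.sqint_integrable[OF finite_measure_Lon])

lemma L2_measurable: "L2 f \<Longrightarrow> f \<in> borel_measurable (Lon 0 1)"
  by (simp add: L2_iff_sqint sqint_def)

lemma L2_add: "L2 f \<Longrightarrow> L2 g \<Longrightarrow> L2 (\<lambda>x. f x + g x)"
  and L2_diff: "L2 f \<Longrightarrow> L2 g \<Longrightarrow> L2 (\<lambda>x. f x - g x)"
  and L2_cmult: "L2 f \<Longrightarrow> L2 (\<lambda>x. c * f x)"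
  by (simp_all add: L2_iff_sqint sqint_add sqint_diff sqint_cmult)

lemma L2_sum: "(\<And>i. i \<in> I \<Longrightarrow> L2 (f i)) \<Longrightarrow> L2 (\<lambda>x. \<Sum>i\<in>I. f i x)"
  by (simp add: L2_iff_sqint sqint_sum)

lemma L2_bounded: "g \<in> borel_measurable (Lon 0 1) \<Longrightarrow> AE x in Lon 0 1. \<bar>g x\<bar> \<le> C \<Longrightarrow> L2 g"
  unfolding L2_iff_sqint by (rule finite_measure.sqint_bounded[OF finite_measure_Lon])

lemma L2_bounded_mult:
  "L2 f \<Longrightarrow> g \<in> borel_measurable (Lon 0 1) \<Longrightarrow> AE x in Lon 0 1. \<bar>g x\<bar> \<le> C \<Longrightarrow> L2 (\<lambda>x. g x * f x)"
  unfolding L2_iff_sqint by (rule sqint_bounded_mult)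

lemma L2_continuous:
  assumes "continuous_on {0..1} f"
  shows "L2 f"
proof -
  obtain B where B: "\<And>x. x \<in> {0..1} \<Longrightarrow> \<bar>f x\<bar> \<le> B"
    using compact_imp_bounded[OF compact_continuous_image[OF assms compact_Icc]]
    unfolding bounded_iff by fastforce
  show ?thesis
    by (rule L2_bounded[of _ B])
       (use B in \<open>auto intro!: continuous_on_measurable_Lon continuous_on_subset[OF assms]\<close>)
qed

lemma ip_add_left: "L2 f \<Longrightarrow> L2 g \<Longrightarrow> L2 h \<Longrightarrow> ip (\<lambda>x. f x + g x) h = ip f h + ip g h"
  unfolding ip_Lon L2_iff_sqint
  using sqint_mult_integrable[of "Lon 0 1"] by (simp add: distrib_right)

lemma ip_diff_left: "L2 f \<Longrightarrow> L2 g \<Longrightarrow> L2 h \<Longrightarrow> ip (\<lambda>x. f x - g x) h = ip f h - ip g h"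
  unfolding ip_Lon L2_iff_sqint
  using sqint_mult_integrable[of "Lon 0 1"] by (simp add: left_diff_distrib)

lemma ip_cmult_left: "ip (\<lambda>x. c * f x) h = c * ip f h"
  by (simp add: ip_Lon mult.assoc)

lemma ip_cmult_right: "ip h (\<lambda>x. c * f x) = c * ip h f"
  by (simp add: ip_Lon mult.left_commute)

lemma ip_add_right: "L2 f \<Longrightarrow> L2 g \<Longrightarrow> L2 h \<Longrightarrow> ip h (\<lambda>x. f x + g x) = ip h f + ip h g"
  by (simp add: ip_commute[of h] ip_add_left)

lemma ip_CS: "L2 f \<Longrightarrow> L2 g \<Longrightarrow> \<bar>ip f g\<bar> \<le> nrm f * nrm g"
  unfolding ip_Lon L2_iff_sqint by (rule CS_l2n)

lemma ip_cong_AE: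
  assumes "f \<in> borel_measurable (Lon 0 1)" "f' \<in> borel_measurable (Lon 0 1)"
    "g \<in> borel_measurable (Lon 0 1)" "g' \<in> borel_measurable (Lon 0 1)"
    "AE x in Lon 0 1. f x = f' x" "AE x in Lon 0 1. g x = g' x"
  shows "ip f g = ip f' g'"
proof -
  have "AE x in Lon 0 1. f x * g x = f' x * g' x"
    using assms(5,6) by eventually_elim simp
  then show ?thesis unfolding ip_Lon by (intro integral_cong_AE) (use assms in auto)
qed

lemma has_weak_deriv_cong_AE:
  assumes m: "f \<in> borel_measurable (Lon 0 1)" "f' \<in> borel_measurable (Lon 0 1)"
    "g \<in> borel_measurable (Lon 0 1)" "g' \<in> borel_measurable (Lon 0 1)"
    and eq: "AE x in Lon 0 1. f x = f' x" "AE x in Lon 0 1. g x = g' x"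
    and w: "has_weak_deriv f g"
  shows "has_weak_deriv f' g'"
proof -
  have "(\<integral>x. f' x * deriv \<phi> x \<partial>Lon 0 1) = - (\<integral>x. g' x * \<phi> x \<partial>Lon 0 1)" if \<phi>: "test_fun 0 1 \<phi>" for \<phi>
  proof -
    have "\<phi> \<in> borel_measurable (Lon 0 1)" "deriv \<phi> \<in> borel_measurable (Lon 0 1)"
      by (rule continuous_on_measurable_Lon[OF test_funD(2)[OF \<phi>]] continuous_on_measurable_Lon[OF test_funD(3)[OF \<phi>]])+
    then show ?thesis
      using ip_cong_AE[OF m(1,2) _ _ eq(1), of "deriv \<phi>" "deriv \<phi>"] ip_cong_AE[OF m(3,4) _ _ eq(2), of \<phi> \<phi>]
        w[unfolded has_weak_deriv_Lon] \<phi> by (simp add: ip_Lon)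
  qed
  then show ?thesis by (simp add: has_weak_deriv_Lon)
qed

lemma has_weak_deriv_linear:
  assumes "L2 f" "L2 f'" "L2 g" "L2 g'" "has_weak_deriv f f'" "has_weak_deriv g g'"
  shows "has_weak_deriv (\<lambda>x. a * f x + b * g x) (\<lambda>x. a * f' x + b * g' x)"
  unfolding has_weak_deriv_Lon
proof (intro allI impI)
  fix \<phi> assume \<phi>: "test_fun 0 1 \<phi>"
  note i = test_fun_bounded_mult[OF L2_integrable \<phi>]
  have "(\<integral>x. (a * f x + b * g x) * deriv \<phi> x \<partial>Lon 0 1)
      = (\<integral>x. a * (f x * deriv \<phi> x) + b * (g x * deriv \<phi> x) \<partial>Lon 0 1)"
    by (simp add: algebra_simps)
  also have "\<dots> = a * (\<integral>x. f x * deriv \<phi> x \<partial>Lon 0 1) + b * (\<integral>x. g x * deriv \<phi> x \<partial>Lon 0 1)"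
    using i(2)[OF assms(1)] i(2)[OF assms(3)] by simp
  also have "\<dots> = - (a * (\<integral>x. f' x * \<phi> x \<partial>Lon 0 1) + b * (\<integral>x. g' x * \<phi> x \<partial>Lon 0 1))"
    using assms(5,6) \<phi> by (simp add: has_weak_deriv_Lon)
  also have "a * (\<integral>x. f' x * \<phi> x \<partial>Lon 0 1) + b * (\<integral>x. g' x * \<phi> x \<partial>Lon 0 1)
      = (\<integral>x. a * (f' x * \<phi> x) + b * (g' x * \<phi> x) \<partial>Lon 0 1)"
    using i(1)[OF assms(2)] i(1)[OF assms(4)] by simp
  finally show "(\<integral>x. (a * f x + b * g x) * deriv \<phi> x \<partial>Lon 0 1)
      = - (\<integral>x. (a * f' x + b * g' x) * \<phi> x \<partial>Lon 0 1)"
    by (simp add: algebra_simps)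
qed

lemma has_weak_deriv_diff:
  assumes "L2 f" "L2 f'" "L2 g" "L2 g'" "has_weak_deriv f f'" "has_weak_deriv g g'"
  shows "has_weak_deriv (\<lambda>x. f x - g x) (\<lambda>x. f' x - g' x)"
  using has_weak_deriv_linear[OF assms, of 1 "-1"] by simp

lemma weak_deriv_prim:
  assumes "L2 f" "L2 g" "has_weak_deriv f g"
  obtains C where "AE x in Lon 0 1. f x = C + integral\<^sup>L (Lon 0 x) g"
  using du_Bois_Reymond[OF L2_integrable[OF assms(1)] L2_integrable[OF assms(2)]] assms(3)
  by (auto simp: has_weak_deriv_Lon)

lemma L2_prim_continuous: "L2 g \<Longrightarrow> continuous_on {0..1} (\<lambda>x. C + integral\<^sup>L (Lon 0 x) g)"
  by (intro continuous_intros prim_continuous L2_integrable)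

lemma prim_has_weak_deriv:
  assumes "L2 g" "f \<in> borel_measurable (Lon 0 1)" "AE x in Lon 0 1. f x = C + integral\<^sup>L (Lon 0 x) g"
  shows "has_weak_deriv f g"
proof (rule has_weak_deriv_cong_AE[of "\<lambda>x. C + integral\<^sup>L (Lon 0 x) g" _ g])
  show "has_weak_deriv (\<lambda>x. C + integral\<^sup>L (Lon 0 x) g) g"
    unfolding has_weak_deriv_Lon using prim_weak_deriv[OF L2_integrable[OF assms(1)]] by simp
  show "(\<lambda>x. C + integral\<^sup>L (Lon 0 x) g) \<in> borel_measurable (Lon 0 1)"
    by (rule L2_measurable[OF L2_continuous[OF L2_prim_continuous[OF assms(1)]]])
  show "AE x in Lon 0 1. C + integral\<^sup>L (Lon 0 x) g = f x" using assms(3) by eventually_elim simp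
qed (use assms L2_measurable in auto)

section \<open>Uniqueness and the selected derivative \<open>wd\<close>\<close>

lemma weak_deriv_unique:
  assumes "L2 g" "L2 h" "has_weak_deriv f g" "has_weak_deriv f h"
  shows "AE x in Lon 0 1. g x = h x"
proof -
  have "AE x in Lon 0 1. g x - h x = 0"
  proof (rule fundamental_lemma)
    show "integrable (Lon 0 1) (\<lambda>x. g x - h x)" using assms L2_integrable by auto
    fix \<phi> assume \<phi>: "test_fun 0 1 \<phi>"
    then show "(\<integral>x. (g x - h x) * \<phi> x \<partial>Lon 0 1) = 0"
      using assms(3,4) test_fun_bounded_mult(1)[OF L2_integrable \<phi>] assms(1,2)
      by (simp add: left_diff_distrib has_weak_deriv_Lon)
  qed
  then show ?thesis by simp
qed

text \<open>\<open>wd\<close> is a choice, fixed only up to null sets. This turns any concrete weak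
  derivative into information about the selected one.\<close>

lemma wd_weak_deriv:
  assumes "L2 g" "has_weak_deriv f g"
  shows "L2 (wd f)" "has_weak_deriv f (wd f)" "AE x in Lon 0 1. wd f x = g x"
proof -
  have "L2 (wd f) \<and> has_weak_deriv f (wd f)"
    unfolding wd_def by (rule someI[of _ g]) (use assms in simp)
  then show "L2 (wd f)" "has_weak_deriv f (wd f)" by auto
  then show "AE x in Lon 0 1. wd f x = g x" by (rule weak_deriv_unique[OF _ assms(1) _ assms(2)])
qed

text \<open>The second \<open>wd\<close> is applied to the selected \<open>wd f\<close> and not to
  \<open>g\<close>; their agreement almost everywhere is what carries \<open>h\<close> over.\<close>

lemma wd_wd_weak_deriv:
  assumes "L2 f" "L2 g" "L2 h" "has_weak_deriv f g" "has_weak_deriv g h"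
  shows "L2 (wd (wd f))" "has_weak_deriv (wd f) (wd (wd f))" "AE x in Lon 0 1. wd (wd f) x = h x"
proof -
  note 1 = wd_weak_deriv[OF assms(2,4)]
  have "AE x in Lon 0 1. g x = wd f x" using 1(3) by eventually_elim simp
  then have "has_weak_deriv (wd f) h"
    using has_weak_deriv_cong_AE[OF L2_measurable[OF assms(2)] L2_measurable[OF 1(1)]
        L2_measurable[OF assms(3)] L2_measurable[OF assms(3)] _ _ assms(5)] by simp
  from wd_weak_deriv[OF assms(3) this]
  show "L2 (wd (wd f))" "has_weak_deriv (wd f) (wd (wd f))" "AE x in Lon 0 1. wd (wd f) x = h x" .
qed

lemma classical_weak_deriv:
  assumes "\<And>x. (f has_real_derivative f' x) (at x)" "continuous_on UNIV f'"
  shows "has_weak_deriv f f'"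
proof (rule prim_has_weak_deriv[of _ _ "f 0"])
  have c: "continuous_on S f" for S
    by (rule DERIV_continuous_on, rule has_field_derivative_at_within, rule assms(1))
  show "L2 f'" by (rule L2_continuous[OF continuous_on_subset[OF assms(2)]]) simp
  show "f \<in> borel_measurable (Lon 0 1)" by (rule continuous_on_measurable_Lon[OF c])
  show "AE x in Lon 0 1. f x = f 0 + integral\<^sup>L (Lon 0 x) f'"
    using AE_space
  proof eventually_elim
    case (elim x)
    then show ?case
      using FTC_Lon(2)[of 0 x f f'] assms(1) continuous_on_subset[OF assms(2), of "{0..x}"] by auto
  qed
qed

section \<open>Zero boundary values in terms of primitives\<close>

lemma continuous_AE_eq:
  fixes f g :: "real \<Rightarrow> real"
  assumes "continuous_on {a..b} f" "continuous_on {a..b} g" "AE x in Lon a b. f x = g x" "a < b" "x \<in> {a..b}"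
  shows "f x = g x"
proof -
  define h where "h x = \<bar>f x - g x\<bar>" for x
  have h: "continuous_on {a..b} h" unfolding h_def using assms by (intro continuous_intros)
  have "integral\<^sup>L (Lon a b) h = integral\<^sup>L (Lon a b) (\<lambda>x. 0)"
  proof (rule integral_cong_AE)
    show "h \<in> borel_measurable (Lon a b)"
      by (rule continuous_on_measurable_Lon[OF continuous_on_subset[OF h]]) auto
    show "AE x in Lon a b. h x = 0" using assms(3) by eventually_elim (simp add: h_def)
  qed simp
  moreover have "h absolutely_integrable_on {a<..<b}"
    by (rule set_integrable_subset[OF absolutely_integrable_continuous_real[OF h]]) auto
  then have i: "integrable (Lon a b) h"
    by (simp add: integrable_restrict_space set_integrable_def)
  ultimately have "integral {a..b} h = 0"
    using lebesgue_integral_eq_integral[OF i] by (simp add: integral_open_interval_real)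
  then have "\<forall>x\<in>{a..b}. h x = 0"
    using integral_eq_0_iff[OF h] assms(4) by (simp add: h_def)
  then show ?thesis using assms(5) by (simp add: h_def)
qed

text \<open>Encodes \<open>f\<close> in \<open>H01\<close> with derivative \<open>g\<close> by
  integrals alone: a primitive without constant vanishes at 0, and total integral zero makes it
  vanish at 1. In this form the boundary values pass to L2 limits.\<close>

definition H01p :: "(real \<Rightarrow> real) \<Rightarrow> (real \<Rightarrow> real) \<Rightarrow> bool" where
  "H01p f g \<longleftrightarrow> L2 f \<and> L2 g \<and> (AE x in Lon 0 1. f x = integral\<^sup>L (Lon 0 x) g) \<and> integral\<^sup>L (Lon 0 1) g = 0"

text \<open>The du Bois-Reymond form C + primitive and the continuous representative from
  \<open>zero_bdry\<close> agree everywhere; evaluation at 0 gives C = 0, evaluation at 1 the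
  vanishing integral.\<close>

lemma H01p_I:
  assumes "L2 f" "L2 g" "has_weak_deriv f g" "zero_bdry f"
  shows "H01p f g"
proof -
  obtain C where C: "AE x in Lon 0 1. f x = C + integral\<^sup>L (Lon 0 x) g"
    using weak_deriv_prim[OF assms(1-3)] .
  obtain w where w: "continuous_on {0..1} w" "AE x in Lon 0 1. w x = f x" "w 0 = 0" "w 1 = 0"
    using assms(4) unfolding zero_bdry_def Omega_def by blast
  have ae: "AE x in Lon 0 1. w x = C + integral\<^sup>L (Lon 0 x) g"
    using C w(2) by eventually_elim simp
  have eq: "w x = C + integral\<^sup>L (Lon 0 x) g" if "x \<in> {0..1}" for x
    by (rule continuous_AE_eq[OF w(1) L2_prim_continuous[OF assms(2)] ae _ that]) simp
  have "C = 0" "integral\<^sup>L (Lon 0 1) g = 0" using eq[of 0] eq[of 1] w by auto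
  then show ?thesis using C assms by (simp add: H01p_def)
qed

lemma H01p_D:
  assumes "H01p f g"
  shows "L2 f" "L2 g" "has_weak_deriv f g" "zero_bdry f"
proof -
  show L: "L2 f" "L2 g" using assms by (auto simp: H01p_def)
  show "has_weak_deriv f g"
    by (rule prim_has_weak_deriv[OF L(2) L2_measurable[OF L(1)], of 0]) (use assms in \<open>simp add: H01p_def\<close>)
  have "AE x in Lon 0 1. integral\<^sup>L (Lon 0 x) g = f x"
    using assms unfolding H01p_def by (auto elim: eventually_mono)
  then show "zero_bdry f"
    unfolding zero_bdry_def Omega_def using L2_prim_continuous[OF L(2), of 0] assms
    by (intro exI[of _ "\<lambda>x. integral\<^sup>L (Lon 0 x) g"]) (auto simp: H01p_def)
qed

text \<open>The boundary values sit on \<open>f\<close> alone: the zero mean of \<open>g\<close>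
  kills both the constant in \<open>p\<close> and the boundary term of the integration by
  parts.\<close>

lemma ip_weak_deriv_H01p:
  assumes fg: "H01p f g" and pq: "L2 p" "L2 q" "has_weak_deriv p q"
  shows "ip p g = - ip q f"
proof -
  note L = H01p_D[OF fg]
  obtain C where C: "AE x in Lon 0 1. p x = C + integral\<^sup>L (Lon 0 x) q"
    using weak_deriv_prim[OF pq] .
  let ?Q = "\<lambda>x. integral\<^sup>L (Lon 0 x) q" and ?G = "\<lambda>x. integral\<^sup>L (Lon 0 x) g"
  have Q: "L2 ?Q" and G: "L2 ?G"
    using L2_continuous[OF L2_prim_continuous[OF pq(2), of 0]] L2_continuous[OF L2_prim_continuous[OF L(2), of 0]]
    by auto
  have c: "L2 (\<lambda>x. C)" by (rule L2_continuous) simp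
  have "ip p g = ip (\<lambda>x. C + ?Q x) g"
    by (rule ip_cong_AE) (use C L pq L2_add[OF c Q] L2_measurable in auto)
  also have "\<dots> = ip (\<lambda>x. C) g + ip ?Q g" by (rule ip_add_left[OF c Q L(2)])
  also have "ip (\<lambda>x. C) g = 0" using fg by (simp add: ip_Lon H01p_def)
  also have "ip ?Q g = - ip q ?G"
    using ibp_prim[OF L2_integrable[OF pq(2)] L2_integrable[OF L(2)]] fg by (simp add: ip_Lon H01p_def)
  also have "ip q ?G = ip q f"
    by (rule ip_cong_AE) (use fg L pq G L2_measurable in \<open>auto simp: H01p_def elim: eventually_mono\<close>)
  finally show ?thesis by simp
qed

lemma H01p_linear:
  assumes "H01p f f'" "H01p g g'"
  shows "H01p (\<lambda>x. a * f x + b * g x) (\<lambda>x. a * f' x + b * g' x)"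
proof -
  note F = H01p_D[OF assms(1)] and G = H01p_D[OF assms(2)]
  have i: "integrable (Lon 0 x) f'" "integrable (Lon 0 x) g'" if "x \<le> 1" for x
    using that integrable_Lon_sub[OF L2_integrable[OF F(2)], of 0 x]
      integrable_Lon_sub[OF L2_integrable[OF G(2)], of 0 x] by auto
  have e: "integral\<^sup>L (Lon 0 x) (\<lambda>x. a * f' x + b * g' x) = a * integral\<^sup>L (Lon 0 x) f' + b * integral\<^sup>L (Lon 0 x) g'"
    if "x \<le> 1" for x using i[OF that] by simp
  have "AE x in Lon 0 1. f x = integral\<^sup>L (Lon 0 x) f'" "AE x in Lon 0 1. g x = integral\<^sup>L (Lon 0 x) g'"
    using assms by (auto simp: H01p_def)
  then have "AE x in Lon 0 1. a * f x + b * g x = integral\<^sup>L (Lon 0 x) (\<lambda>x. a * f' x + b * g' x)"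
    using AE_space
  proof eventually_elim
    case (elim x)
    then show ?case by (subst e) auto
  qed
  then show ?thesis
    using assms F G L2_add[OF L2_cmult L2_cmult] unfolding H01p_def by (simp add: e)
qed

section \<open>Orthonormal bases of sines and cosines\<close>

text \<open>Totality is stated as a trivial orthogonal complement, the property that can be checked
  for trigonometric systems; convergence of expansions then follows by completeness.\<close>

definition onb :: "'a measure \<Rightarrow> (nat \<Rightarrow> 'a \<Rightarrow> real) \<Rightarrow> bool" where
  "onb M e \<longleftrightarrow> (\<forall>k. sqint M (e k)) \<and> (\<forall>j k. (\<integral>x. e j x * e k x \<partial>M) = (if j = k then 1 else 0))
     \<and> (\<forall>g. sqint M g \<longrightarrow> (\<forall>k. (\<integral>x. g x * e k x \<partial>M) = 0) \<longrightarrow> (AE x in M. g x = 0))"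

lemma integral_sum_mult:
  assumes "\<And>k. sqint M (e k)" "sqint M h" "finite I"
  shows "(\<integral>x. (\<Sum>k\<in>I. a k * e k x) * h x \<partial>M) = (\<Sum>k\<in>I. a k * (\<integral>x. e k x * h x \<partial>M))"
  using sqint_mult_integrable[OF assms(1,2)] by (simp add: sum_distrib_right mult.assoc)

lemma l2n_sq_onb_sum:
  assumes "onb M e" "finite I"
  shows "(l2n M (\<lambda>x. \<Sum>k\<in>I. a k * e k x))\<^sup>2 = (\<Sum>k\<in>I. (a k)\<^sup>2)"
proof -
  have e: "sqint M (e k)" and ort: "(\<integral>x. e j x * e k x \<partial>M) = (if j = k then 1 else 0)" for j k
    using assms(1) unfolding onb_def by blast+
  let ?P = "\<lambda>x. \<Sum>k\<in>I. a k * e k x"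
  have P: "sqint M ?P" by (intro sqint_sum sqint_cmult e)
  have "(l2n M ?P)\<^sup>2 = (\<integral>x. ?P x * ?P x \<partial>M)" by (simp add: l2n_sq flip: power2_eq_square)
  also have "\<dots> = (\<Sum>k\<in>I. a k * (\<integral>x. e k x * ?P x \<partial>M))"
    by (rule integral_sum_mult[OF e P assms(2)])
  also have "\<dots> = (\<Sum>k\<in>I. (a k)\<^sup>2)"
  proof (rule sum.cong[OF refl])
    fix k assume k: "k \<in> I"
    have "(\<integral>x. e k x * ?P x \<partial>M) = (\<integral>x. ?P x * e k x \<partial>M)" by (simp add: mult.commute)
    also have "\<dots> = (\<Sum>j\<in>I. a j * (\<integral>x. e j x * e k x \<partial>M))"
      by (rule integral_sum_mult[OF e e assms(2)])
    also have "\<dots> = a k" using assms(2) k by (simp add: ort if_distrib cong: if_cong)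
    finally show "a k * (\<integral>x. e k x * ?P x \<partial>M) = (a k)\<^sup>2" by (simp add: power2_eq_square)
  qed
  finally show ?thesis .
qed

context
  fixes M :: "'a measure" and e :: "nat \<Rightarrow> 'a \<Rightarrow> real" and co :: "('a \<Rightarrow> real) \<Rightarrow> nat \<Rightarrow> real"
  assumes onb: "onb M e"
  defines "co \<equiv> \<lambda>f k. \<integral>x. f x * e k x \<partial>M"
begin

private lemma e: "sqint M (e k)" using onb by (simp add: onb_def)

private lemma ort: "(\<integral>x. e j x * e k x \<partial>M) = (if j = k then 1 else 0)"
  using onb unfolding onb_def by blast

private lemma P: "sqint M (\<lambda>x. \<Sum>k<N. co f k * e k x)"
  by (intro sqint_sum sqint_cmult e)

lemma onb_partial_ip:
  assumes "sqint M g"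
  shows "(\<integral>x. (\<Sum>k<N. co f k * e k x) * g x \<partial>M) = (\<Sum>k<N. co f k * co g k)"
  using integral_sum_mult[OF e assms, of "{..<N}" "co f"] by (simp add: co_def mult.commute)

lemma onb_bessel:
  assumes f: "sqint M f"
  shows "(\<Sum>k<N. (co f k)\<^sup>2) \<le> (l2n M f)\<^sup>2"
proof -
  let ?P = "\<lambda>x. \<Sum>k<N. co f k * e k x"
  have "0 \<le> (l2n M (\<lambda>x. f x + - ?P x))\<^sup>2" by simp
  also have "\<dots> = (l2n M f)\<^sup>2 + 2 * (\<integral>x. f x * - ?P x \<partial>M) + (l2n M ?P)\<^sup>2"
    using l2n_add_sq[OF f sqint_minus[OF P]] by (simp add: l2n_minus)
  also have "(\<integral>x. f x * - ?P x \<partial>M) = - (\<Sum>k<N. (co f k)\<^sup>2)"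
    using onb_partial_ip[OF f, where N = N and f = f] by (simp add: mult.commute power2_eq_square)
  also have "(l2n M ?P)\<^sup>2 = (\<Sum>k<N. (co f k)\<^sup>2)" by (rule l2n_sq_onb_sum[OF onb]) simp
  finally show ?thesis by simp
qed

lemma onb_partial_le:
  assumes f: "sqint M f"
  shows "l2n M (\<lambda>x. \<Sum>k<N. co f k * e k x) \<le> l2n M f"
  by (rule power2_le_imp_le) (use onb_bessel[OF f] l2n_sq_onb_sum[OF onb, of "{..<N}"] in auto)

text \<open>Bessel makes the partial sums Cauchy. Their limit has the coefficients of
  \<open>f\<close>, hence equals \<open>f\<close> by totality.\<close>

lemma onb_converges:
  assumes f: "sqint M f"
  shows "(\<lambda>N. l2n M (\<lambda>x. (\<Sum>k<N. co f k * e k x) - f x)) \<longlonglongrightarrow> 0"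
proof -
  let ?P = "\<lambda>N x. \<Sum>k<N. co f k * e k x"
  have s: "summable (\<lambda>k. (co f k)\<^sup>2)"
  proof (rule bounded_imp_summable[of _ "(l2n M f)\<^sup>2"])
    show "(\<Sum>k\<le>n. (co f k)\<^sup>2) \<le> (l2n M f)\<^sup>2" for n
      using onb_bessel[OF f, of "Suc n"] by (simp add: lessThan_Suc_atMost)
  qed simp
  have sq: "(l2n M (\<lambda>x. ?P m x - ?P n x))\<^sup>2 = (\<Sum>k=n..<m. (co f k)\<^sup>2)" if "n \<le> m" for m n
  proof -
    have "?P m x - ?P n x = (\<Sum>k=n..<m. co f k * e k x)" for x
      using sum_diff_nat_ivl[of 0 n m "\<lambda>k. co f k * e k x"] that by (simp add: atLeast0LessThan)
    then show ?thesis using l2n_sq_onb_sum[OF onb, of "{n..<m}"] by simp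
  qed
  obtain g where g: "sqint M g" "(\<lambda>N. l2n M (\<lambda>x. ?P N x - g x)) \<longlonglongrightarrow> 0"
  proof (rule riesz_fischer[of M ?P])
    show "sqint M (?P n)" for n by (rule P)
    fix r :: real assume "r > 0"
    then obtain N where N: "\<And>m n. m \<ge> N \<Longrightarrow> norm (\<Sum>k=m..<n. (co f k)\<^sup>2) < r\<^sup>2"
      using summable_Cauchy[THEN iffD1, OF s, rule_format, of "r\<^sup>2"] by auto
    have le: "l2n M (\<lambda>x. ?P m x - ?P n x) < r" if "n \<ge> N" "n \<le> m" for m n
    proof (rule power2_less_imp_less)
      show "(l2n M (\<lambda>x. ?P m x - ?P n x))\<^sup>2 < r\<^sup>2"
        unfolding sq[OF that(2)] using N[OF that(1), of m] by simp
    qed (use \<open>r > 0\<close> in simp)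
    have "l2n M (\<lambda>x. ?P m x - ?P n x) < r" if "m \<ge> N" "n \<ge> N" for m n
      using le[of n m] le[of m n] that l2n_minus_commute[of M "?P m" "?P n"] by (cases "n \<le> m") auto
    then show "\<exists>N. \<forall>m\<ge>N. \<forall>n\<ge>N. l2n M (\<lambda>x. ?P m x - ?P n x) < r" by blast
  qed blast
  have "AE x in M. f x - g x = 0"
  proof -
    have "(\<integral>x. (f x - g x) * e k x \<partial>M) = 0" for k
    proof -
      have "(\<lambda>N. \<integral>x. ?P N x * e k x \<partial>M) \<longlonglongrightarrow> (\<integral>x. g x * e k x \<partial>M)"
        by (rule l2ip_tendsto[OF P g(1) e g(2)])
      moreover have "(\<integral>x. ?P N x * e k x \<partial>M) = co f k" if "N > k" for N
      proof -
        have "(\<integral>x. ?P N x * e k x \<partial>M) = (\<Sum>j<N. co f j * (\<integral>x. e j x * e k x \<partial>M))"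
          by (rule integral_sum_mult[OF e e]) simp
        then show ?thesis using that by (simp add: ort if_distrib cong: if_cong)
      qed
      then have "\<forall>\<^sub>F N in sequentially. (\<integral>x. ?P N x * e k x \<partial>M) = co f k"
        using eventually_gt_at_top[of k] by (rule eventually_mono[rotated])
      then have "(\<lambda>N. \<integral>x. ?P N x * e k x \<partial>M) \<longlonglongrightarrow> co f k" by (rule tendsto_eventually)
      ultimately have "(\<integral>x. g x * e k x \<partial>M) = co f k" by (rule LIMSEQ_unique)
      then show ?thesis
        using sqint_mult_integrable[OF f e] sqint_mult_integrable[OF g(1) e]
        by (simp add: left_diff_distrib co_def)
    qed
    moreover have "\<And>h. sqint M h \<Longrightarrow> (\<And>k. (\<integral>x. h x * e k x \<partial>M) = 0) \<Longrightarrow> AE x in M. h x = 0"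
      using onb unfolding onb_def by blast
    ultimately show ?thesis using sqint_diff[OF f g(1)] by blast
  qed
  then have "l2n M (\<lambda>x. ?P N x - g x) = l2n M (\<lambda>x. ?P N x - f x)" for N
    by (intro l2n_cong_AE)
       (use sqint_diff[OF P g(1)] sqint_diff[OF P f] in \<open>auto simp: sqint_def elim: eventually_mono\<close>)
  then show ?thesis using g(2) by simp
qed

text \<open>The second bound is uniform in \<open>N\<close>; it supplies the majorant when mode sums
  are integrated over time.\<close>

lemma onb_parseval:
  assumes f: "sqint M f" and g: "sqint M g"
  shows "(\<lambda>N. \<Sum>k<N. co f k * co g k) \<longlonglongrightarrow> (\<integral>x. f x * g x \<partial>M)"
    and "\<bar>\<Sum>k<N. co f k * co g k\<bar> \<le> l2n M f * l2n M g"
proof -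
  show "(\<lambda>N. \<Sum>k<N. co f k * co g k) \<longlonglongrightarrow> (\<integral>x. f x * g x \<partial>M)"
    using l2ip_tendsto[OF P f g onb_converges[OF f]] unfolding onb_partial_ip[OF g] .
  have "\<bar>\<Sum>k<N. co f k * co g k\<bar> \<le> l2n M (\<lambda>x. \<Sum>k<N. co f k * e k x) * l2n M g"
    unfolding onb_partial_ip[OF g, symmetric] by (rule CS_l2n[OF P g])
  also have "\<dots> \<le> l2n M f * l2n M g"
    by (intro mult_right_mono onb_partial_le[OF f]) simp
  finally show "\<bar>\<Sum>k<N. co f k * co g k\<bar> \<le> l2n M f * l2n M g" .
qed

end

section \<open>The sine and cosine systems on the unit interval\<close>

definition lam :: "nat \<Rightarrow> real" where "lam k = real (Suc k) * pi"
definition es :: "nat \<Rightarrow> real \<Rightarrow> real" where "es k x = sqrt 2 * sin (lam k * x)"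
definition ec :: "nat \<Rightarrow> real \<Rightarrow> real" where "ec k x = sqrt 2 * cos (lam k * x)"
text \<open>The modes \<open>es k\<close> and \<open>ec k\<close> start at frequency pi, so the
  cosine basis has the constant put in front. The index shift reappears wherever sine sums are
  differentiated.\<close>

definition cb :: "nat \<Rightarrow> real \<Rightarrow> real" where "cb k = (case k of 0 \<Rightarrow> (\<lambda>x. 1) | Suc j \<Rightarrow> ec j)"

lemma es_DERIV: "(es k has_real_derivative lam k * ec k x) (at x)"
  unfolding es_def ec_def by (auto intro!: derivative_eq_intros)

lemma ec_DERIV: "(ec k has_real_derivative - lam k * es k x) (at x)"
  unfolding es_def ec_def by (auto intro!: derivative_eq_intros)

lemma continuous_es: "continuous_on S (es k)" and continuous_ec: "continuous_on S (ec k)"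
  unfolding es_def ec_def by (intro continuous_intros)+

lemma L2_es: "L2 (es k)" and L2_ec: "L2 (ec k)"
  by (auto intro: L2_continuous continuous_es continuous_ec)

lemma weak_deriv_es: "has_weak_deriv (es k) (\<lambda>x. lam k * ec k x)"
  by (rule classical_weak_deriv[OF es_DERIV]) (intro continuous_intros continuous_ec)

lemma weak_deriv_ec: "has_weak_deriv (ec k) (\<lambda>x. - lam k * es k x)"
  by (rule classical_weak_deriv[OF ec_DERIV]) (intro continuous_intros continuous_es)

lemma es_boundary: "es k 0 = 0" "es k 1 = 0"
  by (simp_all add: es_def lam_def del: of_nat_Suc)

lemma H01p_es: "H01p (es k) (\<lambda>x. lam k * ec k x)"
proof (rule H01p_I[OF L2_es L2_cmult[OF L2_ec] weak_deriv_es])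
  show "zero_bdry (es k)"
    unfolding zero_bdry_def
    by (intro exI[of _ "es k"] conjI continuous_es) (auto simp: es_boundary)
qed

lemma integral_cos_int:
  "(\<integral>x. cos (of_int m * pi * x) \<partial>Lon 0 1) = (if m = 0 then 1 else 0)"
proof (cases "m = 0")
  case True
  then show ?thesis by (simp add: measure_restrict_space)
next
  case False
  have "(\<integral>x. cos (of_int m * pi * x) \<partial>Lon 0 1)
      = sin (of_int m * pi * 1) / (of_int m * pi) - sin (of_int m * pi * 0) / (of_int m * pi)"
    by (rule FTC_Lon(2)[where f = "\<lambda>x. sin (of_int m * pi * x) / (of_int m * pi)"])
       (use False in \<open>auto intro!: derivative_eq_intros continuous_intros\<close>)
  then show ?thesis using False by (simp add: sin_npi_int mult.commute[of _ pi])
qed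

lemma cos_int_integrable: "integrable (Lon 0 1) (\<lambda>x. cos (of_int m * pi * x))"
  by (rule L2_integrable[OF L2_continuous]) (intro continuous_intros)

lemma es_orthonormal: "(\<integral>x. es j x * es k x \<partial>Lon 0 1) = (if j = k then 1 else 0)"
proof -
  have "es j x * es k x = cos (of_int (int j - int k) * pi * x) - cos (of_int (int j + int k + 2) * pi * x)" for x
  proof -
    have "es j x * es k x = 2 * (sin (lam j * x) * sin (lam k * x))"
      by (simp add: es_def)
    also have "\<dots> = cos (lam j * x - lam k * x) - cos (lam j * x + lam k * x)"
      by (simp add: sin_times_sin)
    finally show ?thesis by (simp add: lam_def algebra_simps)
  qed
  then have "(\<integral>x. es j x * es k x \<partial>Lon 0 1)
    = (\<integral>x. cos (of_int (int j - int k) * pi * x) \<partial>Lon 0 1) - (\<integral>x. cos (of_int (int j + int k + 2) * pi * x) \<partial>Lon 0 1)"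
    by (simp only: Bochner_Integration.integral_diff[OF cos_int_integrable cos_int_integrable])
  then show ?thesis unfolding integral_cos_int by auto
qed

lemma ec_orthonormal: "(\<integral>x. ec j x * ec k x \<partial>Lon 0 1) = (if j = k then 1 else 0)"
proof -
  have "ec j x * ec k x = cos (of_int (int j - int k) * pi * x) + cos (of_int (int j + int k + 2) * pi * x)" for x
  proof -
    have "ec j x * ec k x = 2 * (cos (lam j * x) * cos (lam k * x))"
      by (simp add: ec_def)
    also have "\<dots> = cos (lam j * x - lam k * x) + cos (lam j * x + lam k * x)"
      by (simp add: cos_times_cos)
    finally show ?thesis by (simp add: lam_def algebra_simps)
  qed
  then have "(\<integral>x. ec j x * ec k x \<partial>Lon 0 1)
    = (\<integral>x. cos (of_int (int j - int k) * pi * x) \<partial>Lon 0 1) + (\<integral>x. cos (of_int (int j + int k + 2) * pi * x) \<partial>Lon 0 1)"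
    by (simp only: Bochner_Integration.integral_add[OF cos_int_integrable cos_int_integrable])
  then show ?thesis unfolding integral_cos_int by auto
qed

lemma integral_ec: "integral\<^sup>L (Lon 0 1) (ec k) = 0"
  using integral_cos_int[of "int k + 1"] unfolding ec_def lam_def by (simp add: algebra_simps)

text \<open>Test functions on the unit interval are uniform limits of polynomials in \<open>cos (pi * x)\<close>.\<close>

lemma cos_total:
  assumes g: "integrable (Lon 0 1) g"
    and z: "\<And>k. (\<integral>x. g x * cos (real k * pi * x) \<partial>Lon 0 1) = 0"
  shows "AE x in Lon 0 1. g x = 0"
proof (rule fundamental_lemma[OF g])
  fix \<phi> assume \<phi>: "test_fun 0 1 \<phi>"
  have gi: "integrable (Lon 0 1) (\<lambda>x. g x * h x)" if "continuous_on {0..1} h" for h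
    using prim_mult_integrable[OF g that] by (simp add: mult.commute)
  \<comment> \<open>Multiplication by cos(pi x) replaces a cosine mode by the mean of its two
    neighbours, so orthogonality to all modes spreads to all powers of cos(pi x).\<close>
  have "\<forall>k. (\<integral>x. g x * (cos (pi * x) ^ n * cos (real k * pi * x)) \<partial>Lon 0 1) = 0" for n
  proof (induction n)
    case (Suc n)
    show ?case
    proof
      fix k :: nat
      \<comment> \<open>The lower neighbour of mode 0 has frequency -1, which is mode 1 by
        parity.\<close>
      define k' where "k' = (if k = 0 then 1 else k - 1)"
      have eq: "cos (pi * x) * cos (real k * pi * x) = (cos (real (Suc k) * pi * x) + cos (real k' * pi * x)) / 2" for x
      proof -
        have "cos (pi * x - real k * pi * x) = cos (real k' * pi * x)"
          using cos_minus[of "real (k - 1) * pi * x"] by (cases k) (auto simp: k'_def algebra_simps)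
        then show ?thesis
          by (simp add: cos_times_cos algebra_simps)
      qed
      have "g x * (cos (pi * x) ^ Suc n * cos (real k * pi * x))
          = (1/2) * (g x * (cos (pi * x) ^ n * cos (real (Suc k) * pi * x)))
            + (1/2) * (g x * (cos (pi * x) ^ n * cos (real k' * pi * x)))" for x
      proof -
        have "g x * (cos (pi * x) ^ Suc n * cos (real k * pi * x))
          = g x * cos (pi * x) ^ n * (cos (pi * x) * cos (real k * pi * x))" by simp
        then show ?thesis unfolding eq by (simp add: field_simps)
      qed
      then have "(\<integral>x. g x * (cos (pi * x) ^ Suc n * cos (real k * pi * x)) \<partial>Lon 0 1)
        = (1/2) * (\<integral>x. g x * (cos (pi * x) ^ n * cos (real (Suc k) * pi * x)) \<partial>Lon 0 1)
        + (1/2) * (\<integral>x. g x * (cos (pi * x) ^ n * cos (real k' * pi * x)) \<partial>Lon 0 1)"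
        by (simp only: Bochner_Integration.integral_add[OF integrable_mult_right integrable_mult_right]
            integral_mult_right_zero gi continuous_intros)
      then show "(\<integral>x. g x * (cos (pi * x) ^ Suc n * cos (real k * pi * x)) \<partial>Lon 0 1) = 0"
        using Suc by (simp only: mult_zero_right add_0)
    qed
  qed (use z in simp)
  from this[rule_format, of _ 0]
  have pow0: "(\<integral>x. g x * cos (pi * x) ^ n \<partial>Lon 0 1) = 0" for n by simp
  \<comment> \<open>In the variable y = cos(pi x) the test function is continuous on [-1, 1], where
    polynomial approximation applies.\<close>
  define h where "h y = \<phi> (arccos y / pi)" for y
  have h: "continuous_on {-1..1} h" unfolding h_def
    by (rule continuous_on_compose2[OF test_funD(2)[OF \<phi>, of UNIV]]) (auto intro!: continuous_intros)
  have hcos: "h (cos (pi * x)) = \<phi> x" if "x \<in> {0..1}" for x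
    using that arccos_cos[of "pi * x"] by (simp add: h_def)
  have "\<bar>\<integral>x. g x * \<phi> x \<partial>Lon 0 1\<bar> \<le> r * (\<integral>x. \<bar>g x\<bar> \<partial>Lon 0 1)" if "r > 0" for r
  proof -
    obtain p where p: "real_polynomial_function p" "\<And>y. y \<in> {-1..1} \<Longrightarrow> \<bar>h y - p y\<bar> < r"
      using Stone_Weierstrass_real_polynomial_function[OF _ h \<open>r > 0\<close>] by auto
    then obtain a n where pa: "\<And>y. p y = (\<Sum>i\<le>n. a i * y ^ i)"
      unfolding real_polynomial_function_iff_sum by auto
    have cp: "continuous_on {0..1} (\<lambda>x. p (cos (pi * x)))"
      unfolding pa by (intro continuous_intros)
    have "(\<integral>x. g x * p (cos (pi * x)) \<partial>Lon 0 1) = (\<Sum>i\<le>n. a i * (\<integral>x. g x * cos (pi * x) ^ i \<partial>Lon 0 1))"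
    proof -
      have "(\<integral>x. g x * p (cos (pi * x)) \<partial>Lon 0 1) = (\<integral>x. (\<Sum>i\<le>n. a i * (g x * cos (pi * x) ^ i)) \<partial>Lon 0 1)"
        unfolding pa by (simp add: sum_distrib_left mult.left_commute)
      also have "\<dots> = (\<Sum>i\<le>n. a i * (\<integral>x. g x * cos (pi * x) ^ i \<partial>Lon 0 1))"
        by (subst Bochner_Integration.integral_sum) (auto intro!: gi continuous_intros)
      finally show ?thesis .
    qed
    then have p0: "(\<integral>x. g x * p (cos (pi * x)) \<partial>Lon 0 1) = 0" by (simp add: pow0)
    have i: "integrable (Lon 0 1) (\<lambda>x. g x * \<phi> x)" "integrable (Lon 0 1) (\<lambda>x. g x * p (cos (pi * x)))"
      by (intro gi test_funD(2)[OF \<phi>] cp)+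
    have "(\<integral>x. g x * \<phi> x \<partial>Lon 0 1) = (\<integral>x. g x * \<phi> x - g x * p (cos (pi * x)) \<partial>Lon 0 1)"
      using i p0 by simp
    also have "\<bar>\<dots>\<bar> \<le> (\<integral>x. \<bar>g x * \<phi> x - g x * p (cos (pi * x))\<bar> \<partial>Lon 0 1)"
      by (rule integral_abs_bound)
    also have "\<dots> \<le> (\<integral>x. r * \<bar>g x\<bar> \<partial>Lon 0 1)"
    proof (rule integral_mono)
      show "integrable (Lon 0 1) (\<lambda>x. \<bar>g x * \<phi> x - g x * p (cos (pi * x))\<bar>)" using i by auto
      show "integrable (Lon 0 1) (\<lambda>x. r * \<bar>g x\<bar>)" using g by auto
      fix x assume "x \<in> space (Lon 0 1)"
      then have x: "x \<in> {0..1}" by auto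
      have "\<bar>\<phi> x - p (cos (pi * x))\<bar> < r"
        using p(2)[of "cos (pi * x)"] hcos[OF x] by simp
      then have "\<bar>g x\<bar> * \<bar>\<phi> x - p (cos (pi * x))\<bar> \<le> \<bar>g x\<bar> * r" by (intro mult_left_mono) auto
      then show "\<bar>g x * \<phi> x - g x * p (cos (pi * x))\<bar> \<le> r * \<bar>g x\<bar>"
        by (simp add: abs_mult[symmetric] right_diff_distrib mult.commute)
    qed
    finally show ?thesis by simp
  qed
  note b = this
  show "(\<integral>x. g x * \<phi> x \<partial>Lon 0 1) = 0"
  proof (rule ccontr)
    assume n: "(\<integral>x. g x * \<phi> x \<partial>Lon 0 1) \<noteq> 0"
    define A where "A = (\<integral>x. \<bar>g x\<bar> \<partial>Lon 0 1)"
    have "0 \<le> A" by (simp add: A_def)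
    \<comment> \<open>With I the integral in question, this radius turns the estimate into |I| (A +
      1) \<le> |I| A, absurd for I nonzero.\<close>
    have pos: "0 < \<bar>\<integral>x. g x * \<phi> x \<partial>Lon 0 1\<bar> / (A + 1)" using n \<open>0 \<le> A\<close> by simp
    have "\<bar>\<integral>x. g x * \<phi> x \<partial>Lon 0 1\<bar> * (A + 1) \<le> \<bar>\<integral>x. g x * \<phi> x \<partial>Lon 0 1\<bar> * A"
      using b[OF pos] \<open>0 \<le> A\<close> unfolding A_def[symmetric] by (simp add: field_simps)
    then show False using n by (simp add: algebra_simps)
  qed
qed

lemma onb_cb: "onb (Lon 0 1) cb"
proof -
  have L: "sqint (Lon 0 1) (cb k)" for k
    unfolding L2_iff_sqint[symmetric] cb_def
    by (cases k) (auto intro!: L2_continuous continuous_ec)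
  have o: "(\<integral>x. cb j x * cb k x \<partial>Lon 0 1) = (if j = k then 1 else 0)" for j k
    using ec_orthonormal integral_ec integral_cos_int[of 0]
    by (cases j; cases k) (auto simp: cb_def)
  have "AE x in Lon 0 1. g x = 0" if g: "sqint (Lon 0 1) g" and z: "\<And>k. (\<integral>x. g x * cb k x \<partial>Lon 0 1) = 0" for g
  proof (rule cos_total)
    show "integrable (Lon 0 1) g" using g L2_integrable L2_iff_sqint by blast
    show "(\<integral>x. g x * cos (real k * pi * x) \<partial>Lon 0 1) = 0" for k
    proof (cases k)
      case 0
      then show ?thesis using z[of 0] by (simp add: cb_def)
    next
      case (Suc j)
      have "(\<integral>x. g x * cb (Suc j) x \<partial>Lon 0 1) = sqrt 2 * (\<integral>x. g x * cos (real k * pi * x) \<partial>Lon 0 1)"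
      proof -
        have "g x * cb (Suc j) x = sqrt 2 * (g x * cos (real k * pi * x))" for x
          by (simp add: cb_def ec_def lam_def Suc)
        then show ?thesis by (simp only: integral_mult_right_zero)
      qed
      then show ?thesis using z[of "Suc j"] by simp
    qed
  qed
  with L o show ?thesis by (simp add: onb_def)
qed

text \<open>If \<open>g\<close> is orthogonal to all sines, product formulas make g sin(pi x)
  orthogonal to all cosines, hence zero; and sin(pi x) is positive inside the interval.\<close>

lemma onb_es: "onb (Lon 0 1) es"
proof -
  have L: "sqint (Lon 0 1) (es k)" for k using L2_es by (simp add: L2_iff_sqint)
  have "AE x in Lon 0 1. g x = 0" if g: "sqint (Lon 0 1) g" and z: "\<And>k. (\<integral>x. g x * es k x \<partial>Lon 0 1) = 0" for g
  proof -
    have gi: "integrable (Lon 0 1) g" using g L2_integrable L2_iff_sqint by blast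
    have s: "integrable (Lon 0 1) (\<lambda>x. g x * sin (real k * pi * x))" for k
      using prim_mult_integrable[OF gi, of "\<lambda>x. sin (real k * pi * x)"]
      by (simp add: mult.commute continuous_intros)
    have z': "(\<integral>x. g x * sin (real k * pi * x) \<partial>Lon 0 1) = 0" for k
    proof (cases k)
      case (Suc j)
      have "(\<integral>x. g x * es j x \<partial>Lon 0 1) = sqrt 2 * (\<integral>x. g x * sin (real k * pi * x) \<partial>Lon 0 1)"
      proof -
        have "g x * es j x = sqrt 2 * (g x * sin (real k * pi * x))" for x
          by (simp add: es_def lam_def Suc)
        then show ?thesis by (simp only: integral_mult_right_zero)
      qed
      then show ?thesis using z[of j] by simp
    qed simp
    have "AE x in Lon 0 1. g x * sin (pi * x) = 0"
    proof (rule cos_total)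
      show "integrable (Lon 0 1) (\<lambda>x. g x * sin (pi * x))" using s[of 1] by simp
      fix k :: nat
      \<comment> \<open>The sign treats k = 0, the only case in which the difference frequency 1 - k
        is positive.\<close>
      define c :: real where "c = (if k = 0 then -1 else 1)"
      define k' where "k' = (if k = 0 then 1 else k - 1)"
      have eq: "sin (pi * x) * cos (real k * pi * x) = (sin (real (Suc k) * pi * x) - c * sin (real k' * pi * x)) / 2" for x
      proof -
        have "sin (pi * x - real k * pi * x) = - (c * sin (real k' * pi * x))"
          using sin_minus[of "real (k - 1) * pi * x"] by (cases k) (auto simp: c_def k'_def algebra_simps)
        then show ?thesis by (simp add: sin_times_cos algebra_simps)
      qed
      have "g x * sin (pi * x) * cos (real k * pi * x)
        = (1/2) * (g x * sin (real (Suc k) * pi * x)) - (c / 2) * (g x * sin (real k' * pi * x))" for x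
        unfolding mult.assoc[of "g x" "sin (pi * x)"] eq by (simp add: field_simps)
      then have "(\<integral>x. g x * sin (pi * x) * cos (real k * pi * x) \<partial>Lon 0 1)
        = (1/2) * (\<integral>x. g x * sin (real (Suc k) * pi * x) \<partial>Lon 0 1) - (c / 2) * (\<integral>x. g x * sin (real k' * pi * x) \<partial>Lon 0 1)"
        by (simp only: Bochner_Integration.integral_diff[OF integrable_mult_right integrable_mult_right]
            integral_mult_right_zero s)
      then show "(\<integral>x. g x * sin (pi * x) * cos (real k * pi * x) \<partial>Lon 0 1) = 0"
        by (simp only: z' mult_zero_right diff_zero)
    qed
    then show ?thesis using AE_space
    proof eventually_elim
      case (elim x)
      have "sin (pi * x) > 0" by (rule sin_gt_zero) (use elim in auto)
      then show ?case using elim by simp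
    qed
  qed
  with L es_orthonormal show ?thesis by (simp add: onb_def)
qed

section \<open>Sections of functions on the space-time cylinder\<close>

text \<open>Lebesgue measure on the plane is a completion, so single sections of a measurable
  function may be nonmeasurable. A Borel representative agrees with it on almost every
  section.\<close>

lemma lebesgue_section_measurable:
  fixes F :: "real \<times> real \<Rightarrow> real"
  assumes "F \<in> borel_measurable lebesgue"
  shows "AE t in lebesgue. (\<lambda>x. F (t, x)) \<in> borel_measurable lebesgue"
proof -
  obtain G where G: "G \<in> borel_measurable lborel" "AE p in lborel. F p = G p"
    using completion_ex_borel_measurable_real[OF assms] by blast
  have "AE p in lborel \<Otimes>\<^sub>M lborel. F p = G p" using G(2) unfolding lborel_prod .
  then have "AE t in lborel. AE x in lborel. F (t, x) = G (t, x)"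
    by (rule lborel_pair.AE_pair)
  then have "AE t in lborel. (\<lambda>x. F (t, x)) \<in> borel_measurable lebesgue"
  proof eventually_elim
    case (elim t)
    have [measurable]: "G \<in> borel_measurable (lborel \<Otimes>\<^sub>M lborel)" using G(1) unfolding lborel_prod .
    have "(\<lambda>x. G (t, x)) \<in> borel_measurable lborel" by measurable
    then have m: "(\<lambda>x. G (t, x)) \<in> borel_measurable lebesgue" by (rule measurable_completion)
    show ?case by (rule borel_measurable_AE[OF m]) (use AE_completion[OF elim] in \<open>auto elim: eventually_mono\<close>)
  qed
  then show ?thesis by (rule AE_completion)
qed

text \<open>Fubini for a Borel representative, carried back through equality on almost every
  section.\<close>

lemma lebesgue_fubini:
  fixes F :: "real \<times> real \<Rightarrow> real"
  assumes F: "integrable lebesgue F"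
  shows "AE t in lebesgue. integrable lebesgue (\<lambda>x. F (t, x))"
    and "integrable lebesgue (\<lambda>t. \<integral>x. F (t, x) \<partial>lebesgue)"
    and "integral\<^sup>L lebesgue F = (\<integral>t. (\<integral>x. F (t, x) \<partial>lebesgue) \<partial>lebesgue)"
proof -
  obtain G where G: "G \<in> borel_measurable lborel" "AE p in lborel. F p = G p"
    using completion_ex_borel_measurable_real[OF borel_measurable_integrable[OF F]] by blast
  have Gm: "G \<in> borel_measurable lebesgue" using G(1) by (rule measurable_completion)
  have "integrable lebesgue G"
    by (rule integrable_cong_AE_imp[OF F Gm]) (use AE_completion[OF G(2)] in \<open>auto elim: eventually_mono\<close>)
  then have Gi: "integrable lborel G" using integrable_completion[OF G(1)] by simp
  then have Gp: "integrable (lborel \<Otimes>\<^sub>M lborel) G" unfolding lborel_prod .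
  have [measurable]: "G \<in> borel_measurable (lborel \<Otimes>\<^sub>M lborel)" using G(1) unfolding lborel_prod .
  have sec: "(\<lambda>x. G (t, x)) \<in> borel_measurable lborel" for t by measurable
  have "AE p in lborel \<Otimes>\<^sub>M lborel. F p = G p" using G(2) unfolding lborel_prod .
  then have ae: "AE t in lborel. AE x in lborel. F (t, x) = G (t, x)"
    by (rule lborel_pair.AE_pair)
  have Gsec: "AE t in lborel. integrable lborel (\<lambda>x. G (t, x))"
    by (rule lborel_pair.AE_integrable_fst'[OF Gp])
  have both: "AE t in lborel. integrable lebesgue (\<lambda>x. F (t, x)) \<and>
      (\<integral>x. F (t, x) \<partial>lebesgue) = (\<integral>x. G (t, x) \<partial>lborel)"
    using ae Gsec
  proof eventually_elim
    case (elim t)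
    have m: "(\<lambda>x. G (t, x)) \<in> borel_measurable lebesgue" by (rule measurable_completion[OF sec])
    have eq: "AE x in lebesgue. G (t, x) = F (t, x)"
      using AE_completion[OF elim(1)] by (auto elim: eventually_mono)
    have Fm: "(\<lambda>x. F (t, x)) \<in> borel_measurable lebesgue" by (rule borel_measurable_AE[OF m eq])
    have "integrable lebesgue (\<lambda>x. G (t, x))" using elim(2) integrable_completion[OF sec] by simp
    then have "integrable lebesgue (\<lambda>x. F (t, x))" by (rule integrable_cong_AE_imp[OF _ Fm]) (use eq in \<open>auto elim: eventually_mono\<close>)
    moreover have "(\<integral>x. F (t, x) \<partial>lebesgue) = (\<integral>x. G (t, x) \<partial>lebesgue)"
      by (rule integral_cong_AE[OF Fm m]) (use eq in \<open>auto elim: eventually_mono\<close>)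
    ultimately show ?case using integral_completion[OF sec] by simp
  qed
  have both': "AE t in lebesgue. integrable lebesgue (\<lambda>x. F (t, x)) \<and>
      (\<integral>x. F (t, x) \<partial>lebesgue) = (\<integral>x. G (t, x) \<partial>lborel)"
    using both by (rule AE_completion)
  show "AE t in lebesgue. integrable lebesgue (\<lambda>x. F (t, x))"
    using both' by (auto elim: eventually_mono)
  have gi: "integrable lborel (\<lambda>t. \<integral>x. G (t, x) \<partial>lborel)"
    by (rule lborel_pair.integrable_fst'[OF Gp])
  then have gm: "(\<lambda>t. \<integral>x. G (t, x) \<partial>lborel) \<in> borel_measurable lborel" by auto
  have gm': "(\<lambda>t. \<integral>x. G (t, x) \<partial>lborel) \<in> borel_measurable lebesgue" using gm by (rule measurable_completion)
  have eq: "AE t in lebesgue. (\<integral>x. G (t, x) \<partial>lborel) = (\<integral>x. F (t, x) \<partial>lebesgue)"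
    using both' by eventually_elim simp
  have fm: "(\<lambda>t. \<integral>x. F (t, x) \<partial>lebesgue) \<in> borel_measurable lebesgue"
    by (rule borel_measurable_AE[OF gm' eq])
  have "integrable lebesgue (\<lambda>t. \<integral>x. G (t, x) \<partial>lborel)" using gi integrable_completion[OF gm] by simp
  then show "integrable lebesgue (\<lambda>t. \<integral>x. F (t, x) \<partial>lebesgue)"
    by (rule integrable_cong_AE_imp[OF _ fm]) (use eq in \<open>auto elim: eventually_mono\<close>)
  have "integral\<^sup>L lebesgue F = integral\<^sup>L lebesgue G"
    by (rule integral_cong_AE) (use F Gm AE_completion[OF G(2)] in auto)
  also have "\<dots> = integral\<^sup>L lborel G" by (rule integral_completion[OF G(1)])
  also have "\<dots> = integral\<^sup>L (lborel \<Otimes>\<^sub>M lborel) G" unfolding lborel_prod ..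
  also have "\<dots> = (\<integral>t. (\<integral>x. G (t, x) \<partial>lborel) \<partial>lborel)"
    by (rule lborel_pair.integral_fst'[OF Gp, symmetric])
  also have "\<dots> = (\<integral>t. (\<integral>x. G (t, x) \<partial>lborel) \<partial>lebesgue)" by (rule integral_completion[OF gm, symmetric])
  also have "\<dots> = (\<integral>t. (\<integral>x. F (t, x) \<partial>lebesgue) \<partial>lebesgue)"
    by (rule integral_cong_AE[OF gm' fm eq])
  finally show "integral\<^sup>L lebesgue F = (\<integral>t. (\<integral>x. F (t, x) \<partial>lebesgue) \<partial>lebesgue)" .
qed

text \<open>An exceptional set on the line sits inside a Borel null set, and the strip over that set
  is null for the product measure.\<close>

lemma AE_lebesgue_snd:
  assumes "AE x in lebesgue. P (x::real)"
  shows "AE p in (lebesgue :: (real \<times> real) measure). P (snd p)"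
proof -
  have "AE x in lborel. P x" using assms by (simp add: AE_completion_iff)
  then obtain N where N: "N \<in> null_sets lborel" "{x. \<not> P x} \<subseteq> N"
    unfolding eventually_ae_filter by auto
  then have Nb [measurable]: "N \<in> sets borel" by auto
  have "AE x in lborel. x \<notin> N" using N(1) by (rule AE_not_in)
  then have "AE p in lborel \<Otimes>\<^sub>M lborel. snd p \<notin> N"
  proof (intro lborel_pair.AE_pair_measure)
    show "{p \<in> space (lborel \<Otimes>\<^sub>M lborel). snd p \<notin> N} \<in> sets (lborel \<Otimes>\<^sub>M lborel)" by measurable
  qed auto
  then have "AE p in (lborel :: (real \<times> real) measure). snd p \<notin> N" unfolding lborel_prod .
  then have "AE p in (lborel :: (real \<times> real) measure). P (snd p)"
    by eventually_elim (use N(2) in auto)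
  then show ?thesis by (rule AE_completion)
qed

lemma lebesgue_measurable_snd:
  fixes f :: "real \<Rightarrow> real"
  assumes "f \<in> borel_measurable lebesgue"
  shows "(\<lambda>p::real \<times> real. f (snd p)) \<in> borel_measurable lebesgue"
proof -
  obtain g where g: "g \<in> borel_measurable lborel" "AE x in lborel. f x = g x"
    using completion_ex_borel_measurable_real[OF assms] by blast
  have [measurable]: "g \<in> borel_measurable borel" using g(1) by simp
  have "(\<lambda>p::real \<times> real. g (snd p)) \<in> borel_measurable (lborel \<Otimes>\<^sub>M lborel)" by measurable
  then have "(\<lambda>p::real \<times> real. g (snd p)) \<in> borel_measurable lborel" unfolding lborel_prod .
  then have m: "(\<lambda>p::real \<times> real. g (snd p)) \<in> borel_measurable lebesgue" by (rule measurable_completion)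
  show ?thesis
    by (rule borel_measurable_AE[OF m])
       (use AE_lebesgue_snd[OF AE_completion[OF g(2)]] in \<open>auto elim: eventually_mono\<close>)
qed

lemma lebesgue_integrable_strip:
  fixes f :: "real \<Rightarrow> real"
  assumes f: "integrable lebesgue f"
  shows "integrable lebesgue (\<lambda>p::real \<times> real. indicator {a<..<b} (fst p) * f (snd p))"
proof -
  obtain g where g: "g \<in> borel_measurable lborel" "AE x in lborel. f x = g x"
    using completion_ex_borel_measurable_real[OF borel_measurable_integrable[OF f]] by blast
  have [measurable]: "g \<in> borel_measurable borel" using g(1) by simp
  have "integrable lebesgue g"
    by (rule integrable_cong_AE_imp[OF f measurable_completion[OF g(1)]])
       (use AE_completion[OF g(2)] in \<open>auto elim: eventually_mono\<close>)
  then have gi: "integrable lborel g" using integrable_completion[OF g(1)] by simp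
  have "integrable (lborel \<Otimes>\<^sub>M lborel) (\<lambda>p::real \<times> real. indicator {a<..<b} (fst p) * g (snd p))"
  proof (rule lborel_pair.Fubini_integrable)
    show "integrable lborel (\<lambda>x. \<integral>y. norm (indicator {a<..<b} (fst (x, y)) * g (snd (x, y))) \<partial>lborel)"
      using integrable_real_indicator[of "{a<..<b}" lborel] emeasure_bounded_finite[of "{a<..<b}"]
      by (simp add: abs_mult)
    show "AE x in lborel. integrable lborel (\<lambda>y. indicator {a<..<b} (fst (x, y)) * g (snd (x, y)))"
      using gi by simp
  qed measurable
  then have gp: "integrable lborel (\<lambda>p::real \<times> real. indicator {a<..<b} (fst p) * g (snd p))"
    unfolding lborel_prod .
  then have gl: "integrable lebesgue (\<lambda>p::real \<times> real. indicator {a<..<b} (fst p) * g (snd p))"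
    by (subst integrable_completion) auto
  have "AE p in (lebesgue :: (real \<times> real) measure). g (snd p) = f (snd p)"
    using AE_lebesgue_snd[OF AE_completion[OF g(2)]] by (auto elim: eventually_mono)
  then have eq: "AE p in lebesgue. indicator {a<..<b} (fst p) * g (snd p) = indicator {a<..<b} (fst p) * f (snd p)"
    by eventually_elim simp
  show ?thesis
    by (rule integrable_cong_AE_imp[OF gl borel_measurable_AE[OF borel_measurable_integrable[OF gl] eq]])
       (use eq in \<open>auto elim: eventually_mono\<close>)
qed

text \<open>Completeness of Lebesgue measure; through it functions known only as almost everywhere
  limits become measurable.\<close>

lemma borel_measurable_AE_Lon:
  fixes f g :: "real \<Rightarrow> real"
  assumes "f \<in> borel_measurable (Lon a b)" "AE x in Lon a b. f x = g x"
  shows "g \<in> borel_measurable (Lon a b)"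
proof -
  have "(\<lambda>x. if x \<in> {a<..<b} then f x else 0) \<in> borel_measurable lebesgue"
    using assms(1) by (subst borel_measurable_if) auto
  moreover have "AE x in lebesgue. (if x \<in> {a<..<b} then f x else 0) = (if x \<in> {a<..<b} then g x else 0)"
    using assms(2) unfolding AE_Lon_iff by eventually_elim auto
  ultimately have "(\<lambda>x. if x \<in> {a<..<b} then g x else 0) \<in> borel_measurable lebesgue"
    by (rule borel_measurable_AE)
  then show ?thesis by (subst (asm) borel_measurable_if) auto
qed

section \<open>Transfer to the space-time cylinder\<close>

lemma QT_sets [measurable]: "QT T \<in> sets lebesgue"
proof -
  have "open (QT T)" unfolding QT_def Omega_def by (intro open_Times open_greaterThanLessThan)
  then show ?thesis by auto
qed

lemma QT_iff: "p \<in> QT T \<longleftrightarrow> 0 < fst p \<and> fst p < T \<and> 0 < snd p \<and> snd p < 1"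
  by (cases p) (auto simp: QT_def Omega_def)

abbreviation LQ :: "real \<Rightarrow> (real \<times> real) measure" where
  "LQ T \<equiv> lebesgue_on (QT T)"

lemma AE_LQ_snd:
  assumes "AE x in Lon 0 1. P x"
  shows "AE p in LQ T. P (snd p)"
proof -
  have "AE p in (lebesgue :: (real \<times> real) measure). 0 < snd p \<and> snd p < 1 \<longrightarrow> P (snd p)"
    using assms unfolding AE_Lon_iff by (rule AE_lebesgue_snd[where P = "\<lambda>x. 0 < x \<and> x < 1 \<longrightarrow> P x"])
  then show ?thesis
    by (subst AE_restrict_space_iff) (auto simp: QT_iff elim: eventually_mono)
qed

lemma LQ_measurable_snd:
  fixes f :: "real \<Rightarrow> real"
  assumes "f \<in> borel_measurable (Lon 0 1)"
  shows "(\<lambda>p. f (snd p)) \<in> borel_measurable (LQ T)"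
proof -
  have "(\<lambda>x. if x \<in> {0<..<1} then f x else 0) \<in> borel_measurable lebesgue"
    using assms by (subst borel_measurable_if) auto
  from lebesgue_measurable_snd[OF this]
  have "(\<lambda>p::real \<times> real. if snd p \<in> {0<..<1} then f (snd p) else 0) \<in> borel_measurable (LQ T)"
    by (rule measurable_restrict_space1)
  then show ?thesis
    by (rule measurable_cong[THEN iffD1, rotated]) (auto simp: QT_iff)
qed

lemma LQ_fubini:
  fixes f :: "real \<Rightarrow> real \<Rightarrow> real"
  assumes f: "integrable (LQ T) (\<lambda>p. f (fst p) (snd p))"
  shows "AE t in Lon 0 T. integrable (Lon 0 1) (f t)"
    and "integrable (Lon 0 T) (\<lambda>t. \<integral>x. f t x \<partial>Lon 0 1)"
    and "(\<integral>p. f (fst p) (snd p) \<partial>LQ T) = (\<integral>t. (\<integral>x. f t x \<partial>Lon 0 1) \<partial>Lon 0 T)"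
proof -
  let ?F = "\<lambda>p. if p \<in> QT T then f (fst p) (snd p) else 0"
  have F: "integrable lebesgue ?F"
    using Lebesgue_Measure.integrable_restrict_UNIV[OF QT_sets, where f = "\<lambda>p. f (fst p) (snd p)"] f by simp
  note fub = lebesgue_fubini[OF F]
  have sec: "(\<lambda>x. ?F (t, x)) = (\<lambda>x. if x \<in> {0<..<1} then f t x else 0)" if "0 < t" "t < T" for t
    using that by (auto simp: QT_iff)
  have inner: "(\<integral>x. ?F (t, x) \<partial>lebesgue) = (if t \<in> {0<..<T} then \<integral>x. f t x \<partial>Lon 0 1 else 0)" for t
  proof (cases "0 < t \<and> t < T")
    case True
    then show ?thesis using Lebesgue_Measure.integral_restrict_UNIV[of "{0<..<1}" "f t"] sec[of t] by simp
  next
    case False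
    then have "(\<lambda>x. ?F (t, x)) = (\<lambda>x. 0)" by (auto simp: QT_iff)
    then show ?thesis using False by auto
  qed
  show "AE t in Lon 0 T. integrable (Lon 0 1) (f t)"
    unfolding AE_Lon_iff using fub(1)
  proof eventually_elim
    case (elim t)
    then show ?case
      using Lebesgue_Measure.integrable_restrict_UNIV[of "{0<..<1}" "f t"] sec[of t] by auto
  qed
  show "integrable (Lon 0 T) (\<lambda>t. \<integral>x. f t x \<partial>Lon 0 1)"
    using fub(2) unfolding inner
    by (subst (asm) Lebesgue_Measure.integrable_restrict_UNIV) auto
  show "(\<integral>p. f (fst p) (snd p) \<partial>LQ T) = (\<integral>t. (\<integral>x. f t x \<partial>Lon 0 1) \<partial>Lon 0 T)"
    using fub(3) Lebesgue_Measure.integral_restrict_UNIV[OF QT_sets, where f = "\<lambda>p. f (fst p) (snd p)"]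
      Lebesgue_Measure.integral_restrict_UNIV[of "{0<..<T}" "\<lambda>t. \<integral>x. f t x \<partial>Lon 0 1"]
    unfolding inner by simp
qed

lemma LQ_section_measurable:
  fixes f :: "real \<Rightarrow> real \<Rightarrow> real"
  assumes f: "(\<lambda>p. f (fst p) (snd p)) \<in> borel_measurable (LQ T)"
  shows "AE t in Lon 0 T. f t \<in> borel_measurable (Lon 0 1)"
proof -
  let ?F = "\<lambda>p. if p \<in> QT T then f (fst p) (snd p) else 0"
  have "?F \<in> borel_measurable lebesgue" using f by (subst borel_measurable_if) auto
  from lebesgue_section_measurable[OF this] show ?thesis
    unfolding AE_Lon_iff
  proof eventually_elim
    case (elim t)
    show ?case
    proof
      assume t: "0 < t \<and> t < T"
      then have "(\<lambda>x. ?F (t, x)) = (\<lambda>x. if x \<in> {0<..<1} then f t x else 0)"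
        by (auto simp: QT_iff)
      then have "(\<lambda>x. if x \<in> {0<..<1} then f t x else 0) \<in> borel_measurable lebesgue" using elim by simp
      then show "f t \<in> borel_measurable (Lon 0 1)" by (subst (asm) borel_measurable_if) auto
    qed
  qed
qed

lemma jmeas_iff_sqint: "jmeas T u \<longleftrightarrow> sqint (LQ T) (\<lambda>p. u (fst p) (snd p))"
  by (simp add: jmeas_def sqint_def)

abbreviation jn :: "real \<Rightarrow> (real \<Rightarrow> real \<Rightarrow> real) \<Rightarrow> real" where
  "jn T u \<equiv> l2n (LQ T) (\<lambda>p. u (fst p) (snd p))"

lemma jmeas_diff: "jmeas T u \<Longrightarrow> jmeas T w \<Longrightarrow> jmeas T (\<lambda>t x. u t x - w t x)"
  by (simp add: jmeas_iff_sqint sqint_diff)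

lemma jmeas_bounded_mult:
  assumes "jmeas T u" "d \<in> borel_measurable (Lon 0 1)" "AE x in Lon 0 1. \<bar>d x\<bar> \<le> C"
  shows "jmeas T (\<lambda>t x. d x * u t x)"
  using sqint_bounded_mult[OF assms(1)[unfolded jmeas_iff_sqint] LQ_measurable_snd[OF assms(2)] AE_LQ_snd[OF assms(3)]]
  by (simp add: jmeas_iff_sqint)

lemma jmeas_const:
  assumes "L2 c"
  shows "jmeas T (\<lambda>t. c)"
proof -
  have "integrable lebesgue (\<lambda>x. if x \<in> {0<..<1} then (c x)\<^sup>2 else 0)"
    using Lebesgue_Measure.integrable_restrict_UNIV[of "{0<..<1::real}" "\<lambda>x. (c x)\<^sup>2"] assms
    by (simp add: L2_iff_sqint sqint_def)
  from lebesgue_integrable_strip[OF this, of 0 T]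
  have "integrable lebesgue (\<lambda>p. if p \<in> QT T then (c (snd p))\<^sup>2 else 0)"
    by (rule Bochner_Integration.integrable_cong[THEN iffD1, rotated 2]) (auto simp: QT_iff indicator_def)
  then have "integrable (LQ T) (\<lambda>p. (c (snd p))\<^sup>2)"
    by (subst (asm) Lebesgue_Measure.integrable_restrict_UNIV) auto
  then show ?thesis
    using LQ_measurable_snd[OF L2_measurable[OF assms]] by (simp add: jmeas_def)
qed

lemma jmeas_section:
  assumes "jmeas T u"
  shows "AE t in Lon 0 T. L2 (u t)"
proof -
  have "AE t in Lon 0 T. integrable (Lon 0 1) (\<lambda>x. (u t x)\<^sup>2)"
    using assms by (intro LQ_fubini(1)) (simp add: jmeas_def)
  moreover have "AE t in Lon 0 T. u t \<in> borel_measurable (Lon 0 1)"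
    using assms by (intro LQ_section_measurable) (simp add: jmeas_def)
  ultimately show ?thesis by eventually_elim (simp add: L2_iff_sqint sqint_def)
qed

lemma jmeas_ip:
  assumes "jmeas T u" "jmeas T w"
  shows "integrable (Lon 0 T) (\<lambda>t. ip (u t) (w t))"
    "(\<integral>t. ip (u t) (w t) \<partial>Lon 0 T) = (\<integral>p. u (fst p) (snd p) * w (fst p) (snd p) \<partial>LQ T)"
proof -
  have i: "integrable (LQ T) (\<lambda>p. u (fst p) (snd p) * w (fst p) (snd p))"
    using assms by (intro sqint_mult_integrable) (auto simp: jmeas_iff_sqint)
  show "integrable (Lon 0 T) (\<lambda>t. ip (u t) (w t))"
    using LQ_fubini(2)[OF i] by (simp add: ip_Lon)
  show "(\<integral>t. ip (u t) (w t) \<partial>Lon 0 T) = (\<integral>p. u (fst p) (snd p) * w (fst p) (snd p) \<partial>LQ T)"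
    using LQ_fubini(3)[OF i] by (simp add: ip_Lon)
qed

text \<open>Fubini lets the cylinder norm be computed slice by slice, so estimates at single times
  integrate to estimates on the cylinder.\<close>

lemma jmeas_nrm:
  assumes "jmeas T u"
  shows "sqint (Lon 0 T) (\<lambda>t. nrm (u t))" "l2n (Lon 0 T) (\<lambda>t. nrm (u t)) = jn T u"
proof -
  have i: "integrable (Lon 0 T) (\<lambda>t. (nrm (u t))\<^sup>2)"
    using jmeas_ip(1)[OF assms assms] by (simp add: ip_self)
  then have [measurable]: "(\<lambda>t. (nrm (u t))\<^sup>2) \<in> borel_measurable (Lon 0 T)" by auto
  have "(\<lambda>t. sqrt ((nrm (u t))\<^sup>2)) \<in> borel_measurable (Lon 0 T)" by measurable
  then show "sqint (Lon 0 T) (\<lambda>t. nrm (u t))" using i by (simp add: sqint_def)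
  show "l2n (Lon 0 T) (\<lambda>t. nrm (u t)) = jn T u"
    using jmeas_ip(2)[OF assms assms] by (simp add: ip_self l2n_def power2_eq_square)
qed

lemma jmeas_ip_sqint:
  assumes u: "jmeas T u" and c: "L2 c"
  shows "sqint (Lon 0 T) (\<lambda>t. ip (u t) c)"
proof (rule sqint_bound[OF sqint_cmult[OF jmeas_nrm(1)[OF u], of "nrm c"]])
  show "(\<lambda>t. ip (u t) c) \<in> borel_measurable (Lon 0 T)"
    using jmeas_ip(1)[OF u jmeas_const[OF c]] by auto
  show "AE t in Lon 0 T. \<bar>ip (u t) c\<bar> \<le> \<bar>nrm c * nrm (u t)\<bar>"
    using jmeas_section[OF u]
  proof eventually_elim
    case (elim t)
    show ?case using ip_CS[OF elim c] by (simp add: abs_mult mult.commute)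
  qed
qed

section \<open>Energy identities\<close>

lemma cont_L2_D:
  assumes "cont_L2 T w" "t \<in> {0..T}"
  shows "L2 (w t)" "((\<lambda>s. nrm (\<lambda>x. w s x - w t x)) \<longlongrightarrow> 0) (at t within {0..T})"
proof -
  show "L2 (w t)" using assms by (simp add: cont_L2_def)
  have "((\<lambda>s. sqrt (ip (\<lambda>x. w s x - w t x) (\<lambda>x. w s x - w t x))) \<longlongrightarrow> sqrt 0) (at t within {0..T})"
    using assms by (intro tendsto_real_sqrt) (simp add: cont_L2_def)
  then show "((\<lambda>s. nrm (\<lambda>x. w s x - w t x)) \<longlongrightarrow> 0) (at t within {0..T})" by (simp add: ip_self)
qed

lemma cont_L2_diff:
  assumes "cont_L2 T u" "cont_L2 T w"
  shows "cont_L2 T (\<lambda>t x. u t x - w t x)"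
  unfolding cont_L2_def
proof (intro conjI ballI)
  fix t assume t: "t \<in> {0..T}"
  note U = cont_L2_D[OF assms(1)] and W = cont_L2_D[OF assms(2)]
  show "L2 (\<lambda>x. u t x - w t x)" by (intro L2_diff U W t)
  let ?n = "\<lambda>s. nrm (\<lambda>x. u s x - w s x - (u t x - w t x))"
  have "(?n \<longlongrightarrow> 0) (at t within {0..T})"
  proof (rule tendsto_sandwich[OF _ _ tendsto_const])
    show "((\<lambda>s. nrm (\<lambda>x. u s x - u t x) + nrm (\<lambda>x. w s x - w t x)) \<longlongrightarrow> 0) (at t within {0..T})"
      using tendsto_add[OF U(2)[OF t] W(2)[OF t]] by simp
    have "?n s \<le> nrm (\<lambda>x. u s x - u t x) + nrm (\<lambda>x. w s x - w t x)" if "s \<in> {0..T}" for s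
      using l2n_triangle_diff[of "Lon 0 1" "\<lambda>x. u s x - u t x" "\<lambda>x. w s x - w t x"]
        L2_diff[OF U(1)[OF that] U(1)[OF t]] L2_diff[OF W(1)[OF that] W(1)[OF t]]
      by (simp add: L2_iff_sqint algebra_simps)
    then show "\<forall>\<^sub>F s in at t within {0..T}. ?n s \<le> nrm (\<lambda>x. u s x - u t x) + nrm (\<lambda>x. w s x - w t x)"
      by (auto simp: eventually_at_filter)
  qed auto
  from tendsto_power[OF this, of 2]
  show "((\<lambda>s. ip (\<lambda>x. u s x - w s x - (u t x - w t x)) (\<lambda>x. u s x - w s x - (u t x - w t x))) \<longlongrightarrow> 0) (at t within {0..T})"
    by (simp add: ip_self)
qed

lemma cont_L2_ip_continuous:
  assumes w: "cont_L2 T w" and \<phi>: "L2 \<phi>"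
  shows "continuous_on {0..T} (\<lambda>t. ip (w t) \<phi>)"
  unfolding continuous_on_def
proof
  fix t assume t: "t \<in> {0..T}"
  have "((\<lambda>s. ip (w s) \<phi> - ip (w t) \<phi>) \<longlongrightarrow> 0) (at t within {0..T})"
  proof (rule tendsto_rabs_zero_cancel, rule tendsto_sandwich[OF _ _ tendsto_const])
    show "((\<lambda>s. nrm (\<lambda>x. w s x - w t x) * nrm \<phi>) \<longlongrightarrow> 0) (at t within {0..T})"
      using tendsto_mult_left_zero[OF cont_L2_D(2)[OF w t]] .
    have "\<bar>ip (w s) \<phi> - ip (w t) \<phi>\<bar> \<le> nrm (\<lambda>x. w s x - w t x) * nrm \<phi>" if s: "s \<in> {0..T}" for s
      using ip_CS[OF L2_diff[OF cont_L2_D(1)[OF w s] cont_L2_D(1)[OF w t]] \<phi>]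
        ip_diff_left[OF cont_L2_D(1)[OF w s] cont_L2_D(1)[OF w t] \<phi>] by simp
    then show "\<forall>\<^sub>F s in at t within {0..T}. \<bar>ip (w s) \<phi> - ip (w t) \<phi>\<bar> \<le> nrm (\<lambda>x. w s x - w t x) * nrm \<phi>"
      by (auto simp: eventually_at_filter)
  qed auto
  then show "((\<lambda>t. ip (w t) \<phi>) \<longlongrightarrow> ip (w t) \<phi>) (at t within {0..T})" by (rule LIM_zero_cancel)
qed

lemma cont_L2_nrm_continuous:
  assumes w: "cont_L2 T w"
  shows "continuous_on {0..T} (\<lambda>t. nrm (w t))"
  unfolding continuous_on_def
proof
  fix t assume t: "t \<in> {0..T}"
  have "((\<lambda>s. nrm (w s) - nrm (w t)) \<longlongrightarrow> 0) (at t within {0..T})"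
  proof (rule tendsto_rabs_zero_cancel, rule tendsto_sandwich[OF _ _ tendsto_const cont_L2_D(2)[OF w t]])
    have "\<bar>nrm (w s) - nrm (w t)\<bar> \<le> nrm (\<lambda>x. w s x - w t x)" if s: "s \<in> {0..T}" for s
      using cont_L2_D(1)[OF w s] cont_L2_D(1)[OF w t] by (intro l2n_reverse_triangle) (auto simp: L2_iff_sqint)
    then show "\<forall>\<^sub>F s in at t within {0..T}. \<bar>nrm (w s) - nrm (w t)\<bar> \<le> nrm (\<lambda>x. w s x - w t x)"
      by (auto simp: eventually_at_filter)
  qed auto
  then show "((\<lambda>t. nrm (w t)) \<longlongrightarrow> nrm (w t)) (at t within {0..T})" by (rule LIM_zero_cancel)
qed

section \<open>From weak time derivatives to energy identities\<close>

text \<open>The du Bois-Reymond lemma in time identifies the coefficient with a primitive almost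
  everywhere. Both sides are continuous, so equality holds at all times, and the value at 0 fixes
  the constant.\<close>

lemma time_deriv_integrated:
  assumes "T > 0" and w: "cont_L2 T w" and d: "is_time_deriv T V w wt" and \<phi>: "V \<phi>" "L2 \<phi>"
    and h: "integrable (Lon 0 T) h" and eq: "AE t in Lon 0 T. wt t \<phi> = h t"
    and t: "t \<in> {0..T}"
  shows "ip (w t) \<phi> = ip (w 0) \<phi> + integral\<^sup>L (Lon 0 t) h"
proof -
  interpret finite_measure "Lon 0 T" by (rule finite_measure_Lon)
  let ?f = "\<lambda>t. ip (w t) \<phi>"
  have c: "continuous_on {0..T} ?f" by (rule cont_L2_ip_continuous[OF w \<phi>(2)])
  have fi: "integrable (Lon 0 T) ?f"
    using prim_mult_integrable[of 0 T "\<lambda>_. 1", OF _ c] by simp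
  have wtm: "(\<lambda>t. wt t \<phi>) \<in> borel_measurable (Lon 0 T)"
    by (rule borel_measurable_AE_Lon[OF borel_measurable_integrable[OF h]]) (use eq in \<open>auto elim: eventually_mono\<close>)
  have "(\<integral>t. ?f t * deriv \<psi> t \<partial>Lon 0 T) = - (\<integral>t. h t * \<psi> t \<partial>Lon 0 T)" if \<psi>: "test_fun 0 T \<psi>" for \<psi>
  proof -
    have [measurable]: "\<psi> \<in> borel_measurable (Lon 0 T)"
      by (rule continuous_on_measurable_Lon[OF test_funD(2)[OF \<psi>]])
    have "(\<integral>t. ?f t * deriv \<psi> t \<partial>Lon 0 T) = - (\<integral>t. wt t \<phi> * \<psi> t \<partial>Lon 0 T)"
      using d \<phi>(1) \<psi> by (simp add: is_time_deriv_def)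
    also have "(\<integral>t. wt t \<phi> * \<psi> t \<partial>Lon 0 T) = (\<integral>t. h t * \<psi> t \<partial>Lon 0 T)"
      by (rule integral_cong_AE) (use wtm h eq in \<open>auto elim: eventually_mono\<close>)
    finally show ?thesis .
  qed
  then obtain C where C: "AE t in Lon 0 T. ?f t = C + integral\<^sup>L (Lon 0 t) h"
    using du_Bois_Reymond[OF fi h \<open>T > 0\<close>] by blast
  have c2: "continuous_on {0..T} (\<lambda>t. C + integral\<^sup>L (Lon 0 t) h)"
    by (intro continuous_intros prim_continuous h)
  have ev: "?f t = C + integral\<^sup>L (Lon 0 t) h" if "t \<in> {0..T}" for t
    by (rule continuous_AE_eq[OF c c2 C \<open>T > 0\<close> that])
  show ?thesis using ev[OF t] ev[of 0] \<open>T > 0\<close> by simp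
qed

text \<open>Each coefficient solves a scalar integral equation, and \<open>ibp_prim\<close> gives
  the increment of its square. Summed over the modes, the squares become norms by Parseval, while
  the right side converges by dominated convergence with majorant \<open>D\<close>.\<close>

lemma energy_modes:
  assumes w: "\<And>t. t \<in> {0..T} \<Longrightarrow> L2 (w t)"
    and h: "\<And>k. integrable (Lon 0 T) (h k)"
    and m: "\<And>k t. t \<in> {0..T} \<Longrightarrow> ip (w t) (es k) = ip (w 0) (es k) + integral\<^sup>L (Lon 0 t) (h k)"
    and R: "AE t in Lon 0 T. (\<lambda>N. \<Sum>k<N. ip (w t) (es k) * h k t) \<longlonglongrightarrow> R t"
    and D: "integrable (Lon 0 T) D" "\<And>N. AE t in Lon 0 T. \<bar>\<Sum>k<N. ip (w t) (es k) * h k t\<bar> \<le> D t"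
    and s: "s \<in> {0..T}"
  shows "(nrm (w s))\<^sup>2 = (nrm (w 0))\<^sup>2 + 2 * integral\<^sup>L (Lon 0 s) R"
proof -
  have hs: "integrable (Lon 0 s) (h k)" for k by (rule integrable_Lon_sub[OF h]) (use s in auto)
  have wh: "integrable (Lon 0 s) (\<lambda>t. ip (w t) (es k) * h k t)"
    and each: "2 * (\<integral>t. ip (w t) (es k) * h k t \<partial>Lon 0 s) = (ip (w s) (es k))\<^sup>2 - (ip (w 0) (es k))\<^sup>2" for k
  proof -
    let ?c = "ip (w 0) (es k)" and ?H = "\<lambda>t. integral\<^sup>L (Lon 0 t) (h k)"
    have Hh: "integrable (Lon 0 s) (\<lambda>t. ?H t * h k t)"
      by (rule prim_mult_integrable[OF hs prim_continuous[OF hs]])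
    have eq: "ip (w t) (es k) * h k t = ?c * h k t + ?H t * h k t" if "t \<in> space (Lon 0 s)" for t
      using m[of t k] that s by (simp add: distrib_right)
    show "integrable (Lon 0 s) (\<lambda>t. ip (w t) (es k) * h k t)"
      by (subst Bochner_Integration.integrable_cong[OF refl eq]) (use hs Hh in auto)
    have "(\<integral>t. ip (w t) (es k) * h k t \<partial>Lon 0 s) = (\<integral>t. ?c * h k t + ?H t * h k t \<partial>Lon 0 s)"
      by (rule Bochner_Integration.integral_cong[OF refl eq])
    also have "\<dots> = ?c * ?H s + (\<integral>t. ?H t * h k t \<partial>Lon 0 s)"
      using hs Hh by simp
    finally have "(\<integral>t. ip (w t) (es k) * h k t \<partial>Lon 0 s) = ?c * ?H s + (\<integral>t. ?H t * h k t \<partial>Lon 0 s)" .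
    \<comment> \<open>Integration by parts with equal factors: twice the integral is the square of
      the primitive.\<close>
    moreover have "2 * (\<integral>t. ?H t * h k t \<partial>Lon 0 s) = (?H s)\<^sup>2"
      using ibp_prim[OF hs[of k] hs[of k]] by (simp add: power2_eq_square mult.commute)
    ultimately have "2 * (\<integral>t. ip (w t) (es k) * h k t \<partial>Lon 0 s) = 2 * (?c * ?H s) + (?H s)\<^sup>2" by simp
    also have "?H s = ip (w s) (es k) - ?c" using m[OF s, of k] by simp
    finally show "2 * (\<integral>t. ip (w t) (es k) * h k t \<partial>Lon 0 s) = (ip (w s) (es k))\<^sup>2 - ?c\<^sup>2"
      by (simp add: power2_eq_square algebra_simps)
  qed
  have pars: "(\<lambda>N. \<Sum>k<N. (ip (w t) (es k))\<^sup>2) \<longlonglongrightarrow> (nrm (w t))\<^sup>2" if "t \<in> {0..T}" for t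
  proof -
    have "sqint (Lon 0 1) (w t)" using w[OF that] by (simp add: L2_iff_sqint)
    from onb_parseval(1)[OF onb_es this this] show ?thesis
      by (simp add: ip_Lon l2n_sq flip: power2_eq_square)
  qed
  have "(\<lambda>N. \<integral>t. (\<Sum>k<N. ip (w t) (es k) * h k t) \<partial>Lon 0 s) \<longlonglongrightarrow> integral\<^sup>L (Lon 0 s) R"
  proof (rule integral_dominated_convergence[where w = D])
    show "R \<in> borel_measurable (Lon 0 s)"
    proof -
      have "AE t in Lon 0 s. (\<lambda>N. \<Sum>k<N. ip (w t) (es k) * h k t) \<longlonglongrightarrow> R t"
        by (rule AE_Lon_subset[OF R]) (use s in auto)
      then have "AE t in Lon 0 s. lim (\<lambda>N. \<Sum>k<N. ip (w t) (es k) * h k t) = R t"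
        by eventually_elim (rule limI)
      moreover have "(\<lambda>t. lim (\<lambda>N. \<Sum>k<N. ip (w t) (es k) * h k t)) \<in> borel_measurable (Lon 0 s)"
        by (intro borel_measurable_lim_metric borel_measurable_sum borel_measurable_integrable wh)
      ultimately show ?thesis by (rule borel_measurable_AE_Lon[rotated])
    qed
    show "(\<lambda>t. \<Sum>k<N. ip (w t) (es k) * h k t) \<in> borel_measurable (Lon 0 s)" for N
      by (intro borel_measurable_sum borel_measurable_integrable wh)
    show "integrable (Lon 0 s) D" by (rule integrable_Lon_sub[OF D(1)]) (use s in auto)
    show "AE t in Lon 0 s. (\<lambda>N. \<Sum>k<N. ip (w t) (es k) * h k t) \<longlonglongrightarrow> R t"
      by (rule AE_Lon_subset[OF R]) (use s in auto)
    show "AE t in Lon 0 s. norm (\<Sum>k<N. ip (w t) (es k) * h k t) \<le> D t" for N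
      using AE_Lon_subset[OF D(2), of 0 s N] s by simp
  qed
  then have "(\<lambda>N. 2 * (\<integral>t. (\<Sum>k<N. ip (w t) (es k) * h k t) \<partial>Lon 0 s)) \<longlonglongrightarrow> 2 * integral\<^sup>L (Lon 0 s) R"
    by (rule tendsto_mult_left)
  moreover have "2 * (\<integral>t. (\<Sum>k<N. ip (w t) (es k) * h k t) \<partial>Lon 0 s)
      = (\<Sum>k<N. (ip (w s) (es k))\<^sup>2) - (\<Sum>k<N. (ip (w 0) (es k))\<^sup>2)" for N
    using wh by (simp add: sum_distrib_left each sum_subtractf)
  ultimately have "(\<lambda>N. (\<Sum>k<N. (ip (w s) (es k))\<^sup>2) - (\<Sum>k<N. (ip (w 0) (es k))\<^sup>2)) \<longlonglongrightarrow> 2 * integral\<^sup>L (Lon 0 s) R"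
    by simp
  moreover have "(\<lambda>N. (\<Sum>k<N. (ip (w s) (es k))\<^sup>2) - (\<Sum>k<N. (ip (w 0) (es k))\<^sup>2)) \<longlonglongrightarrow> (nrm (w s))\<^sup>2 - (nrm (w 0))\<^sup>2"
    by (intro tendsto_diff pars) (use s in auto)
  ultimately have "2 * integral\<^sup>L (Lon 0 s) R = (nrm (w s))\<^sup>2 - (nrm (w 0))\<^sup>2" by (rule LIMSEQ_unique)
  then show ?thesis by simp
qed

text \<open>Integration by parts moves the factor \<open>lam k\<close> from a sine coefficient of
  \<open>w\<close> to a cosine coefficient of its derivative; this absorbs the frequency that
  testing the flux with \<open>es k\<close> produces.\<close>

lemma H01p_cosine_coeff:
  assumes "H01p w g"
  shows "lam k * ip w (es k) = ip g (ec k)"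
proof -
  have "ip (ec k) g = - ip (\<lambda>x. - lam k * es k x) w"
    by (rule ip_weak_deriv_H01p[OF assms L2_ec L2_cmult[OF L2_es] weak_deriv_ec])
  then show ?thesis using ip_cmult_left[of "- lam k" "es k" w] by (simp add: ip_commute)
qed

lemma H01p_cosine_coeff_0:
  assumes "H01p w g"
  shows "ip g (\<lambda>x. 1) = 0"
  using assms by (simp add: ip_Lon H01p_def)

text \<open>One integration by parts uses the zero boundary values of \<open>es k\<close>, the other
  those of \<open>w\<close>. In the mode sums the square of \<open>lam k\<close> thereby turns into
  a second derivative.\<close>

lemma sine_coeff_second:
  assumes "H01p w g" "L2 h" "has_weak_deriv g h"
  shows "ip h (es k) = - (lam k)\<^sup>2 * ip w (es k)"
proof -
  have "ip g (\<lambda>x. lam k * ec k x) = - ip h (es k)"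
    by (rule ip_weak_deriv_H01p[OF H01p_es H01p_D(2)[OF assms(1)] assms(2,3)])
  then have "ip h (es k) = - lam k * ip g (ec k)" by (simp add: ip_cmult_right)
  then show ?thesis
    unfolding H01p_cosine_coeff[OF assms(1), of k, symmetric] by (simp add: power2_eq_square mult.assoc)
qed

text \<open>The zeroth coefficients drop out of the product through \<open>g\<close>;
  \<open>G\<close> will be a flux, whose mean is in general not zero.\<close>

lemma cosine_parseval:
  assumes g: "L2 g" "L2 G" and z: "ip g (\<lambda>x. 1) = 0"
  shows "(\<lambda>N. \<Sum>k<N. ip g (ec k) * ip G (ec k)) \<longlonglongrightarrow> ip g G"
    and "\<bar>\<Sum>k<N. ip g (ec k) * ip G (ec k)\<bar> \<le> nrm g * nrm G"
proof -
  note s = g[unfolded L2_iff_sqint]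
  have shift: "(\<Sum>k<Suc N. ip g (cb k) * ip G (cb k)) = (\<Sum>k<N. ip g (ec k) * ip G (ec k))" for N
    using z by (simp only: sum.lessThan_Suc_shift) (simp add: cb_def)
  have "(\<lambda>N. \<Sum>k<N. ip g (cb k) * ip G (cb k)) \<longlonglongrightarrow> ip g G"
    using onb_parseval(1)[OF onb_cb s] by (simp add: ip_Lon)
  from LIMSEQ_Suc[OF this] show "(\<lambda>N. \<Sum>k<N. ip g (ec k) * ip G (ec k)) \<longlonglongrightarrow> ip g G"
    unfolding shift .
  show "\<bar>\<Sum>k<N. ip g (ec k) * ip G (ec k)\<bar> \<le> nrm g * nrm G"
    using onb_parseval(2)[OF onb_cb s, of "Suc N"] unfolding ip_Lon[symmetric] shift .
qed

lemma sine_parseval: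
  assumes "L2 f" "L2 g"
  shows "(\<lambda>N. \<Sum>k<N. ip f (es k) * ip g (es k)) \<longlonglongrightarrow> ip f g"
    and "\<bar>\<Sum>k<N. ip f (es k) * ip g (es k)\<bar> \<le> nrm f * nrm g"
  using onb_parseval[OF onb_es assms[unfolded L2_iff_sqint]] by (auto simp: ip_Lon)

text \<open>The flux \<open>G\<close> is kept abstract: it is the coefficient times the gradient for
  one solution, and a difference of two such products for a pair of solutions.\<close>

theorem energy_second_order:
  assumes w: "cont_L2 T w" and J: "jmeas T w1" "jmeas T G"
    and H: "AE t in Lon 0 T. H01p (w t) (w1 t)"
    and m: "\<And>k t. t \<in> {0..T} \<Longrightarrow>
      ip (w t) (es k) = ip (w 0) (es k) + integral\<^sup>L (Lon 0 t) (\<lambda>s. - lam k * ip (G s) (ec k))"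
    and s: "s \<in> {0..T}"
  shows "(nrm (w s))\<^sup>2 = (nrm (w 0))\<^sup>2 - 2 * (\<integral>t. ip (w1 t) (G t) \<partial>Lon 0 s)"
proof -
  interpret finite_measure "Lon 0 T" by (rule finite_measure_Lon)
  have key: "AE t in Lon 0 T. L2 (w1 t) \<and> L2 (G t) \<and> ip (w1 t) (\<lambda>x. 1) = 0 \<and>
     (\<forall>k. ip (w t) (es k) * (- lam k * ip (G t) (ec k)) = - (ip (w1 t) (ec k) * ip (G t) (ec k)))"
    using jmeas_section[OF J(1)] jmeas_section[OF J(2)] H
  proof eventually_elim
    case (elim t)
    have "ip (w t) (es k) * (- lam k * ip (G t) (ec k)) = - (ip (w1 t) (ec k) * ip (G t) (ec k))" for k
      by (simp add: H01p_cosine_coeff[OF elim(3), of k, symmetric])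
    then show ?case using elim H01p_cosine_coeff_0 by auto
  qed
  have "(nrm (w s))\<^sup>2 = (nrm (w 0))\<^sup>2 + 2 * (\<integral>t. - ip (w1 t) (G t) \<partial>Lon 0 s)"
  proof (rule energy_modes[where w = w and h = "\<lambda>k s. - lam k * ip (G s) (ec k)"
        and D = "\<lambda>t. nrm (w1 t) * nrm (G t)", OF _ _ m _ _ _ s])
    show "L2 (w t)" if "t \<in> {0..T}" for t by (rule cont_L2_D(1)[OF w that])
    show "integrable (Lon 0 T) (\<lambda>s. - lam k * ip (G s) (ec k))" for k
      by (intro integrable_mult_right sqint_integrable jmeas_ip_sqint J L2_ec)
    show "integrable (Lon 0 T) (\<lambda>t. nrm (w1 t) * nrm (G t))"
      by (intro sqint_mult_integrable jmeas_nrm J)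
    show "AE t in Lon 0 T. (\<lambda>N. \<Sum>k<N. ip (w t) (es k) * (- lam k * ip (G t) (ec k))) \<longlonglongrightarrow> - ip (w1 t) (G t)"
      using key
    proof eventually_elim
      case (elim t)
      then have e: "ip (w t) (es k) * (- lam k * ip (G t) (ec k)) = - (ip (w1 t) (ec k) * ip (G t) (ec k))" for k
        by blast
      show ?case unfolding e sum_negf using tendsto_minus[OF cosine_parseval(1)[of "w1 t" "G t"]] elim by blast
    qed
    show "AE t in Lon 0 T. \<bar>\<Sum>k<N. ip (w t) (es k) * (- lam k * ip (G t) (ec k))\<bar> \<le> nrm (w1 t) * nrm (G t)" for N
      using key
    proof eventually_elim
      case (elim t)
      then have e: "ip (w t) (es k) * (- lam k * ip (G t) (ec k)) = - (ip (w1 t) (ec k) * ip (G t) (ec k))" for k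
        by blast
      show ?case unfolding e sum_negf abs_minus_cancel using cosine_parseval(2)[of "w1 t" "G t" N] elim by blast
    qed
  qed
  then show ?thesis by simp
qed

text \<open>By \<open>sine_coeff_second\<close> the coefficient of \<open>w\<close> with factor
  \<open>lam k\<close> squared is minus the coefficient of \<open>w2\<close>, so both parts of the
  right side become Parseval sums of square-integrable slices.\<close>

theorem energy_fourth_order:
  assumes w: "cont_L2 T w" and J: "jmeas T w" "jmeas T w1" "jmeas T w2" "jmeas T F"
    and H: "AE t in Lon 0 T. H01p (w t) (w1 t) \<and> has_weak_deriv (w1 t) (w2 t)"
    and m: "\<And>k t. t \<in> {0..T} \<Longrightarrow> ip (w t) (es k) = ip (w 0) (es k)
       + integral\<^sup>L (Lon 0 t) (\<lambda>s. (lam k)\<^sup>2 * ip (w2 s) (es k) + ip (F s) (es k))"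
    and s: "s \<in> {0..T}"
  shows "(nrm (w s))\<^sup>2 = (nrm (w 0))\<^sup>2 + 2 * (\<integral>t. ip (w t) (F t) - (nrm (w2 t))\<^sup>2 \<partial>Lon 0 s)"
proof -
  interpret finite_measure "Lon 0 T" by (rule finite_measure_Lon)
  have key: "AE t in Lon 0 T. L2 (w t) \<and> L2 (w2 t) \<and> L2 (F t) \<and>
     (\<forall>k. ip (w t) (es k) * ((lam k)\<^sup>2 * ip (w2 t) (es k) + ip (F t) (es k))
       = ip (w t) (es k) * ip (F t) (es k) - ip (w2 t) (es k) * ip (w2 t) (es k))"
    using jmeas_section[OF J(1)] jmeas_section[OF J(3)] jmeas_section[OF J(4)] H
  proof eventually_elim
    case (elim t)
    have "ip (w t) (es k) * ((lam k)\<^sup>2 * ip (w2 t) (es k) + ip (F t) (es k))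
       = ip (w t) (es k) * ip (F t) (es k) - ip (w2 t) (es k) * ip (w2 t) (es k)" for k
      using sine_coeff_second[of "w t" "w1 t" "w2 t" k] elim by (simp add: algebra_simps)
    then show ?case using elim by auto
  qed
  show ?thesis
  proof (rule energy_modes[where w = w and h = "\<lambda>k s. (lam k)\<^sup>2 * ip (w2 s) (es k) + ip (F s) (es k)"
        and D = "\<lambda>t. nrm (w t) * nrm (F t) + nrm (w2 t) * nrm (w2 t)", OF _ _ m _ _ _ s])
    show "L2 (w t)" if "t \<in> {0..T}" for t by (rule cont_L2_D(1)[OF w that])
    show "integrable (Lon 0 T) (\<lambda>s. (lam k)\<^sup>2 * ip (w2 s) (es k) + ip (F s) (es k))" for k
      by (intro Bochner_Integration.integrable_add integrable_mult_right sqint_integrable jmeas_ip_sqint J L2_es)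
    show "integrable (Lon 0 T) (\<lambda>t. nrm (w t) * nrm (F t) + nrm (w2 t) * nrm (w2 t))"
      by (intro Bochner_Integration.integrable_add sqint_mult_integrable jmeas_nrm J)
    show "AE t in Lon 0 T. (\<lambda>N. \<Sum>k<N. ip (w t) (es k) * ((lam k)\<^sup>2 * ip (w2 t) (es k) + ip (F t) (es k)))
        \<longlonglongrightarrow> ip (w t) (F t) - (nrm (w2 t))\<^sup>2"
      using key
    proof eventually_elim
      case (elim t)
      show ?case
        using tendsto_diff[OF sine_parseval(1)[of "w t" "F t"] sine_parseval(1)[of "w2 t" "w2 t"]] elim
        by (simp add: sum_subtractf ip_self)
    qed
    show "AE t in Lon 0 T. \<bar>\<Sum>k<N. ip (w t) (es k) * ((lam k)\<^sup>2 * ip (w2 t) (es k) + ip (F t) (es k))\<bar>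
        \<le> nrm (w t) * nrm (F t) + nrm (w2 t) * nrm (w2 t)" for N
      using key
    proof eventually_elim
      case (elim t)
      have "(\<Sum>k<N. ip (w t) (es k) * ((lam k)\<^sup>2 * ip (w2 t) (es k) + ip (F t) (es k)))
        = (\<Sum>k<N. ip (w t) (es k) * ip (F t) (es k)) - (\<Sum>k<N. ip (w2 t) (es k) * ip (w2 t) (es k))"
        using elim by (simp add: sum_subtractf)
      then show ?case
        using sine_parseval(2)[of "w t" "F t" N] sine_parseval(2)[of "w2 t" "w2 t" N] elim by linarith
    qed
  qed
qed

section \<open>The spaces of the weak formulation\<close>

lemma H1_wd:
  assumes "H1 f"
  shows "L2 f" "L2 (wd f)" "has_weak_deriv f (wd f)"
  using assms wd_weak_deriv unfolding H1_def by auto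

lemma H01_H01p:
  assumes "H01 f"
  shows "H01p f (wd f)"
  using H1_wd[of f] assms by (intro H01p_I) (auto simp: H01_def)

lemma H01I: "H01p f g \<Longrightarrow> H01 f"
  using H01p_D[of f g] by (auto simp: H01_def H1_def)

lemma V02_facts:
  assumes "V02 f"
  shows "H01p f (wd f)" "L2 (wd (wd f))" "has_weak_deriv (wd f) (wd (wd f))"
proof -
  obtain g h where gh: "L2 f" "L2 g" "L2 h" "has_weak_deriv f g" "has_weak_deriv g h" "zero_bdry f"
    using assms by (auto simp: V02_def H2_def)
  show "H01p f (wd f)"
    using H01_H01p[of f] gh by (auto simp: H01_def H1_def)
  show "L2 (wd (wd f))" "has_weak_deriv (wd f) (wd (wd f))"
    using wd_wd_weak_deriv[OF gh(1-5)] by auto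
qed

lemma V02I: "H01p f g \<Longrightarrow> L2 h \<Longrightarrow> has_weak_deriv g h \<Longrightarrow> V02 f"
  using H01p_D[of f g] by (auto simp: V02_def H2_def)

lemma V02_imp_H01: "V02 f \<Longrightarrow> H01 f"
  using V02_facts(1) H01I by blast

lemma H1_norm_nrm: "H1_norm f = sqrt ((nrm f)\<^sup>2 + (nrm (wd f))\<^sup>2)"
  by (simp add: H1_norm_def ip_self)

lemma H2_norm_nrm: "H2_norm f = sqrt ((nrm f)\<^sup>2 + (nrm (wd f))\<^sup>2 + (nrm (wd (wd f)))\<^sup>2)"
  by (simp add: H2_norm_def ip_self)

lemma nrm_le_H1_norm: "nrm f \<le> H1_norm f" "nrm (wd f) \<le> H1_norm f"
  unfolding H1_norm_nrm by (auto intro!: real_le_rsqrt)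

lemma nrm_le_H2_norm: "nrm f \<le> H2_norm f" "nrm (wd (wd f)) \<le> H2_norm f"
  unfolding H2_norm_nrm by (auto intro!: real_le_rsqrt)

lemma H01_wd_linear:
  assumes "H01 f" "H01 g"
  shows "AE x in Lon 0 1. wd (\<lambda>x. a * f x + b * g x) x = a * wd f x + b * wd g x"
    and "H01 (\<lambda>x. a * f x + b * g x)"
proof -
  have p: "H01p (\<lambda>x. a * f x + b * g x) (\<lambda>x. a * wd f x + b * wd g x)"
    by (intro H01p_linear H01_H01p assms)
  show "AE x in Lon 0 1. wd (\<lambda>x. a * f x + b * g x) x = a * wd f x + b * wd g x"
    using wd_weak_deriv(3)[OF H01p_D(2)[OF p] H01p_D(3)[OF p]] .
  show "H01 (\<lambda>x. a * f x + b * g x)" by (rule H01I[OF p])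
qed

lemma V02_wd_wd_linear:
  assumes "V02 f" "V02 g"
  shows "AE x in Lon 0 1. wd (wd (\<lambda>x. a * f x + b * g x)) x = a * wd (wd f) x + b * wd (wd g) x"
proof -
  note F = V02_facts[OF assms(1)] and G = V02_facts[OF assms(2)]
  have p: "H01p (\<lambda>x. a * f x + b * g x) (\<lambda>x. a * wd f x + b * wd g x)"
    by (rule H01p_linear[OF F(1) G(1)])
  have q: "has_weak_deriv (\<lambda>x. a * wd f x + b * wd g x) (\<lambda>x. a * wd (wd f) x + b * wd (wd g) x)"
    using F G H01p_D by (intro has_weak_deriv_linear) auto
  show ?thesis
    by (rule wd_wd_weak_deriv(3)[OF H01p_D(1)[OF p] H01p_D(2)[OF p] _ H01p_D(3)[OF p] q])
       (intro L2_add L2_cmult F G)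
qed

lemma es_wd:
  shows "V02 (es k)" "AE x in Lon 0 1. wd (es k) x = lam k * ec k x"
    "AE x in Lon 0 1. wd (wd (es k)) x = - (lam k)\<^sup>2 * es k x"
proof -
  have w2: "has_weak_deriv (\<lambda>x. lam k * ec k x) (\<lambda>x. - (lam k)\<^sup>2 * es k x)"
    by (rule classical_weak_deriv)
       (auto intro!: derivative_eq_intros ec_DERIV continuous_intros continuous_es simp: power2_eq_square)
  have L: "L2 (\<lambda>x. lam k * ec k x)" "L2 (\<lambda>x. - (lam k)\<^sup>2 * es k x)"
    by (intro L2_cmult L2_ec L2_es)+
  show "V02 (es k)" by (rule V02I[OF H01p_es L(2) w2])
  show "AE x in Lon 0 1. wd (es k) x = lam k * ec k x"
    by (rule wd_weak_deriv(3)[OF L(1) weak_deriv_es])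
  show "AE x in Lon 0 1. wd (wd (es k)) x = - (lam k)\<^sup>2 * es k x"
    by (rule wd_wd_weak_deriv(3)[OF L2_es L weak_deriv_es w2])
qed

lemma nrm_es: "nrm (es k) = 1"
  using es_orthonormal[of k k] by (simp add: l2n_def power2_eq_square)

lemma V02_sine_sum:
  shows "V02 (\<lambda>x. \<Sum>k<N. a k * es k x)"
    and "AE x in Lon 0 1. wd (\<lambda>x. \<Sum>k<N. a k * es k x) x = (\<Sum>k<N. a k * lam k * ec k x)"
proof -
  let ?P = "\<lambda>x. \<Sum>k<N. a k * es k x" and ?Q = "\<lambda>x. \<Sum>k<N. a k * lam k * ec k x"
    and ?R = "\<lambda>x. \<Sum>k<N. - a k * (lam k)\<^sup>2 * es k x"
  have c: "continuous_on S ?P" "continuous_on S ?Q" "continuous_on S ?R" for S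
    by (intro continuous_intros continuous_es continuous_ec)+
  have "(?P has_real_derivative ?Q x) (at x)" for x
    by (auto intro!: derivative_eq_intros es_DERIV sum.cong)
  then have P: "has_weak_deriv ?P ?Q" by (rule classical_weak_deriv[OF _ c(2)])
  have "(?Q has_real_derivative ?R x) (at x)" for x
    by (auto intro!: derivative_eq_intros ec_DERIV sum.cong simp: power2_eq_square)
  then have Q: "has_weak_deriv ?Q ?R" by (rule classical_weak_deriv[OF _ c(3)])
  have z: "zero_bdry ?P"
    unfolding zero_bdry_def by (intro exI[of _ ?P] conjI c(1)) (auto simp: es_boundary)
  have "H01p ?P ?Q" by (intro H01p_I L2_continuous c P z)
  then show "V02 ?P" by (rule V02I[OF _ L2_continuous[OF c(3)] Q])
  show "AE x in Lon 0 1. wd ?P x = ?Q x" by (rule wd_weak_deriv(3)[OF L2_continuous[OF c(2)] P])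
qed

text \<open>Termwise differentiation of the sine sum gives the cosine sum of
  \<open>wd \<phi>\<close>, because the coefficients match and the constant one is zero. Both sums
  therefore converge by the basis property.\<close>

lemma H01_sine_expansion:
  assumes "H01 \<phi>"
  defines "P \<equiv> \<lambda>N x. \<Sum>k<N. ip \<phi> (es k) * es k x"
  shows "(\<lambda>N. nrm (\<lambda>x. P N x - \<phi> x)) \<longlonglongrightarrow> 0"
    and "(\<lambda>N. nrm (\<lambda>x. wd (P N) x - wd \<phi> x)) \<longlonglongrightarrow> 0"
proof -
  note p = H01_H01p[OF assms(1)]
  note L = H01p_D(1,2)[OF p]
  show "(\<lambda>N. nrm (\<lambda>x. P N x - \<phi> x)) \<longlonglongrightarrow> 0"
    using onb_converges[OF onb_es L(1)[unfolded L2_iff_sqint]] by (simp add: P_def ip_Lon)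
  have "(\<lambda>N. nrm (\<lambda>x. (\<Sum>k<N. ip (wd \<phi>) (cb k) * cb k x) - wd \<phi> x)) \<longlonglongrightarrow> 0"
    using onb_converges[OF onb_cb L(2)[unfolded L2_iff_sqint]] by (simp add: ip_Lon)
  from LIMSEQ_Suc[OF this]
  have "(\<lambda>N. nrm (\<lambda>x. (\<Sum>k<Suc N. ip (wd \<phi>) (cb k) * cb k x) - wd \<phi> x)) \<longlonglongrightarrow> 0" .
  also have "(\<lambda>N. nrm (\<lambda>x. (\<Sum>k<Suc N. ip (wd \<phi>) (cb k) * cb k x) - wd \<phi> x))
      = (\<lambda>N. nrm (\<lambda>x. wd (P N) x - wd \<phi> x))"
  proof
    fix N
    \<comment> \<open>N sine terms correspond to N + 1 cosine terms, the first of which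
      vanishes.\<close>
    have sh: "(\<Sum>k<Suc N. ip (wd \<phi>) (cb k) * cb k x) = (\<Sum>k<N. ip \<phi> (es k) * lam k * ec k x)" for x
      using H01p_cosine_coeff_0[OF p] H01p_cosine_coeff[OF p]
      by (simp only: sum.lessThan_Suc_shift) (simp add: cb_def mult.commute)
    have "AE x in Lon 0 1. wd (P N) x = (\<Sum>k<Suc N. ip (wd \<phi>) (cb k) * cb k x)"
      using V02_sine_sum(2)[where N = N and a = "\<lambda>k. ip \<phi> (es k)"] by (simp only: sh P_def)
    moreover have "L2 (wd (P N))"
      unfolding P_def by (rule H01p_D(2)[OF V02_facts(1)[OF V02_sine_sum(1)]])
    moreover have "L2 (\<lambda>x. \<Sum>k<Suc N. ip (wd \<phi>) (cb k) * cb k x)"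
      unfolding sh by (intro L2_sum L2_cmult L2_ec)
    ultimately show "nrm (\<lambda>x. (\<Sum>k<Suc N. ip (wd \<phi>) (cb k) * cb k x) - wd \<phi> x) = nrm (\<lambda>x. wd (P N) x - wd \<phi> x)"
      by (intro l2n_cong_AE L2_measurable L2_diff L(2)) (auto elim: eventually_mono)
  qed
  finally show "(\<lambda>N. nrm (\<lambda>x. wd (P N) x - wd \<phi> x)) \<longlonglongrightarrow> 0" .
qed

text \<open>The equation for \<open>v\<close> is only tested with \<open>V02\<close>; density of the sine polynomials in
  \<open>H01\<close> extends it to all of \<open>H01\<close>.\<close>

lemma H01_extension:
  assumes \<phi>: "H01 \<phi>" and W: "bounded_lin_fun H01 H1_norm W" and G: "L2 G"
    and eq: "\<And>\<psi>. V02 \<psi> \<Longrightarrow> W \<psi> = - ip G (wd \<psi>)"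
  shows "W \<phi> = - ip G (wd \<phi>)"
proof -
  define P where "P N x = (\<Sum>k<N. ip \<phi> (es k) * es k x)" for N x
  have V: "V02 (P N)" for N unfolding P_def by (rule V02_sine_sum(1))
  note H = V02_imp_H01[OF V]
  note L = H01p_D(1,2)[OF H01_H01p[OF \<phi>]]
  have LP: "L2 (P N)" "L2 (wd (P N))" for N using H01p_D(1,2)[OF H01_H01p[OF H]] by auto
  have lim: "(\<lambda>N. nrm (\<lambda>x. P N x - \<phi> x)) \<longlonglongrightarrow> 0" "(\<lambda>N. nrm (\<lambda>x. wd (P N) x - wd \<phi> x)) \<longlonglongrightarrow> 0"
    using H01_sine_expansion[OF \<phi>] unfolding P_def by auto
  obtain C where C: "\<And>\<psi>. H01 \<psi> \<Longrightarrow> \<bar>W \<psi>\<bar> \<le> C * H1_norm \<psi>"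
    using W by (auto simp: bounded_lin_fun_def)
  \<comment> \<open>The difference is spelled with factors 1 and -1 to fit the linearity clause of
    \<open>bounded_lin_fun\<close>.\<close>
  have lin: "W (\<lambda>x. 1 * P N x + - 1 * \<phi> x) = 1 * W (P N) + - 1 * W \<phi>" for N
    using W H \<phi> unfolding bounded_lin_fun_def by blast
  have nm: "H1_norm (\<lambda>x. 1 * P N x + - 1 * \<phi> x)
      = sqrt ((nrm (\<lambda>x. P N x - \<phi> x))\<^sup>2 + (nrm (\<lambda>x. wd (P N) x - wd \<phi> x))\<^sup>2)" for N
  proof -
    have "nrm (wd (\<lambda>x. 1 * P N x + - 1 * \<phi> x)) = nrm (\<lambda>x. wd (P N) x - wd \<phi> x)"
    proof (rule l2n_cong_AE)
      show "wd (\<lambda>x. 1 * P N x + - 1 * \<phi> x) \<in> borel_measurable (Lon 0 1)"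
        by (rule L2_measurable[OF H01p_D(2)[OF H01_H01p[OF H01_wd_linear(2)[OF H \<phi>]]]])
      show "(\<lambda>x. wd (P N) x - wd \<phi> x) \<in> borel_measurable (Lon 0 1)"
        by (rule L2_measurable[OF L2_diff[OF LP(2) L(2)]])
      show "AE x in Lon 0 1. wd (\<lambda>x. 1 * P N x + - 1 * \<phi> x) x = wd (P N) x - wd \<phi> x"
        using H01_wd_linear(1)[OF H[of N] \<phi>, where a = 1 and b = "- 1"] by eventually_elim simp
    qed
    then show ?thesis by (simp add: H1_norm_nrm)
  qed
  have "(\<lambda>N. H1_norm (\<lambda>x. 1 * P N x + - 1 * \<phi> x)) \<longlonglongrightarrow> sqrt (0\<^sup>2 + 0\<^sup>2)"
    unfolding nm by (intro tendsto_intros lim)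
  then have z: "(\<lambda>N. C * H1_norm (\<lambda>x. 1 * P N x + - 1 * \<phi> x)) \<longlonglongrightarrow> 0"
    using tendsto_mult_right_zero by fastforce
  have "(\<lambda>N. W (P N) - W \<phi>) \<longlonglongrightarrow> 0"
  proof (rule tendsto_rabs_zero_cancel, rule tendsto_sandwich[OF _ _ tendsto_const z])
    have "\<bar>W (P N) - W \<phi>\<bar> \<le> C * H1_norm (\<lambda>x. 1 * P N x + - 1 * \<phi> x)" for N
      using C[OF H01_wd_linear(2)[OF H[of N] \<phi>, where a = 1 and b = "- 1"]] lin[of N] by simp
    then show "\<forall>\<^sub>F N in sequentially. \<bar>W (P N) - W \<phi>\<bar> \<le> C * H1_norm (\<lambda>x. 1 * P N x + - 1 * \<phi> x)" by simp
  qed auto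
  then have "(\<lambda>N. W (P N)) \<longlonglongrightarrow> W \<phi>" by (rule LIM_zero_cancel)
  moreover have "(\<lambda>N. - ip (wd (P N)) G) \<longlonglongrightarrow> - ip (wd \<phi>) G"
    using l2ip_tendsto[of "Lon 0 1" "\<lambda>N. wd (P N)" "wd \<phi>" G] LP(2) L(2) G lim(2)
    by (intro tendsto_minus) (simp add: ip_Lon L2_iff_sqint)
  moreover have "W (P N) = - ip (wd (P N)) G" for N using eq[OF V] by (simp add: ip_commute)
  ultimately have "W \<phi> = - ip (wd \<phi>) G" using LIMSEQ_unique by simp
  then show ?thesis by (simp add: ip_commute)
qed

section \<open>Dual norms\<close>

text \<open>A real supremum carries information only over a nonempty set that is bounded above,
  which \<open>ne\<close> and \<open>w\<close> provide.\<close>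

lemma dual_norm_bounds:
  assumes ne: "\<exists>\<phi>. V \<phi> \<and> N \<phi> \<noteq> 0" and N0: "\<And>\<phi>. 0 \<le> N \<phi>"
    and w: "\<And>\<phi>. V \<phi> \<Longrightarrow> \<bar>w \<phi>\<bar> \<le> c * N \<phi>"
  shows "0 \<le> dual_norm V N w" "dual_norm V N w \<le> c"
    "bdd_above ((\<lambda>\<phi>. \<bar>w \<phi>\<bar> / N \<phi>) ` {\<phi>. V \<phi> \<and> N \<phi> \<noteq> 0})"
proof -
  let ?S = "{\<phi>. V \<phi> \<and> N \<phi> \<noteq> 0}"
  have le: "\<bar>w \<phi>\<bar> / N \<phi> \<le> c" if "\<phi> \<in> ?S" for \<phi>
  proof -
    have "0 < N \<phi>" using N0[of \<phi>] that by simp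
    then show ?thesis using w[of \<phi>] that by (simp add: pos_divide_le_eq)
  qed
  then show bdd: "bdd_above ((\<lambda>\<phi>. \<bar>w \<phi>\<bar> / N \<phi>) ` ?S)" by (intro bdd_aboveI[of _ c]) auto
  show "dual_norm V N w \<le> c" unfolding dual_norm_def by (rule cSUP_least) (use ne le in auto)
  obtain \<phi> where \<phi>: "\<phi> \<in> ?S" using ne by auto
  have "0 \<le> \<bar>w \<phi>\<bar> / N \<phi>" using N0 by simp
  also have "\<dots> \<le> dual_norm V N w" unfolding dual_norm_def by (rule cSUP_upper[OF \<phi> bdd])
  finally show "0 \<le> dual_norm V N w" .
qed

text \<open>Reverse triangle inequality for a supremum; through it dual norms converge along
  approximating functionals.\<close>

lemma dual_norm_lipschitz:
  assumes ne: "\<exists>\<phi>. V \<phi> \<and> N \<phi> \<noteq> 0" and N0: "\<And>\<phi>. 0 \<le> N \<phi>"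
    and w: "\<And>\<phi>. V \<phi> \<Longrightarrow> \<bar>w \<phi>\<bar> \<le> c * N \<phi>" and w': "\<And>\<phi>. V \<phi> \<Longrightarrow> \<bar>w' \<phi>\<bar> \<le> c' * N \<phi>"
    and e: "\<And>\<phi>. V \<phi> \<Longrightarrow> \<bar>w \<phi> - w' \<phi>\<bar> \<le> e * N \<phi>"
  shows "\<bar>dual_norm V N w - dual_norm V N w'\<bar> \<le> e"
proof -
  have half: "dual_norm V N a \<le> dual_norm V N b + e"
    if b: "\<And>\<phi>. V \<phi> \<Longrightarrow> \<bar>b \<phi>\<bar> \<le> c2 * N \<phi>" and ab: "\<And>\<phi>. V \<phi> \<Longrightarrow> \<bar>a \<phi> - b \<phi>\<bar> \<le> e * N \<phi>" for a b c2
    unfolding dual_norm_def[of V N a]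
  proof (rule cSUP_least)
    fix \<phi> assume \<phi>: "\<phi> \<in> {\<phi>. V \<phi> \<and> N \<phi> \<noteq> 0}"
    then have pos: "0 < N \<phi>" using N0[of \<phi>] by simp
    have "\<bar>a \<phi>\<bar> / N \<phi> \<le> (\<bar>b \<phi>\<bar> + e * N \<phi>) / N \<phi>"
      using ab[of \<phi>] \<phi> pos by (intro divide_right_mono) auto
    also have "\<dots> = \<bar>b \<phi>\<bar> / N \<phi> + e" using pos by (simp add: field_simps)
    also have "\<bar>b \<phi>\<bar> / N \<phi> \<le> dual_norm V N b"
      unfolding dual_norm_def by (rule cSUP_upper[OF \<phi> dual_norm_bounds(3)[OF ne N0 b]])
    finally show "\<bar>a \<phi>\<bar> / N \<phi> \<le> dual_norm V N b + e" by simp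
  qed (use ne in auto)
  have e': "\<And>\<phi>. V \<phi> \<Longrightarrow> \<bar>w' \<phi> - w \<phi>\<bar> \<le> e * N \<phi>" using e by (simp add: abs_minus_commute)
  show ?thesis using half[OF w' e] half[OF w e'] by linarith
qed

lemma H01_nontrivial: "\<exists>\<phi>. H01 \<phi> \<and> H1_norm \<phi> \<noteq> 0"
  using V02_imp_H01[OF es_wd(1)[of 0]] nrm_le_H1_norm(1)[of "es 0"] by (intro exI[of _ "es 0"]) (simp add: nrm_es)

lemma V02_nontrivial: "\<exists>\<phi>. V02 \<phi> \<and> H2_norm \<phi> \<noteq> 0"
  using es_wd(1)[of 0] nrm_le_H2_norm(1)[of "es 0"] by (intro exI[of _ "es 0"]) (simp add: nrm_es)

lemma H1_norm_nonneg: "0 \<le> H1_norm f" and H2_norm_nonneg: "0 \<le> H2_norm f"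
  by (simp_all add: H1_norm_nrm H2_norm_nrm)

section \<open>Stability of weak solutions with respect to the coefficient\<close>

text \<open>The part of \<open>Dset\<close> that the evolution equations see; the H1 part acts
  through compactness and through the functional.\<close>

definition coef :: "real \<Rightarrow> real \<Rightarrow> (real \<Rightarrow> real) \<Rightarrow> bool" where
  "coef \<alpha>0 \<alpha>1 d \<longleftrightarrow> 0 < \<alpha>0 \<and> d \<in> borel_measurable (Lon 0 1) \<and> (AE x in Lon 0 1. \<alpha>0 \<le> d x \<and> d x \<le> \<alpha>1)"

lemma coef_bound: "coef \<alpha>0 \<alpha>1 d \<Longrightarrow> AE x in Lon 0 1. \<bar>d x\<bar> \<le> \<alpha>1"
  unfolding coef_def by (auto elim: eventually_mono)

lemma coef_mult_jmeas: "coef \<alpha>0 \<alpha>1 d \<Longrightarrow> jmeas T w \<Longrightarrow> jmeas T (\<lambda>t x. d x * w t x)"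
  using jmeas_bounded_mult coef_bound coef_def by blast

lemma coef_mult_L2: "coef \<alpha>0 \<alpha>1 d \<Longrightarrow> L2 w \<Longrightarrow> L2 (\<lambda>x. d x * w x)"
  using L2_bounded_mult coef_bound coef_def by blast

text \<open>A weak solution in the form that the energy estimates use: jointly measurable
  derivatives in place of the slicewise choices \<open>wd\<close>, and integral equations for the
  sine modes in place of functionals.\<close>

definition rsol :: "real \<Rightarrow> (real \<Rightarrow> real) \<Rightarrow> (real \<Rightarrow> real \<Rightarrow> real) \<Rightarrow> (real \<Rightarrow> real \<Rightarrow> real) \<Rightarrow>
    (real \<Rightarrow> real \<Rightarrow> real) \<Rightarrow> (real \<Rightarrow> real \<Rightarrow> real) \<Rightarrow> (real \<Rightarrow> real \<Rightarrow> real) \<Rightarrow> bool" where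
  "rsol T d u v u1 u2 v1 \<longleftrightarrow>
     jmeas T u \<and> jmeas T u1 \<and> jmeas T u2 \<and> jmeas T v \<and> jmeas T v1 \<and> cont_L2 T u \<and> cont_L2 T v
   \<and> (AE t in Lon 0 T. H01p (u t) (u1 t) \<and> has_weak_deriv (u1 t) (u2 t))
   \<and> (AE t in Lon 0 T. H01p (v t) (v1 t))
   \<and> (\<forall>k. \<forall>t\<in>{0..T}. ip (v t) (es k) = ip (v 0) (es k)
        + integral\<^sup>L (Lon 0 t) (\<lambda>s. - lam k * ip (\<lambda>x. d x * v1 s x) (ec k)))
   \<and> (\<forall>k. \<forall>t\<in>{0..T}. ip (u t) (es k) = ip (u 0) (es k)
        + integral\<^sup>L (Lon 0 t) (\<lambda>s. (lam k)\<^sup>2 * ip (u2 s) (es k) + ip (v s) (es k)))"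

text \<open>The derivatives from \<open>L2_V02\<close> and \<open>L2_H01\<close> replace
  \<open>wd\<close> in the equations. The second equation is extended to all of \<open>H01\<close>,
  because \<open>vt\<close> is tested there when limits are taken.\<close>

lemma weak_sol_unfold:
  assumes "T > 0" and d: "coef \<alpha>0 \<alpha>1 d" and ws: "weak_sol T u0 v0 d u v"
  obtains u1 u2 v1 ut vt where "rsol T d u v u1 u2 v1"
    "L2_dual T V02 H2_norm ut" "L2_dual T H01 H1_norm vt"
    "is_time_deriv T V02 u ut" "is_time_deriv T H01 v vt"
    "AE t in Lon 0 T. \<forall>\<phi>. V02 \<phi> \<longrightarrow> ut t \<phi> = ip (v t) \<phi> - ip (u2 t) (wd (wd \<phi>))"
    "AE t in Lon 0 T. \<forall>\<phi>. H01 \<phi> \<longrightarrow> vt t \<phi> = - ip (\<lambda>x. d x * v1 t x) (wd \<phi>)"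
proof -
  interpret finite_measure "Lon 0 T" by (rule finite_measure_Lon)
  obtain u1 u2 where u: "jmeas T u" "jmeas T u1" "jmeas T u2"
    "AE t in Lon 0 T. has_weak_deriv (u t) (u1 t) \<and> has_weak_deriv (u1 t) (u2 t) \<and> zero_bdry (u t)"
    using ws by (auto simp: weak_sol_def L2_V02_def)
  obtain v1 where v: "jmeas T v" "jmeas T v1"
    "AE t in Lon 0 T. has_weak_deriv (v t) (v1 t) \<and> zero_bdry (v t)"
    using ws by (auto simp: weak_sol_def L2_H01_def)
  obtain ut vt where t: "L2_dual T V02 H2_norm ut" "L2_dual T H01 H1_norm vt"
    "is_time_deriv T V02 u ut" "is_time_deriv T H01 v vt"
    "AE t in Lon 0 T. \<forall>\<phi>. V02 \<phi> \<longrightarrow> ut t \<phi> + ip (wd (wd (u t))) (wd (wd \<phi>)) = ip (v t) \<phi>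
        \<and> vt t \<phi> + ip (\<lambda>x. d x * wd (v t) x) (wd \<phi>) = 0"
    using ws unfolding weak_sol_def by blast
  have c: "cont_L2 T u" "cont_L2 T v" using ws by (auto simp: weak_sol_def)
  have Hu: "AE t in Lon 0 T. H01p (u t) (u1 t) \<and> has_weak_deriv (u1 t) (u2 t)"
    using u(4) jmeas_section[OF u(1)] jmeas_section[OF u(2)] by eventually_elim (auto intro: H01p_I)
  have Hv: "AE t in Lon 0 T. H01p (v t) (v1 t)"
    using v(3) jmeas_section[OF v(1)] jmeas_section[OF v(2)] by eventually_elim (auto intro: H01p_I)
  have eu: "AE t in Lon 0 T. \<forall>\<phi>. V02 \<phi> \<longrightarrow> ut t \<phi> = ip (v t) \<phi> - ip (u2 t) (wd (wd \<phi>))"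
    using t(5) Hu jmeas_section[OF u(3)]
  proof eventually_elim
    case (elim t)
    note p = H01p_D[of "u t" "u1 t"]
    have w: "L2 (wd (wd (u t)))" "AE x in Lon 0 1. wd (wd (u t)) x = u2 t x"
      using wd_wd_weak_deriv[of "u t" "u1 t" "u2 t"] p elim by auto
    show ?case
    proof (intro allI impI)
      fix \<phi> assume "V02 \<phi>"
      moreover have "ip (wd (wd (u t))) (wd (wd \<phi>)) = ip (u2 t) (wd (wd \<phi>))"
        by (rule ip_cong_AE) (use w elim V02_facts(2)[OF \<open>V02 \<phi>\<close>] in \<open>auto intro: L2_measurable\<close>)
      ultimately show "ut t \<phi> = ip (v t) \<phi> - ip (u2 t) (wd (wd \<phi>))" using elim by auto
    qed
  qed
  have bl: "AE t in Lon 0 T. bounded_lin_fun H01 H1_norm (vt t)" using t(2) by (simp add: L2_dual_def)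
  have ev: "AE t in Lon 0 T. \<forall>\<phi>. H01 \<phi> \<longrightarrow> vt t \<phi> = - ip (\<lambda>x. d x * v1 t x) (wd \<phi>)"
    using t(5) Hv bl
  proof eventually_elim
    case (elim t)
    note p = H01p_D[OF elim(2)]
    note w = wd_weak_deriv[OF p(2,3)]
    have Ld: "L2 (\<lambda>x. d x * wd (v t) x)" "L2 (\<lambda>x. d x * v1 t x)"
      by (rule coef_mult_L2[OF d w(1)], rule coef_mult_L2[OF d p(2)])
    have "vt t \<psi> = - ip (\<lambda>x. d x * v1 t x) (wd \<psi>)" if "V02 \<psi>" for \<psi>
    proof -
      have "AE x in Lon 0 1. d x * wd (v t) x = d x * v1 t x" using w(3) by eventually_elim simp
      then have "ip (\<lambda>x. d x * wd (v t) x) (wd \<psi>) = ip (\<lambda>x. d x * v1 t x) (wd \<psi>)"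
        by (intro ip_cong_AE) (use Ld H01p_D(2)[OF V02_facts(1)[OF that]] in \<open>auto intro: L2_measurable\<close>)
      then show ?thesis using elim(1) that by auto
    qed
    then show ?case using H01_extension[OF _ elim(3) Ld(2)] by blast
  qed
  have mv: "ip (v t) (es k) = ip (v 0) (es k) + integral\<^sup>L (Lon 0 t) (\<lambda>s. - lam k * ip (\<lambda>x. d x * v1 s x) (ec k))"
    if tt: "t \<in> {0..T}" for k t
  proof (rule time_deriv_integrated[OF \<open>T > 0\<close> c(2) t(4) V02_imp_H01[OF es_wd(1)] L2_es _ _ tt])
    show "integrable (Lon 0 T) (\<lambda>s. - lam k * ip (\<lambda>x. d x * v1 s x) (ec k))"
      by (intro integrable_mult_right sqint_integrable jmeas_ip_sqint L2_ec coef_mult_jmeas[OF d] v(2))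
    show "AE t in Lon 0 T. vt t (es k) = - lam k * ip (\<lambda>x. d x * v1 t x) (ec k)"
      using ev Hv
    proof eventually_elim
      case (elim t)
      have Ld: "L2 (\<lambda>x. d x * v1 t x)" by (rule coef_mult_L2[OF d H01p_D(2)[OF elim(2)]])
      have "ip (\<lambda>x. d x * v1 t x) (wd (es k)) = ip (\<lambda>x. d x * v1 t x) (\<lambda>x. lam k * ec k x)"
        by (rule ip_cong_AE[OF L2_measurable[OF Ld] L2_measurable[OF Ld]
              L2_measurable[OF H01p_D(2)[OF V02_facts(1)[OF es_wd(1)]]] L2_measurable[OF L2_cmult[OF L2_ec]] _ es_wd(2)]) simp
      then show ?case using elim(1) V02_imp_H01[OF es_wd(1)] by (simp add: ip_cmult_right)
    qed
  qed
  have mu: "ip (u t) (es k) = ip (u 0) (es k)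
      + integral\<^sup>L (Lon 0 t) (\<lambda>s. (lam k)\<^sup>2 * ip (u2 s) (es k) + ip (v s) (es k))"
    if tt: "t \<in> {0..T}" for k t
  proof (rule time_deriv_integrated[OF \<open>T > 0\<close> c(1) t(3) es_wd(1) L2_es _ _ tt])
    show "integrable (Lon 0 T) (\<lambda>s. (lam k)\<^sup>2 * ip (u2 s) (es k) + ip (v s) (es k))"
      by (intro Bochner_Integration.integrable_add integrable_mult_right sqint_integrable jmeas_ip_sqint L2_es u v)
    show "AE t in Lon 0 T. ut t (es k) = (lam k)\<^sup>2 * ip (u2 t) (es k) + ip (v t) (es k)"
      using eu jmeas_section[OF u(3)]
    proof eventually_elim
      case (elim t)
      have "ip (u2 t) (wd (wd (es k))) = ip (u2 t) (\<lambda>x. - (lam k)\<^sup>2 * es k x)"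
        by (rule ip_cong_AE[OF L2_measurable[OF elim(2)] L2_measurable[OF elim(2)]
              L2_measurable[OF V02_facts(2)[OF es_wd(1)]] L2_measurable[OF L2_cmult[OF L2_es]] _ es_wd(3)]) simp
      also have "\<dots> = - (lam k)\<^sup>2 * ip (u2 t) (es k)" by (rule ip_cmult_right)
      finally show ?case using elim(1) es_wd(1) by simp
    qed
  qed
  have "rsol T d u v u1 u2 v1"
    unfolding rsol_def using u v c Hu Hv mv mu by blast
  with t eu ev show thesis using that by blast
qed

section \<open>Energy bound and stability estimate\<close>

lemma integral_Lon_mono_set:
  fixes f :: "real \<Rightarrow> real"
  assumes f: "integrable (Lon 0 T) f" "AE t in Lon 0 T. 0 \<le> f t" and s: "s \<in> {0..T}"
  shows "integral\<^sup>L (Lon 0 s) f \<le> integral\<^sup>L (Lon 0 T) f"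
proof -
  have "0 \<le> integral\<^sup>L (Lon s T) f"
    by (rule Bochner_Integration.integral_nonneg_AE) (use AE_Lon_subset[OF f(2), of s T] s in auto)
  then show ?thesis using Lint_split[OF f(1), of s] s by simp
qed

text \<open>The energy identity at time \<open>T\<close> with the final energy dropped and
  \<open>d\<close> bounded below by \<open>\<alpha>0\<close>.\<close>

lemma rsol_energy:
  assumes d: "coef \<alpha>0 \<alpha>1 d" and r: "rsol T d u v u1 u2 v1" and "T > 0"
  shows "2 * \<alpha>0 * (jn T v1)\<^sup>2 \<le> (nrm (v 0))\<^sup>2"
proof -
  have J: "jmeas T v1" and c: "cont_L2 T v" and H: "AE t in Lon 0 T. H01p (v t) (v1 t)"
    using r unfolding rsol_def by blast+
  have m: "ip (v t) (es k) = ip (v 0) (es k) + integral\<^sup>L (Lon 0 t) (\<lambda>s. - lam k * ip (\<lambda>x. d x * v1 s x) (ec k))"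
    if "t \<in> {0..T}" for k t
    using r that unfolding rsol_def by blast
  have "(nrm (v T))\<^sup>2 = (nrm (v 0))\<^sup>2 - 2 * (\<integral>t. ip (v1 t) (\<lambda>x. d x * v1 t x) \<partial>Lon 0 T)"
    by (rule energy_second_order[OF c J coef_mult_jmeas[OF d J] H m]) (use \<open>T > 0\<close> in auto)
  moreover have "\<alpha>0 * (jn T v1)\<^sup>2 \<le> (\<integral>t. ip (v1 t) (\<lambda>x. d x * v1 t x) \<partial>Lon 0 T)"
  proof -
    have "(\<integral>t. \<alpha>0 * (nrm (v1 t))\<^sup>2 \<partial>Lon 0 T) \<le> (\<integral>t. ip (v1 t) (\<lambda>x. d x * v1 t x) \<partial>Lon 0 T)"
    proof (rule integral_mono_AE)
      show "integrable (Lon 0 T) (\<lambda>t. \<alpha>0 * (nrm (v1 t))\<^sup>2)"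
        using jmeas_nrm(1)[OF J] by (auto simp: sqint_def)
      show "integrable (Lon 0 T) (\<lambda>t. ip (v1 t) (\<lambda>x. d x * v1 t x))"
        by (rule jmeas_ip(1)[OF J coef_mult_jmeas[OF d J]])
      show "AE t in Lon 0 T. \<alpha>0 * (nrm (v1 t))\<^sup>2 \<le> ip (v1 t) (\<lambda>x. d x * v1 t x)"
        using jmeas_section[OF J]
      proof eventually_elim
        case (elim t)
        have "\<alpha>0 * (nrm (v1 t))\<^sup>2 = (\<integral>x. \<alpha>0 * (v1 t x)\<^sup>2 \<partial>Lon 0 1)" by (simp add: l2n_sq)
        also have "\<dots> \<le> (\<integral>x. v1 t x * (d x * v1 t x) \<partial>Lon 0 1)"
        proof (rule integral_mono_AE)
          show "integrable (Lon 0 1) (\<lambda>x. \<alpha>0 * (v1 t x)\<^sup>2)" using elim by (simp add: L2_iff_sqint sqint_def)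
          show "integrable (Lon 0 1) (\<lambda>x. v1 t x * (d x * v1 t x))"
            using sqint_mult_integrable[of "Lon 0 1"] elim coef_mult_L2[OF d elim] by (simp add: L2_iff_sqint)
          have "AE x in Lon 0 1. \<alpha>0 \<le> d x \<and> d x \<le> \<alpha>1" using d by (simp add: coef_def)
          then show "AE x in Lon 0 1. \<alpha>0 * (v1 t x)\<^sup>2 \<le> v1 t x * (d x * v1 t x)"
          proof eventually_elim
            case (elim x)
            have "\<alpha>0 * (v1 t x)\<^sup>2 \<le> d x * (v1 t x)\<^sup>2" by (rule mult_right_mono) (use elim in auto)
            then show ?case by (simp add: power2_eq_square ac_simps)
          qed
        qed
        finally show ?case by (simp add: ip_Lon)
      qed
    qed
    then show ?thesis using jmeas_nrm(2)[OF J] by (simp add: l2n_sq[of "Lon 0 T", symmetric])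
  qed
  ultimately show ?thesis using zero_le_power2[of "nrm (v T)"] by linarith
qed

text \<open>The flux difference is d (p - q) + (d - d') q. Young's inequality with weight
  \<open>\<alpha>0\<close> spends half of the coercive term on the second summand, which explains
  both constants.\<close>

lemma difference_coercive:
  assumes d: "coef \<alpha>0 \<alpha>1 d" and d': "coef \<alpha>0 \<alpha>1 d'" and \<delta>: "AE x in Lon 0 1. \<bar>d x - d' x\<bar> \<le> \<delta>"
    and p: "L2 p" and q: "L2 q"
  shows "\<alpha>0 / 2 * (nrm (\<lambda>x. p x - q x))\<^sup>2 - \<delta>\<^sup>2 / (2 * \<alpha>0) * (nrm q)\<^sup>2
    \<le> ip (\<lambda>x. p x - q x) (\<lambda>x. d x * p x - d' x * q x)"
proof -
  have a: "0 < \<alpha>0" using d by (simp add: coef_def)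
  let ?w = "\<lambda>x. p x - q x"
  have w: "L2 ?w" by (rule L2_diff[OF p q])
  have G: "L2 (\<lambda>x. d x * p x - d' x * q x)" by (intro L2_diff coef_mult_L2[OF d] coef_mult_L2[OF d'] p q)
  have "\<alpha>0 / 2 * (nrm ?w)\<^sup>2 - \<delta>\<^sup>2 / (2 * \<alpha>0) * (nrm q)\<^sup>2
     = (\<integral>x. \<alpha>0 / 2 * (?w x)\<^sup>2 - \<delta>\<^sup>2 / (2 * \<alpha>0) * (q x)\<^sup>2 \<partial>Lon 0 1)"
    using w q by (simp add: l2n_sq L2_iff_sqint sqint_def)
  also have "\<dots> \<le> (\<integral>x. ?w x * (d x * p x - d' x * q x) \<partial>Lon 0 1)"
  proof (rule integral_mono_AE)
    show "integrable (Lon 0 1) (\<lambda>x. \<alpha>0 / 2 * (?w x)\<^sup>2 - \<delta>\<^sup>2 / (2 * \<alpha>0) * (q x)\<^sup>2)"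
      using w q by (simp add: L2_iff_sqint sqint_def)
    show "integrable (Lon 0 1) (\<lambda>x. ?w x * (d x * p x - d' x * q x))"
      using sqint_mult_integrable[of "Lon 0 1"] w G by (simp add: L2_iff_sqint)
    have "AE x in Lon 0 1. \<alpha>0 \<le> d x \<and> d x \<le> \<alpha>1" using d by (simp add: coef_def)
    then show "AE x in Lon 0 1. \<alpha>0 / 2 * (?w x)\<^sup>2 - \<delta>\<^sup>2 / (2 * \<alpha>0) * (q x)\<^sup>2 \<le> ?w x * (d x * p x - d' x * q x)"
      using \<delta>
    proof eventually_elim
      case (elim x)
      let ?e = "d x - d' x"
      have "?e\<^sup>2 \<le> \<delta>\<^sup>2" using elim by (simp add: abs_le_square_iff[symmetric])
      then have 1: "?e\<^sup>2 * (q x)\<^sup>2 / (2 * \<alpha>0) \<le> \<delta>\<^sup>2 * (q x)\<^sup>2 / (2 * \<alpha>0)"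
        using a by (intro divide_right_mono mult_right_mono) auto
      have 2: "\<alpha>0 * (?w x)\<^sup>2 \<le> d x * (?w x)\<^sup>2" by (rule mult_right_mono) (use elim in auto)
      \<comment> \<open>Young's inequality as a completed square.\<close>
      have "0 \<le> (\<alpha>0 * ?w x + ?e * q x)\<^sup>2 / (2 * \<alpha>0)" using a by simp
      also have "\<dots> = \<alpha>0 / 2 * (?w x)\<^sup>2 + ?w x * (?e * q x) + ?e\<^sup>2 * (q x)\<^sup>2 / (2 * \<alpha>0)"
        using a by (simp add: power2_eq_square field_simps)
      finally have "\<alpha>0 / 2 * (?w x)\<^sup>2 - \<delta>\<^sup>2 * (q x)\<^sup>2 / (2 * \<alpha>0) \<le> d x * (?w x)\<^sup>2 + ?w x * (?e * q x)"
        using 1 2 by linarith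
      also have "\<dots> = ?w x * (d x * p x - d' x * q x)" by (simp add: power2_eq_square algebra_simps)
      finally show ?case by simp
    qed
  qed
  finally show ?thesis by (simp add: ip_Lon)
qed

text \<open>The factor 1 + T is a convenient upper bound for the square root of
  \<open>T\<close>.\<close>

lemma jmeas_jn_le:
  assumes J: "jmeas T w" and b: "AE t in Lon 0 T. nrm (w t) \<le> B" and "0 \<le> T" "0 \<le> B"
  shows "jn T w \<le> (1 + T) * B"
proof -
  interpret finite_measure "Lon 0 T" by (rule finite_measure_Lon)
  have "(jn T w)\<^sup>2 = (\<integral>t. (nrm (w t))\<^sup>2 \<partial>Lon 0 T)"
    using jmeas_nrm(2)[OF J] by (simp add: l2n_sq[of "Lon 0 T", symmetric])
  also have "\<dots> \<le> (\<integral>t. B\<^sup>2 \<partial>Lon 0 T)"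
  proof (rule integral_mono_AE)
    show "integrable (Lon 0 T) (\<lambda>t. (nrm (w t))\<^sup>2)" using jmeas_nrm(1)[OF J] by (simp add: sqint_def)
    show "AE t in Lon 0 T. (nrm (w t))\<^sup>2 \<le> B\<^sup>2" using b by eventually_elim (simp add: power_mono)
  qed simp
  also have "\<dots> = T * B\<^sup>2" using \<open>0 \<le> T\<close> by (simp add: measure_restrict_space)
  also have "\<dots> \<le> ((1 + T) * B)\<^sup>2"
  proof -
    have "T \<le> (1 + T)\<^sup>2" using \<open>0 \<le> T\<close> by (simp add: power2_eq_square algebra_simps)
    then show ?thesis by (simp add: power_mult_distrib mult_right_mono)
  qed
  finally show ?thesis by (rule power2_le_imp_le) (use assms in simp)
qed

text \<open>\<open>\<epsilon>\<close> comes from coercivity and from the gradient bound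
  \<open>rsol_energy\<close> for the second solution. The \<open>v\<close> difference is then the
  source in the \<open>u\<close> equation, and integrating it over time contributes the factor 2
  T.\<close>

theorem stability:
  assumes "T > 0" and d: "coef \<alpha>0 \<alpha>1 d" and d': "coef \<alpha>0 \<alpha>1 d'"
    and \<delta>: "AE x in Lon 0 1. \<bar>d x - d' x\<bar> \<le> \<delta>" "0 \<le> \<delta>"
    and r: "rsol T d u v u1 u2 v1" and r': "rsol T d' u' v' u1' u2' v1'"
    and iu: "AE x in Lon 0 1. u 0 x = u' 0 x" and iv: "AE x in Lon 0 1. v 0 x = v' 0 x"
  defines "\<epsilon> \<equiv> \<delta> * nrm (v' 0) / \<alpha>0"
  shows "\<And>t. t \<in> {0..T} \<Longrightarrow> nrm (\<lambda>x. v t x - v' t x) \<le> \<epsilon>"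
    and "sqrt \<alpha>0 * jn T (\<lambda>t x. v1 t x - v1' t x) \<le> \<epsilon>"
    and "\<And>t. t \<in> {0..T} \<Longrightarrow> nrm (\<lambda>x. u t x - u' t x) \<le> 2 * T * \<epsilon>"
    and "jn T (\<lambda>t x. u2 t x - u2' t x) \<le> 2 * T * \<epsilon>"
    and "jn T (\<lambda>t x. u1 t x - u1' t x) \<le> (1 + T) * (2 * T * \<epsilon>)"
proof -
  interpret finite_measure "Lon 0 T" by (rule finite_measure_Lon)
  have a: "0 < \<alpha>0" using d by (simp add: coef_def)
  have e0: "0 \<le> \<epsilon>" unfolding \<epsilon>_def using a \<delta> by simp
  have R: "jmeas T u" "jmeas T u1" "jmeas T u2" "jmeas T v" "jmeas T v1" "cont_L2 T u" "cont_L2 T v"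
    "AE t in Lon 0 T. H01p (u t) (u1 t) \<and> has_weak_deriv (u1 t) (u2 t)" "AE t in Lon 0 T. H01p (v t) (v1 t)"
    using r unfolding rsol_def by blast+
  have R': "jmeas T u'" "jmeas T u1'" "jmeas T u2'" "jmeas T v'" "jmeas T v1'" "cont_L2 T u'" "cont_L2 T v'"
    "AE t in Lon 0 T. H01p (u' t) (u1' t) \<and> has_weak_deriv (u1' t) (u2' t)" "AE t in Lon 0 T. H01p (v' t) (v1' t)"
    using r' unfolding rsol_def by blast+
  have zero: "nrm (\<lambda>x. f x - g x) = 0" if "AE x in Lon 0 1. f x = g x" "L2 f" "L2 g" for f g
  proof -
    have "nrm (\<lambda>x. f x - g x) = nrm (\<lambda>x. 0)"
      by (rule l2n_cong_AE) (use that L2_measurable in \<open>auto elim: eventually_mono\<close>)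
    then show ?thesis by (simp add: l2n_def)
  qed
  have T0: "0 \<in> {0..T}" "T \<in> {0..T}" using \<open>T > 0\<close> by auto

  define w where "w = (\<lambda>t x. v t x - v' t x)"
  define w1 where "w1 = (\<lambda>t x. v1 t x - v1' t x)"
  define G where "G = (\<lambda>t x. d x * v1 t x - d' x * v1' t x)"
  have cw: "cont_L2 T w" unfolding w_def by (rule cont_L2_diff[OF R(7) R'(7)])
  have Jw1: "jmeas T w1" unfolding w1_def by (rule jmeas_diff[OF R(5) R'(5)])
  have JG: "jmeas T G"
    unfolding G_def by (intro jmeas_diff coef_mult_jmeas[OF d] coef_mult_jmeas[OF d'] R R')
  have Hw: "AE t in Lon 0 T. H01p (w t) (w1 t)"
    using R(9) R'(9)
  proof eventually_elim
    case (elim t)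
    show ?case using H01p_linear[OF elim, of 1 "- 1"] by (simp add: w_def w1_def)
  qed
  have w0: "nrm (w 0) = 0"
    unfolding w_def by (intro zero iv cont_L2_D(1)[OF R(7) T0(1)] cont_L2_D(1)[OF R'(7) T0(1)])
  have mw: "ip (w t) (es k) = ip (w 0) (es k) + integral\<^sup>L (Lon 0 t) (\<lambda>s. - lam k * ip (G s) (ec k))"
    if t: "t \<in> {0..T}" for k t
  proof -
    let ?h = "\<lambda>s. - lam k * ip (\<lambda>x. d x * v1 s x) (ec k)" and ?h' = "\<lambda>s. - lam k * ip (\<lambda>x. d' x * v1' s x) (ec k)"
    have hi: "integrable (Lon 0 T) ?h" "integrable (Lon 0 T) ?h'"
      by (intro integrable_mult_right sqint_integrable jmeas_ip_sqint L2_ec coef_mult_jmeas[OF d] coef_mult_jmeas[OF d'] R R')+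
    have hi': "integrable (Lon 0 t) ?h" "integrable (Lon 0 t) ?h'"
      by (rule integrable_Lon_sub[OF hi(1)], use t in simp, use t in simp,
          rule integrable_Lon_sub[OF hi(2)], use t in simp, use t in simp)
    have "ip (w s) (es k) = ip (v s) (es k) - ip (v' s) (es k)" if "s \<in> {0..T}" for s
      unfolding w_def by (rule ip_diff_left[OF cont_L2_D(1)[OF R(7) that] cont_L2_D(1)[OF R'(7) that] L2_es])
    moreover have "ip (v t) (es k) = ip (v 0) (es k) + integral\<^sup>L (Lon 0 t) ?h"
      "ip (v' t) (es k) = ip (v' 0) (es k) + integral\<^sup>L (Lon 0 t) ?h'"
      using r r' t unfolding rsol_def by blast+
    moreover have "integral\<^sup>L (Lon 0 t) (\<lambda>s. - lam k * ip (G s) (ec k)) = integral\<^sup>L (Lon 0 t) (\<lambda>s. ?h s - ?h' s)"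
    proof (rule integral_cong_AE)
      show "(\<lambda>s. ?h s - ?h' s) \<in> borel_measurable (Lon 0 t)" using hi' by (intro borel_measurable_diff borel_measurable_integrable)
      have "integrable (Lon 0 T) (\<lambda>s. - lam k * ip (G s) (ec k))"
        by (intro integrable_mult_right sqint_integrable jmeas_ip_sqint L2_ec JG)
      then show "(\<lambda>s. - lam k * ip (G s) (ec k)) \<in> borel_measurable (Lon 0 t)"
        using integrable_Lon_sub[of 0 T _ 0 t] t by (intro borel_measurable_integrable) auto
      have "AE s in Lon 0 T. - lam k * ip (G s) (ec k) = ?h s - ?h' s"
        using jmeas_section[OF R(5)] jmeas_section[OF R'(5)]
      proof eventually_elim
        case (elim s)
        show ?case unfolding G_def
          by (subst ip_diff_left[OF coef_mult_L2[OF d elim(1)] coef_mult_L2[OF d' elim(2)] L2_ec]) (simp add: algebra_simps)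
      qed
      then show "AE s in Lon 0 t. - lam k * ip (G s) (ec k) = ?h s - ?h' s"
        by (rule AE_Lon_subset) (use t in auto)
    qed
    ultimately show ?thesis using hi' T0(1) t by simp
  qed
  have Ew: "(nrm (w s))\<^sup>2 = (nrm (w 0))\<^sup>2 - 2 * (\<integral>t. ip (w1 t) (G t) \<partial>Lon 0 s)" if "s \<in> {0..T}" for s
    using that by (intro energy_second_order[OF cw Jw1 JG Hw mw])
  have E': "2 * \<alpha>0 * (jn T v1')\<^sup>2 \<le> (nrm (v' 0))\<^sup>2" by (rule rsol_energy[OF d' r' \<open>T > 0\<close>])
  have sq: "integrable (Lon 0 T) (\<lambda>t. (nrm (g t))\<^sup>2)" "(\<integral>t. (nrm (g t))\<^sup>2 \<partial>Lon 0 T) = (jn T g)\<^sup>2" if "jmeas T g" for g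
    using jmeas_nrm[OF that] by (auto simp: sqint_def l2n_sq[of "Lon 0 T", symmetric])
  \<comment> \<open>In the energy identity for \<open>w\<close>, half of the coercive term stays on
    the left; on the right the squared gradient of the second solution appears with factor
    \<delta>^2 / \<alpha>0.\<close>
  have main: "(nrm (w s))\<^sup>2 + \<alpha>0 * (\<integral>t. (nrm (w1 t))\<^sup>2 \<partial>Lon 0 s) \<le> \<epsilon>\<^sup>2" if s: "s \<in> {0..T}" for s
  proof -
    have i1: "integrable (Lon 0 s) (\<lambda>t. (nrm (w1 t))\<^sup>2)" and i2: "integrable (Lon 0 s) (\<lambda>t. (nrm (v1' t))\<^sup>2)"
      and i3: "integrable (Lon 0 s) (\<lambda>t. ip (w1 t) (G t))"
      using integrable_Lon_sub[OF sq(1)[OF Jw1], of 0 s] integrable_Lon_sub[OF sq(1)[OF R'(5)], of 0 s]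
        integrable_Lon_sub[OF jmeas_ip(1)[OF Jw1 JG], of 0 s] s by auto
    have "(\<integral>t. \<alpha>0 / 2 * (nrm (w1 t))\<^sup>2 - \<delta>\<^sup>2 / (2 * \<alpha>0) * (nrm (v1' t))\<^sup>2 \<partial>Lon 0 s) \<le> (\<integral>t. ip (w1 t) (G t) \<partial>Lon 0 s)"
    proof (rule integral_mono_AE)
      have "AE t in Lon 0 T. \<alpha>0 / 2 * (nrm (w1 t))\<^sup>2 - \<delta>\<^sup>2 / (2 * \<alpha>0) * (nrm (v1' t))\<^sup>2 \<le> ip (w1 t) (G t)"
        using jmeas_section[OF R(5)] jmeas_section[OF R'(5)]
        unfolding w1_def G_def by eventually_elim (rule difference_coercive[OF d d' \<delta>(1)])
      then show "AE t in Lon 0 s. \<alpha>0 / 2 * (nrm (w1 t))\<^sup>2 - \<delta>\<^sup>2 / (2 * \<alpha>0) * (nrm (v1' t))\<^sup>2 \<le> ip (w1 t) (G t)"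
        by (rule AE_Lon_subset) (use s in auto)
    qed (use i1 i2 i3 in auto)
    then have "\<alpha>0 / 2 * (\<integral>t. (nrm (w1 t))\<^sup>2 \<partial>Lon 0 s) - \<delta>\<^sup>2 / (2 * \<alpha>0) * (\<integral>t. (nrm (v1' t))\<^sup>2 \<partial>Lon 0 s)
        \<le> (\<integral>t. ip (w1 t) (G t) \<partial>Lon 0 s)"
      using i1 i2 by simp
    moreover have "(\<integral>t. (nrm (v1' t))\<^sup>2 \<partial>Lon 0 s) \<le> (jn T v1')\<^sup>2"
      using integral_Lon_mono_set[OF sq(1)[OF R'(5)] _ s] sq(2)[OF R'(5)] by simp
    then have "\<delta>\<^sup>2 / (2 * \<alpha>0) * (\<integral>t. (nrm (v1' t))\<^sup>2 \<partial>Lon 0 s) \<le> \<delta>\<^sup>2 / (2 * \<alpha>0) * (jn T v1')\<^sup>2"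
      using a by (intro mult_left_mono) auto
    moreover have "\<delta>\<^sup>2 / (2 * \<alpha>0) * (jn T v1')\<^sup>2 \<le> \<epsilon>\<^sup>2 / 2"
    proof -
      have "\<delta>\<^sup>2 / (2 * \<alpha>0) * (jn T v1')\<^sup>2 = \<delta>\<^sup>2 / (4 * \<alpha>0\<^sup>2) * (2 * \<alpha>0 * (jn T v1')\<^sup>2)"
        using a by (simp add: power2_eq_square)
      also have "\<dots> \<le> \<delta>\<^sup>2 / (4 * \<alpha>0\<^sup>2) * (nrm (v' 0))\<^sup>2" using E' by (intro mult_left_mono) auto
      also have "\<dots> = \<epsilon>\<^sup>2 / 4" by (simp add: \<epsilon>_def power_divide power_mult_distrib)
      \<comment> \<open>Rounding up here makes the total exactly the square of
        \<open>\<epsilon>\<close> once the identity is doubled.\<close>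
      also have "\<dots> \<le> \<epsilon>\<^sup>2 / 2" by simp
      finally show ?thesis .
    qed
    ultimately have "\<alpha>0 / 2 * (\<integral>t. (nrm (w1 t))\<^sup>2 \<partial>Lon 0 s) - \<epsilon>\<^sup>2 / 2 \<le> (\<integral>t. ip (w1 t) (G t) \<partial>Lon 0 s)" by linarith
    then show ?thesis using Ew[OF s] w0 by simp
  qed
  have "0 \<le> \<alpha>0 * (\<integral>t. (nrm (w1 t))\<^sup>2 \<partial>Lon 0 s)" for s using a by simp
  then have wb: "nrm (w s) \<le> \<epsilon>" if "s \<in> {0..T}" for s
    using main[OF that] by (intro power2_le_imp_le[OF _ e0]) (smt (verit))
  then show "nrm (\<lambda>x. v t x - v' t x) \<le> \<epsilon>" if "t \<in> {0..T}" for t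
    using that unfolding w_def by blast
  show "sqrt \<alpha>0 * jn T (\<lambda>t x. v1 t x - v1' t x) \<le> \<epsilon>"
  proof (rule power2_le_imp_le[OF _ e0])
    have "\<alpha>0 * (jn T w1)\<^sup>2 \<le> \<epsilon>\<^sup>2"
      using main[OF T0(2)] zero_le_power2[of "nrm (w T)"] unfolding sq(2)[OF Jw1] by linarith
    then show "(sqrt \<alpha>0 * jn T (\<lambda>t x. v1 t x - v1' t x))\<^sup>2 \<le> \<epsilon>\<^sup>2"
      using a by (simp add: power_mult_distrib w1_def)
  qed

  define z where "z = (\<lambda>t x. u t x - u' t x)"
  define z1 where "z1 = (\<lambda>t x. u1 t x - u1' t x)"
  define z2 where "z2 = (\<lambda>t x. u2 t x - u2' t x)"
  have cz: "cont_L2 T z" unfolding z_def by (rule cont_L2_diff[OF R(6) R'(6)])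
  have Jz: "jmeas T z" "jmeas T z1" "jmeas T z2" "jmeas T w"
    unfolding z_def z1_def z2_def w_def by (intro jmeas_diff R R')+
  have Hz: "AE t in Lon 0 T. H01p (z t) (z1 t) \<and> has_weak_deriv (z1 t) (z2 t)"
    using R(8) R'(8) jmeas_section[OF R(3)] jmeas_section[OF R'(3)]
  proof eventually_elim
    case (elim t)
    have "has_weak_deriv (z1 t) (z2 t)"
      unfolding z1_def z2_def using elim by (intro has_weak_deriv_diff) (auto dest: H01p_D(2))
    moreover have "H01p (z t) (z1 t)"
      using H01p_linear[of "u t" "u1 t" "u' t" "u1' t" 1 "- 1"] elim by (simp add: z_def z1_def)
    ultimately show ?case by simp
  qed
  have z0: "nrm (z 0) = 0"
    unfolding z_def by (intro zero iu cont_L2_D(1)[OF R(6) T0(1)] cont_L2_D(1)[OF R'(6) T0(1)])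
  have mz: "ip (z t) (es k) = ip (z 0) (es k)
      + integral\<^sup>L (Lon 0 t) (\<lambda>s. (lam k)\<^sup>2 * ip (z2 s) (es k) + ip (w s) (es k))"
    if t: "t \<in> {0..T}" for k t
  proof -
    let ?h = "\<lambda>s. (lam k)\<^sup>2 * ip (u2 s) (es k) + ip (v s) (es k)" and ?h' = "\<lambda>s. (lam k)\<^sup>2 * ip (u2' s) (es k) + ip (v' s) (es k)"
    have hi: "integrable (Lon 0 T) ?h" "integrable (Lon 0 T) ?h'"
      by (intro Bochner_Integration.integrable_add integrable_mult_right sqint_integrable jmeas_ip_sqint L2_es R R')+
    have hi': "integrable (Lon 0 t) ?h" "integrable (Lon 0 t) ?h'"
      by (rule integrable_Lon_sub[OF hi(1)], use t in simp, use t in simp,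
          rule integrable_Lon_sub[OF hi(2)], use t in simp, use t in simp)
    have "ip (z s) (es k) = ip (u s) (es k) - ip (u' s) (es k)" if "s \<in> {0..T}" for s
      unfolding z_def by (rule ip_diff_left[OF cont_L2_D(1)[OF R(6) that] cont_L2_D(1)[OF R'(6) that] L2_es])
    moreover have "ip (u t) (es k) = ip (u 0) (es k) + integral\<^sup>L (Lon 0 t) ?h"
      "ip (u' t) (es k) = ip (u' 0) (es k) + integral\<^sup>L (Lon 0 t) ?h'"
      using r r' t unfolding rsol_def by blast+
    moreover have "integral\<^sup>L (Lon 0 t) (\<lambda>s. (lam k)\<^sup>2 * ip (z2 s) (es k) + ip (w s) (es k)) = integral\<^sup>L (Lon 0 t) (\<lambda>s. ?h s - ?h' s)"
    proof (rule integral_cong_AE)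
      show "(\<lambda>s. ?h s - ?h' s) \<in> borel_measurable (Lon 0 t)" using hi' by (intro borel_measurable_diff borel_measurable_integrable)
      have "integrable (Lon 0 T) (\<lambda>s. (lam k)\<^sup>2 * ip (z2 s) (es k) + ip (w s) (es k))"
        by (intro Bochner_Integration.integrable_add integrable_mult_right sqint_integrable jmeas_ip_sqint L2_es Jz)
      then show "(\<lambda>s. (lam k)\<^sup>2 * ip (z2 s) (es k) + ip (w s) (es k)) \<in> borel_measurable (Lon 0 t)"
        using integrable_Lon_sub[of 0 T _ 0 t] t by (intro borel_measurable_integrable) auto
      have "AE s in Lon 0 T. (lam k)\<^sup>2 * ip (z2 s) (es k) + ip (w s) (es k) = ?h s - ?h' s"
        using jmeas_section[OF R(3)] jmeas_section[OF R'(3)] jmeas_section[OF R(4)] jmeas_section[OF R'(4)]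
      proof eventually_elim
        case (elim s)
        show ?case unfolding z2_def w_def
          unfolding ip_diff_left[OF elim(1,2) L2_es] ip_diff_left[OF elim(3,4) L2_es] by (simp add: algebra_simps)
      qed
      then show "AE s in Lon 0 t. (lam k)\<^sup>2 * ip (z2 s) (es k) + ip (w s) (es k) = ?h s - ?h' s"
        by (rule AE_Lon_subset) (use t in auto)
    qed
    ultimately show ?thesis using hi' T0(1) t by simp
  qed
  have Ez: "(nrm (z s))\<^sup>2 = (nrm (z 0))\<^sup>2 + 2 * (\<integral>t. ip (z t) (w t) - (nrm (z2 t))\<^sup>2 \<partial>Lon 0 s)"
    if "s \<in> {0..T}" for s
    using that by (intro energy_fourth_order[OF cz Jz(1,2,3,4) Hz mz])
  \<comment> \<open>A time of maximal norm: the source integral is at most T \<epsilon> times this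
    maximum, and one factor of the maximum can then be divided out.\<close>
  obtain \<tau> where \<tau>: "\<tau> \<in> {0..T}" "\<And>t. t \<in> {0..T} \<Longrightarrow> nrm (z t) \<le> nrm (z \<tau>)"
    using continuous_attains_sup[OF _ _ cont_L2_nrm_continuous[OF cz]] \<open>T > 0\<close> by fastforce
  let ?m = "nrm (z \<tau>)"
  have mainz: "(nrm (z s))\<^sup>2 + 2 * (\<integral>t. (nrm (z2 t))\<^sup>2 \<partial>Lon 0 s) \<le> 2 * T * \<epsilon> * ?m" if s: "s \<in> {0..T}" for s
  proof -
    have i1: "integrable (Lon 0 s) (\<lambda>t. (nrm (z2 t))\<^sup>2)" and i2: "integrable (Lon 0 s) (\<lambda>t. ip (z t) (w t))"
      using integrable_Lon_sub[OF sq(1)[OF Jz(3)], of 0 s] integrable_Lon_sub[OF jmeas_ip(1)[OF Jz(1,4)], of 0 s] s by auto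
    have "(\<integral>t. ip (z t) (w t) \<partial>Lon 0 s) \<le> (\<integral>t. ?m * \<epsilon> \<partial>Lon 0 s)"
    proof (rule integral_mono_AE[OF i2])
      show "integrable (Lon 0 s) (\<lambda>t. ?m * \<epsilon>)"
        using finite_measure.integrable_const[OF finite_measure_Lon] by blast
      show "AE t in Lon 0 s. ip (z t) (w t) \<le> ?m * \<epsilon>"
        using AE_space
      proof eventually_elim
        case (elim t)
        then have t: "t \<in> {0..T}" using s by auto
        have "ip (z t) (w t) \<le> nrm (z t) * nrm (w t)"
          using ip_CS[OF cont_L2_D(1)[OF cz t] cont_L2_D(1)[OF cw t]] by simp
        also have "\<dots> \<le> ?m * \<epsilon>" by (intro mult_mono \<tau>(2) wb t) auto
        finally show ?case .
      qed
    qed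
    also have "\<dots> = s * (?m * \<epsilon>)" using s by (simp add: measure_restrict_space)
    also have "\<dots> \<le> T * (?m * \<epsilon>)" using s e0 by (intro mult_right_mono) auto
    finally have "(\<integral>t. ip (z t) (w t) \<partial>Lon 0 s) \<le> T * (?m * \<epsilon>)" .
    moreover have "(\<integral>t. ip (z t) (w t) - (nrm (z2 t))\<^sup>2 \<partial>Lon 0 s) = (\<integral>t. ip (z t) (w t) \<partial>Lon 0 s) - (\<integral>t. (nrm (z2 t))\<^sup>2 \<partial>Lon 0 s)"
      using i1 i2 by simp
    ultimately show ?thesis using Ez[OF s] z0 by (simp add: algebra_simps)
  qed
  have m: "?m \<le> 2 * T * \<epsilon>"
  proof (cases "?m = 0")
    case False
    then have "0 < ?m" using l2n_nonneg[of "Lon 0 1" "z \<tau>"] by linarith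
    moreover have "?m * ?m \<le> (2 * T * \<epsilon>) * ?m"
    proof -
      have "0 \<le> (\<integral>t. (nrm (z2 t))\<^sup>2 \<partial>Lon 0 \<tau>)" by simp
      then show ?thesis using mainz[OF \<tau>(1)] unfolding power2_eq_square[of ?m] by linarith
    qed
    ultimately show ?thesis by simp
  qed (use e0 \<open>T > 0\<close> in simp)
  have zb: "nrm (z t) \<le> 2 * T * \<epsilon>" if "t \<in> {0..T}" for t using \<tau>(2)[OF that] m by linarith
  then show "nrm (\<lambda>x. u t x - u' t x) \<le> 2 * T * \<epsilon>" if "t \<in> {0..T}" for t
    using that unfolding z_def by blast
  have Te: "0 \<le> 2 * T * \<epsilon>" using e0 \<open>T > 0\<close> by simp
  have z2b: "jn T z2 \<le> 2 * T * \<epsilon>"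
  proof (rule power2_le_imp_le[OF _ Te])
    have "2 * (jn T z2)\<^sup>2 \<le> 2 * T * \<epsilon> * ?m"
      using mainz[OF T0(2)] sq(2)[OF Jz(3)] zero_le_power2[of "nrm (z T)"] by linarith
    also have "\<dots> \<le> 2 * T * \<epsilon> * (2 * T * \<epsilon>)" by (rule mult_left_mono[OF m Te])
    finally show "(jn T z2)\<^sup>2 \<le> (2 * T * \<epsilon>)\<^sup>2"
      unfolding power2_eq_square[of "2 * T * \<epsilon>"] using zero_le_power2[of "jn T z2"] by linarith
  qed
  then show "jn T (\<lambda>t x. u2 t x - u2' t x) \<le> 2 * T * \<epsilon>" unfolding z2_def .
  have zj: "jn T z \<le> (1 + T) * (2 * T * \<epsilon>)"
  proof (rule jmeas_jn_le[OF Jz(1)])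
    show "AE t in Lon 0 T. nrm (z t) \<le> 2 * T * \<epsilon>" using AE_space by eventually_elim (auto intro: zb)
  qed (use Te \<open>T > 0\<close> in auto)
  show "jn T (\<lambda>t x. u1 t x - u1' t x) \<le> (1 + T) * (2 * T * \<epsilon>)"
  proof (rule power2_le_imp_le)
    \<comment> \<open>Interpolation: one integration by parts in space bounds the squared gradient
      by the product of the norms of \<open>z\<close> and \<open>z2\<close>.\<close>
    have "(jn T z1)\<^sup>2 = (\<integral>t. ip (z1 t) (z1 t) \<partial>Lon 0 T)" using sq(2)[OF Jz(2)] by (simp add: ip_self)
    also have "\<dots> = (\<integral>t. - ip (z2 t) (z t) \<partial>Lon 0 T)"
    proof (rule integral_cong_AE)
      show "(\<lambda>t. ip (z1 t) (z1 t)) \<in> borel_measurable (Lon 0 T)" "(\<lambda>t. - ip (z2 t) (z t)) \<in> borel_measurable (Lon 0 T)"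
        using jmeas_ip(1)[OF Jz(2,2)] jmeas_ip(1)[OF Jz(3,1)] by auto
      show "AE t in Lon 0 T. ip (z1 t) (z1 t) = - ip (z2 t) (z t)"
        using Hz jmeas_section[OF Jz(2)] jmeas_section[OF Jz(3)]
        by eventually_elim (auto intro: ip_weak_deriv_H01p)
    qed
    also have "\<dots> = - (\<integral>p. z2 (fst p) (snd p) * z (fst p) (snd p) \<partial>LQ T)" using jmeas_ip(2)[OF Jz(3,1)] by simp
    also have "\<dots> \<le> jn T z2 * jn T z" using CS_l2n[OF Jz(3)[unfolded jmeas_iff_sqint] Jz(1)[unfolded jmeas_iff_sqint]] by linarith
    also have "\<dots> \<le> (2 * T * \<epsilon>) * ((1 + T) * (2 * T * \<epsilon>))" by (rule mult_mono[OF z2b zj Te]) simp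
    also have "\<dots> \<le> ((1 + T) * (2 * T * \<epsilon>)) * ((1 + T) * (2 * T * \<epsilon>))"
    proof (rule mult_right_mono)
      show "2 * T * \<epsilon> \<le> (1 + T) * (2 * T * \<epsilon>)" using mult_right_mono[OF _ Te, of 1 "1 + T"] \<open>T > 0\<close> by simp
    qed (use Te \<open>T > 0\<close> in simp)
    finally show "(jn T (\<lambda>t x. u1 t x - u1' t x))\<^sup>2 \<le> ((1 + T) * (2 * T * \<epsilon>))\<^sup>2"
      unfolding z1_def power2_eq_square .
  qed (use Te \<open>T > 0\<close> in simp)
qed

section \<open>Limits of weak solutions\<close>

text \<open>Cauchy-Schwarz with the indicator of the interval from 0 to x, whose norm is at most
  1.\<close>

lemma abs_prim_le_nrm:
  assumes h: "L2 h" and x: "x \<in> {0..1}"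
  shows "\<bar>integral\<^sup>L (Lon 0 x) h\<bar> \<le> nrm h"
proof -
  let ?I = "\<lambda>s. if 0 < s \<and> s < x then 1 else (0::real)"
  have I: "L2 ?I" by (rule L2_bounded[of _ 1]) auto
  have one: "L2 (\<lambda>_. 1)" by (rule L2_continuous) simp
  have "integral\<^sup>L (Lon 0 x) h = ip ?I h"
    unfolding ip_Lon using Lint_sub[of 0 0 x 1 h] x by (simp add: if_distribR if_distrib cong: if_cong)
  also have "\<bar>\<dots>\<bar> \<le> nrm ?I * nrm h" by (rule ip_CS[OF I h])
  also have "\<dots> \<le> 1 * nrm h"
  proof (rule mult_right_mono)
    have "nrm ?I \<le> nrm (\<lambda>_. 1)"
      by (rule l2n_mono) (use one I L2_measurable in \<open>auto simp: L2_iff_sqint\<close>)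
    then show "nrm ?I \<le> 1" by (simp add: l2n_def measure_restrict_space)
  qed simp
  finally show ?thesis by simp
qed

lemma weak_deriv_limit:
  assumes L: "\<And>n. L2 (f n)" "\<And>n. L2 (g n)" "L2 f'" "L2 g'"
    and w: "\<And>n. has_weak_deriv (f n) (g n)"
    and lim: "(\<lambda>n. nrm (\<lambda>x. f n x - f' x)) \<longlonglongrightarrow> 0" "(\<lambda>n. nrm (\<lambda>x. g n x - g' x)) \<longlonglongrightarrow> 0"
  shows "has_weak_deriv f' g'"
  unfolding has_weak_deriv_Lon
proof (intro allI impI)
  fix \<phi> assume \<phi>: "test_fun 0 1 \<phi>"
  note S = L[unfolded L2_iff_sqint]
  have p: "sqint (Lon 0 1) \<phi>" "sqint (Lon 0 1) (deriv \<phi>)"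
    using L2_continuous[OF test_funD(2)[OF \<phi>]] L2_continuous[OF test_funD(3)[OF \<phi>]] by (auto simp: L2_iff_sqint)
  have 1: "(\<lambda>n. \<integral>x. f n x * deriv \<phi> x \<partial>Lon 0 1) \<longlonglongrightarrow> (\<integral>x. f' x * deriv \<phi> x \<partial>Lon 0 1)"
    by (rule l2ip_tendsto[OF S(1) S(3) p(2) lim(1)])
  have 2: "(\<lambda>n. - (\<integral>x. g n x * \<phi> x \<partial>Lon 0 1)) \<longlonglongrightarrow> - (\<integral>x. g' x * \<phi> x \<partial>Lon 0 1)"
    by (rule tendsto_minus[OF l2ip_tendsto[OF S(2) S(4) p(1) lim(2)]])
  have "(\<integral>x. f n x * deriv \<phi> x \<partial>Lon 0 1) = - (\<integral>x. g n x * \<phi> x \<partial>Lon 0 1)" for n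
    using w \<phi> by (simp add: has_weak_deriv_Lon)
  with 1 have "(\<lambda>n. - (\<integral>x. g n x * \<phi> x \<partial>Lon 0 1)) \<longlonglongrightarrow> (\<integral>x. f' x * deriv \<phi> x \<partial>Lon 0 1)" by simp
  from LIMSEQ_unique[OF this 2] show "(\<integral>x. f' x * deriv \<phi> x \<partial>Lon 0 1) = - (\<integral>x. g' x * \<phi> x \<partial>Lon 0 1)" .
qed

text \<open>By \<open>abs_prim_le_nrm\<close>, primitives converge uniformly when the derivatives
  converge in norm, so both the representation and its value at 1 survive.\<close>

lemma H01p_limit:
  assumes H: "\<And>n. H01p (f n) (g n)" and L: "L2 f'" "L2 g'"
    and lim: "(\<lambda>n. nrm (\<lambda>x. f n x - f' x)) \<longlonglongrightarrow> 0" "(\<lambda>n. nrm (\<lambda>x. g n x - g' x)) \<longlonglongrightarrow> 0"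
  shows "H01p f' g'"
proof -
  note F = H01p_D(1,2)[OF H]
  let ?G = "\<lambda>h x. integral\<^sup>L (Lon 0 x) h"
  have G: "L2 (?G h)" if "L2 h" for h using L2_continuous[OF L2_prim_continuous[OF that, of 0]] by simp
  have sub: "?G (\<lambda>x. g n x - g' x) x = ?G (g n) x - ?G g' x" if "x \<in> {0..1}" for n x
    using integrable_Lon_sub[OF L2_integrable[OF F(2)], of 0 x] integrable_Lon_sub[OF L2_integrable[OF L(2)], of 0 x] that
    by (intro Bochner_Integration.integral_diff) auto
  have b: "\<bar>?G (g n) x - ?G g' x\<bar> \<le> nrm (\<lambda>x. g n x - g' x)" if "x \<in> {0..1}" for n x
    using abs_prim_le_nrm[OF L2_diff[OF F(2) L(2)] that] sub[OF that] by simp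
  have "(\<lambda>n. nrm (\<lambda>x. f n x - ?G g' x)) \<longlonglongrightarrow> 0"
  proof (rule tendsto_sandwich[OF _ _ tendsto_const lim(2)])
    have "nrm (\<lambda>x. f n x - ?G g' x) \<le> nrm (\<lambda>x. g n x - g' x)" for n
    proof -
      let ?c = "nrm (\<lambda>x. g n x - g' x)"
      have c: "L2 (\<lambda>_. ?c)" by (rule L2_continuous) simp
      have "AE x in Lon 0 1. f n x = ?G (g n) x" using H by (simp add: H01p_def)
      then have "AE x in Lon 0 1. \<bar>f n x - ?G g' x\<bar> \<le> \<bar>?c\<bar>"
        using AE_space
      proof eventually_elim
        case (elim x)
        then show ?case using b[of x n] by auto
      qed
      then have "nrm (\<lambda>x. f n x - ?G g' x) \<le> nrm (\<lambda>_. ?c)"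
        using l2n_mono[OF c[unfolded L2_iff_sqint] L2_measurable[OF L2_diff[OF F(1) G[OF L(2)]]]] by blast
      then show ?thesis by (simp add: l2n_def[of _ "\<lambda>_. ?c"] measure_restrict_space)
    qed
    then show "\<forall>\<^sub>F n in sequentially. nrm (\<lambda>x. f n x - ?G g' x) \<le> nrm (\<lambda>x. g n x - g' x)" by simp
  qed auto
  then have ae: "AE x in Lon 0 1. f' x = ?G g' x"
    using l2n_limit_unique[OF F(1)[unfolded L2_iff_sqint] L(1)[unfolded L2_iff_sqint] G[OF L(2), unfolded L2_iff_sqint] lim(1)]
    by blast
  have "(\<lambda>n. ?G (g n) 1 - ?G g' 1) \<longlonglongrightarrow> 0"
    by (rule tendsto_rabs_zero_cancel, rule tendsto_sandwich[OF _ _ tendsto_const lim(2)]) (use b[of 1] in auto)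
  then have "?G g' 1 = 0" using H by (simp add: H01p_def LIMSEQ_const_iff)
  with ae L show ?thesis by (simp add: H01p_def)
qed

text \<open>Splitting into three terms through one sufficiently close \<open>U n\<close>.\<close>

lemma cont_L2_uniform_limit:
  assumes U: "\<And>n. cont_L2 T (U n)" and L: "\<And>t. t \<in> {0..T} \<Longrightarrow> L2 (u t)"
    and b: "\<And>n t. t \<in> {0..T} \<Longrightarrow> nrm (\<lambda>x. U n t x - u t x) \<le> c n" and c: "c \<longlonglongrightarrow> 0"
  shows "cont_L2 T u"
  unfolding cont_L2_def
proof (intro conjI ballI)
  show "L2 (u t)" if "t \<in> {0..T}" for t by (rule L[OF that])
  fix s assume s: "s \<in> {0..T}"
  have "((\<lambda>t. nrm (\<lambda>x. u t x - u s x)) \<longlongrightarrow> 0) (at s within {0..T})"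
  proof (rule tendstoI)
    fix e :: real assume "e > 0"
    then obtain n where n: "c n < e / 3"
      using order_tendstoD(2)[OF c, of "e / 3"] by (auto simp: eventually_sequentially)
    have "\<forall>\<^sub>F t in at s within {0..T}. nrm (\<lambda>x. U n t x - U n s x) < e / 3"
      using order_tendstoD(2)[OF cont_L2_D(2)[OF U s], of "e / 3" n] \<open>e > 0\<close> by simp
    moreover have "\<forall>\<^sub>F t in at s within {0..T}. t \<in> {0..T}" by (auto simp: eventually_at_filter)
    ultimately show "\<forall>\<^sub>F t in at s within {0..T}. dist (nrm (\<lambda>x. u t x - u s x)) 0 < e"
    proof eventually_elim
      case (elim t)
      note S = L[OF s, unfolded L2_iff_sqint] L[OF elim(2), unfolded L2_iff_sqint]
        cont_L2_D(1)[OF U s, unfolded L2_iff_sqint, of n] cont_L2_D(1)[OF U elim(2), unfolded L2_iff_sqint, of n]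
      have "nrm (\<lambda>x. u t x - u s x) \<le> nrm (\<lambda>x. u t x - U n t x) + nrm (\<lambda>x. U n t x - u s x)"
        by (rule l2n_triangle3[OF S(2,4,1)])
      also have "nrm (\<lambda>x. U n t x - u s x) \<le> nrm (\<lambda>x. U n t x - U n s x) + nrm (\<lambda>x. U n s x - u s x)"
        by (rule l2n_triangle3[OF S(4,3,1)])
      also have "nrm (\<lambda>x. u t x - U n t x) = nrm (\<lambda>x. U n t x - u t x)" by (rule l2n_minus_commute)
      finally have "nrm (\<lambda>x. u t x - u s x) < e" using b[OF elim(2), of n] b[OF s, of n] n elim(1) by linarith
      then show ?case by (simp add: dist_real_def)
    qed
  qed
  from tendsto_power[OF this, of 2]
  show "((\<lambda>t. ip (\<lambda>x. u t x - u s x) (\<lambda>x. u t x - u s x)) \<longlongrightarrow> 0) (at s within {0..T})"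
    by (simp add: ip_self)
qed

lemma jn_ip_tendsto:
  assumes J: "\<And>n. jmeas T (U n)" "jmeas T u" and lim: "(\<lambda>n. jn T (\<lambda>t x. U n t x - u t x)) \<longlonglongrightarrow> 0"
    and c: "L2 c" and \<psi>: "sqint (Lon 0 T) \<psi>"
  shows "(\<lambda>n. \<integral>t. ip (U n t) c * \<psi> t \<partial>Lon 0 T) \<longlonglongrightarrow> (\<integral>t. ip (u t) c * \<psi> t \<partial>Lon 0 T)"
proof (rule l2ip_tendsto[OF jmeas_ip_sqint[OF J(1) c] jmeas_ip_sqint[OF J(2) c] \<psi>])
  have z: "(\<lambda>n. nrm c * jn T (\<lambda>t x. U n t x - u t x)) \<longlonglongrightarrow> 0"
    using tendsto_mult_right_zero[OF lim] .
  show "(\<lambda>n. l2n (Lon 0 T) (\<lambda>t. ip (U n t) c - ip (u t) c)) \<longlonglongrightarrow> 0"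
  proof (rule tendsto_sandwich[OF _ _ tendsto_const z])
    have "l2n (Lon 0 T) (\<lambda>t. ip (U n t) c - ip (u t) c) \<le> nrm c * jn T (\<lambda>t x. U n t x - u t x)" for n
    proof -
      note Jd = jmeas_diff[OF J(1)[of n] J(2)]
      have "l2n (Lon 0 T) (\<lambda>t. ip (U n t) c - ip (u t) c) \<le> l2n (Lon 0 T) (\<lambda>t. nrm c * nrm (\<lambda>x. U n t x - u t x))"
      proof (rule l2n_mono[OF sqint_cmult[OF jmeas_nrm(1)[OF Jd]]])
        show "(\<lambda>t. ip (U n t) c - ip (u t) c) \<in> borel_measurable (Lon 0 T)"
          using sqint_diff[OF jmeas_ip_sqint[OF J(1) c] jmeas_ip_sqint[OF J(2) c]] by (simp add: sqint_def)
        show "AE t in Lon 0 T. \<bar>ip (U n t) c - ip (u t) c\<bar> \<le> \<bar>nrm c * nrm (\<lambda>x. U n t x - u t x)\<bar>"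
          using jmeas_section[OF J(1)[of n]] jmeas_section[OF J(2)]
        proof eventually_elim
          case (elim t)
          show ?case using ip_CS[OF L2_diff[OF elim] c] ip_diff_left[OF elim c] by (simp add: mult.commute)
        qed
      qed
      also have "\<dots> = nrm c * jn T (\<lambda>t x. U n t x - u t x)"
        using jmeas_nrm(2)[OF Jd] by (simp add: l2n_cmult)
      finally show ?thesis .
    qed
    then show "\<forall>\<^sub>F n in sequentially. l2n (Lon 0 T) (\<lambda>t. ip (U n t) c - ip (u t) c) \<le> nrm c * jn T (\<lambda>t x. U n t x - u t x)"
      by simp
  qed auto
qed

lemma coef_mult_diff:
  assumes d: "coef \<alpha>0 \<alpha>1 d" and d': "coef \<alpha>0 \<alpha>1 d'" and \<delta>: "AE x in Lon 0 1. \<bar>d x - d' x\<bar> \<le> \<delta>"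
    and p: "L2 p" and q: "L2 q"
  shows "nrm (\<lambda>x. d x * p x - d' x * q x) \<le> \<alpha>1 * nrm (\<lambda>x. p x - q x) + \<delta> * nrm q"
proof -
  \<comment> \<open>The signs of constants are read off from bounds that hold almost everywhere,
    since the interval has positive measure.\<close>
  have a1: "0 \<le> \<alpha>1" and d0: "0 \<le> \<delta>"
  proof -
    have ae: "AE x in Lon 0 1. 0 \<le> \<alpha>1 \<and> 0 \<le> \<delta>"
      using coef_bound[OF d] \<delta> by eventually_elim auto
    have "ae_filter (Lon 0 1) \<noteq> bot"
      by (simp add: ae_filter_eq_bot_iff emeasure_restrict_space)
    from iffD1[OF eventually_const[OF this] ae] have "0 \<le> \<alpha>1 \<and> 0 \<le> \<delta>" .
    then show "0 \<le> \<alpha>1" "0 \<le> \<delta>" by auto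
  qed
  have m: "d \<in> borel_measurable (Lon 0 1)" "d' \<in> borel_measurable (Lon 0 1)" using d d' by (auto simp: coef_def)
  have L1: "L2 (\<lambda>x. d x * (p x - q x))" by (rule coef_mult_L2[OF d L2_diff[OF p q]])
  have L2': "L2 (\<lambda>x. (d x - d' x) * q x)" by (rule L2_bounded_mult[OF q _ \<delta>]) (use m in simp)
  have "nrm (\<lambda>x. d x * p x - d' x * q x) = nrm (\<lambda>x. d x * (p x - q x) + (d x - d' x) * q x)"
    by (simp add: algebra_simps)
  also have "\<dots> \<le> nrm (\<lambda>x. d x * (p x - q x)) + nrm (\<lambda>x. (d x - d' x) * q x)"
    using L1 L2' by (intro l2n_triangle) (auto simp: L2_iff_sqint)
  also have "nrm (\<lambda>x. d x * (p x - q x)) \<le> nrm (\<lambda>x. \<alpha>1 * (p x - q x))"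
  proof (rule l2n_mono)
    show "sqint (Lon 0 1) (\<lambda>x. \<alpha>1 * (p x - q x))" using L2_cmult[OF L2_diff[OF p q]] by (simp add: L2_iff_sqint)
    show "AE x in Lon 0 1. \<bar>d x * (p x - q x)\<bar> \<le> \<bar>\<alpha>1 * (p x - q x)\<bar>"
      using coef_bound[OF d] by eventually_elim (auto simp: abs_mult intro!: mult_right_mono)
  qed (rule L2_measurable[OF L1])
  also have "\<dots> = \<alpha>1 * nrm (\<lambda>x. p x - q x)" using a1 by (simp add: l2n_cmult)
  also have "nrm (\<lambda>x. (d x - d' x) * q x) \<le> nrm (\<lambda>x. \<delta> * q x)"
  proof (rule l2n_mono)
    show "sqint (Lon 0 1) (\<lambda>x. \<delta> * q x)" using L2_cmult[OF q] by (simp add: L2_iff_sqint)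
    show "AE x in Lon 0 1. \<bar>(d x - d' x) * q x\<bar> \<le> \<bar>\<delta> * q x\<bar>"
      using \<delta> by eventually_elim (auto simp: abs_mult intro!: mult_right_mono)
  qed (rule L2_measurable[OF L2'])
  also have "\<dots> = \<delta> * nrm q" using d0 by (simp add: l2n_cmult)
  finally show ?thesis by simp
qed

text \<open>A supremum over uncountably many test functions gives no measurability in t by itself.
  Here it is the almost everywhere limit of the dual norms of \<open>W n\<close>, whose squares are
  measurable; \<open>b\<close> then bounds it.\<close>

lemma dual_norm_sq_integrable_limit:
  assumes W: "\<And>n. integrable (Lon 0 T) (\<lambda>t. (dual_norm V N (W n t))\<^sup>2)"
    and ne: "\<exists>\<phi>. V \<phi> \<and> N \<phi> \<noteq> 0" and N0: "\<And>\<phi>. 0 \<le> N \<phi>"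
    and b: "sqint (Lon 0 T) b" "AE t in Lon 0 T. \<forall>\<phi>. V \<phi> \<longrightarrow> \<bar>w t \<phi>\<bar> \<le> b t * N \<phi>"
    and bl: "\<And>n. AE t in Lon 0 T. bounded_lin_fun V N (W n t)"
    and e: "\<And>n. AE t in Lon 0 T. \<forall>\<phi>. V \<phi> \<longrightarrow> \<bar>W n t \<phi> - w t \<phi>\<bar> \<le> e n t * N \<phi>"
      "AE t in Lon 0 T. (\<lambda>n. e n t) \<longlonglongrightarrow> 0"
  shows "integrable (Lon 0 T) (\<lambda>t. (dual_norm V N (w t))\<^sup>2)"
proof -
  let ?D = "\<lambda>t. dual_norm V N (w t)" and ?Dn = "\<lambda>n t. dual_norm V N (W n t)"
  have bl': "AE t in Lon 0 T. \<forall>n. bounded_lin_fun V N (W n t)" using bl by (simp add: AE_all_countable)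
  have e': "AE t in Lon 0 T. \<forall>n \<phi>. V \<phi> \<longrightarrow> \<bar>W n t \<phi> - w t \<phi>\<bar> \<le> e n t * N \<phi>" using e(1) by (simp add: AE_all_countable)
  have conv: "AE t in Lon 0 T. (\<lambda>n. ?Dn n t) \<longlonglongrightarrow> ?D t"
    using bl' e' e(2) b(2)
  proof eventually_elim
    case (elim t)
    have "\<bar>?Dn n t - ?D t\<bar> \<le> e n t" for n
    proof -
      obtain C where "\<And>\<phi>. V \<phi> \<Longrightarrow> \<bar>W n t \<phi>\<bar> \<le> C * N \<phi>"
        using elim(1) unfolding bounded_lin_fun_def by blast
      then show ?thesis
        by (rule dual_norm_lipschitz[OF ne N0]) (use elim in auto)
    qed
    then have "(\<lambda>n. ?Dn n t - ?D t) \<longlonglongrightarrow> 0"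
      by (intro tendsto_rabs_zero_cancel[OF tendsto_sandwich[OF _ _ tendsto_const elim(3)]]) auto
    then show ?case by (rule LIM_zero_cancel)
  qed
  have m: "(\<lambda>t. (?D t)\<^sup>2) \<in> borel_measurable (Lon 0 T)"
  proof (rule borel_measurable_AE_Lon)
    show "(\<lambda>t. lim (\<lambda>n. (?Dn n t)\<^sup>2)) \<in> borel_measurable (Lon 0 T)"
      by (intro borel_measurable_lim_metric borel_measurable_integrable W)
    show "AE t in Lon 0 T. lim (\<lambda>n. (?Dn n t)\<^sup>2) = (?D t)\<^sup>2"
      using conv by eventually_elim (intro limI tendsto_power)
  qed
  show ?thesis
  proof (rule Bochner_Integration.integrable_bound[OF sqint_sq_integrable[OF b(1)] m])
    show "AE t in Lon 0 T. norm ((?D t)\<^sup>2) \<le> norm ((b t)\<^sup>2)"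
      using b(2)
    proof eventually_elim
      case (elim t)
      have "0 \<le> ?D t" "?D t \<le> b t" using dual_norm_bounds[OF ne N0, of "w t" "b t"] elim by auto
      then show ?case by (simp add: power_mono)
    qed
  qed
qed

lemma jmeas_lim:
  assumes J: "\<And>n. jmeas T (U n)"
    and c: "\<And>n. jn T (\<lambda>t x. U (Suc n) t x - U n t x) \<le> c n" "summable c"
  shows "jmeas T (\<lambda>t x. lim (\<lambda>n. U n t x))"
    and "(\<lambda>n. jn T (\<lambda>t x. U n t x - lim (\<lambda>n. U n t x))) \<longlonglongrightarrow> 0"
  using riesz_fischer_fast(1,2)[OF J[unfolded jmeas_iff_sqint] c] by (auto simp: jmeas_iff_sqint)

text \<open>Letting m tend to infinity in the Cauchy estimate leaves a rate in terms of
  \<open>\<delta> n\<close>, uniform over all times that share the constants.\<close>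

lemma section_lim:
  assumes L: "\<And>n. L2 (U n t)" and c: "\<And>n. nrm (\<lambda>x. U (Suc n) t x - U n t x) \<le> c n" "summable c"
    and b: "\<And>m n. nrm (\<lambda>x. U m t x - U n t x) \<le> K * (\<delta> m + \<delta> n)" and \<delta>: "\<delta> \<longlonglongrightarrow> (0::real)"
  shows "L2 (\<lambda>x. lim (\<lambda>n. U n t x))" "nrm (\<lambda>x. U n t x - lim (\<lambda>n. U n t x)) \<le> K * \<delta> n"
proof -
  let ?u = "\<lambda>x. lim (\<lambda>n. U n t x)"
  note rf = riesz_fischer_fast(1,2)[where f = "\<lambda>n. U n t", OF L[unfolded L2_iff_sqint] c]
  show "L2 ?u" using rf(1) by (simp add: L2_iff_sqint)
  have le: "nrm (\<lambda>x. U n t x - ?u x) \<le> K * (\<delta> m + \<delta> n) + nrm (\<lambda>x. U m t x - ?u x)" for m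
    using l2n_triangle3[OF L[of n, unfolded L2_iff_sqint] L[of m, unfolded L2_iff_sqint] rf(1)]
      b[of m n] l2n_minus_commute[of "Lon 0 1" "U n t" "U m t"] by linarith
  have "(\<lambda>m. K * (\<delta> m + \<delta> n) + nrm (\<lambda>x. U m t x - ?u x)) \<longlonglongrightarrow> K * (0 + \<delta> n) + 0"
    by (intro tendsto_intros \<delta> rf(2))
  from LIMSEQ_le_const[OF this] show "nrm (\<lambda>x. U n t x - ?u x) \<le> K * \<delta> n" using le by auto
qed

text \<open>Existence for \<open>d\<close> is produced here: stability makes the given solutions
  Cauchy in every norm of the formulation, and each clause of \<open>weak_sol\<close> passes to the
  limit.\<close>

theorem weak_sol_limit:
  assumes "T > 0" and D: "\<And>n. coef \<alpha>0 \<alpha>1 (D n)" and d: "coef \<alpha>0 \<alpha>1 d"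
    and \<delta>: "\<And>n. AE x in Lon 0 1. \<bar>D n x - d x\<bar> \<le> \<delta> n" "\<And>n. 0 \<le> \<delta> n" "summable \<delta>"
    and ws: "\<And>n. weak_sol T u0 v0 (D n) (U n) (V n)" and u0: "L2 u0" and v0: "L2 v0"
  obtains u v where "weak_sol T u0 v0 d u v"
    "(\<lambda>n. nrm (\<lambda>x. U n T x - u T x)) \<longlonglongrightarrow> 0" "(\<lambda>n. nrm (\<lambda>x. V n T x - v T x)) \<longlonglongrightarrow> 0"
proof -
  have a: "0 < \<alpha>0" using d by (simp add: coef_def)
  have T0: "0 \<in> {0..T}" "T \<in> {0..T}" using \<open>T > 0\<close> by auto
  have \<delta>0: "\<delta> \<longlonglongrightarrow> 0" using \<delta>(3) by (rule summable_LIMSEQ_zero)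
  define P where "P n u1 u2 v1 ut vt \<longleftrightarrow> rsol T (D n) (U n) (V n) u1 u2 v1 \<and>
    L2_dual T V02 H2_norm ut \<and> L2_dual T H01 H1_norm vt \<and>
    is_time_deriv T V02 (U n) ut \<and> is_time_deriv T H01 (V n) vt \<and>
    (AE t in Lon 0 T. \<forall>\<phi>. V02 \<phi> \<longrightarrow> ut t \<phi> = ip (V n t) \<phi> - ip (u2 t) (wd (wd \<phi>))) \<and>
    (AE t in Lon 0 T. \<forall>\<phi>. H01 \<phi> \<longrightarrow> vt t \<phi> = - ip (\<lambda>x. D n x * v1 t x) (wd \<phi>))" for n u1 u2 v1 ut vt
  have "\<exists>u1 u2 v1 ut vt. P n u1 u2 v1 ut vt" for n
    unfolding P_def by (rule weak_sol_unfold[OF \<open>T > 0\<close> D ws, of n]) blast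
  then obtain U1 U2 V1 Ut Vt where P: "\<And>n. P n (U1 n) (U2 n) (V1 n) (Ut n) (Vt n)"
    by metis
  have r: "rsol T (D n) (U n) (V n) (U1 n) (U2 n) (V1 n)" and
    dual: "L2_dual T V02 H2_norm (Ut n)" "L2_dual T H01 H1_norm (Vt n)" and
    td: "is_time_deriv T V02 (U n) (Ut n)" "is_time_deriv T H01 (V n) (Vt n)" and
    Ut: "AE t in Lon 0 T. \<forall>\<phi>. V02 \<phi> \<longrightarrow> Ut n t \<phi> = ip (V n t) \<phi> - ip (U2 n t) (wd (wd \<phi>))" and
    Vt: "AE t in Lon 0 T. \<forall>\<phi>. H01 \<phi> \<longrightarrow> Vt n t \<phi> = - ip (\<lambda>x. D n x * V1 n t x) (wd \<phi>)" for n
    using P[of n] unfolding P_def by blast+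
  have J: "jmeas T (U n)" "jmeas T (U1 n)" "jmeas T (U2 n)" "jmeas T (V n)" "jmeas T (V1 n)"
    and C: "cont_L2 T (U n)" "cont_L2 T (V n)"
    and H: "AE t in Lon 0 T. H01p (U n t) (U1 n t) \<and> has_weak_deriv (U1 n t) (U2 n t)"
      "AE t in Lon 0 T. H01p (V n t) (V1 n t)" for n
    using r[of n] unfolding rsol_def by blast+
  have init: "AE x in Lon 0 1. U n 0 x = u0 x" "AE x in Lon 0 1. V n 0 x = v0 x" for n
    using ws[of n] unfolding weak_sol_def Omega_def by blast+
  have nV0: "nrm (V n 0) = nrm v0" for n
    by (rule l2n_cong_AE[OF L2_measurable[OF cont_L2_D(1)[OF C(2) T0(1)]] L2_measurable[OF v0] init(2)])
  define K where "K = nrm v0 / \<alpha>0"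
  have K0: "0 \<le> K" using a by (simp add: K_def)
  have ini: "AE x in Lon 0 1. U m 0 x = U n 0 x" "AE x in Lon 0 1. V m 0 x = V n 0 x" for m n
    using init(1)[of m] init(1)[of n] init(2)[of m] init(2)[of n] by (eventually_elim, simp)+
  \<comment> \<open>A solution for \<open>d\<close> is only being constructed, so stability compares
    two members of the sequence; \<open>d\<close> enters through the triangle inequality.\<close>
  have dd: "AE x in Lon 0 1. \<bar>D m x - D n x\<bar> \<le> \<delta> m + \<delta> n" for m n
    using \<delta>(1)[of m] \<delta>(1)[of n] by eventually_elim linarith
  have nn: "0 \<le> \<delta> m + \<delta> n" for m n using \<delta>(2)[of m] \<delta>(2)[of n] by simp
  note st = stability[OF \<open>T > 0\<close> D D dd nn r r ini]
  have eps: "(\<delta> m + \<delta> n) * nrm (V n 0) / \<alpha>0 = K * (\<delta> m + \<delta> n)" for m n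
    unfolding nV0 K_def by simp
  have bV: "nrm (\<lambda>x. V m t x - V n t x) \<le> K * (\<delta> m + \<delta> n)" if "t \<in> {0..T}" for m n t
    using st(1)[OF that, of m n] unfolding eps .
  have bU: "nrm (\<lambda>x. U m t x - U n t x) \<le> (2 * T * K) * (\<delta> m + \<delta> n)" if "t \<in> {0..T}" for m n t
    using st(3)[OF that, of m n] unfolding eps by (simp add: mult.assoc)
  have bU2: "jn T (\<lambda>t x. U2 m t x - U2 n t x) \<le> (2 * T * K) * (\<delta> m + \<delta> n)" for m n
    using st(4)[of m n] unfolding eps by (simp add: mult.assoc)
  have bU1: "jn T (\<lambda>t x. U1 m t x - U1 n t x) \<le> ((1 + T) * (2 * T * K)) * (\<delta> m + \<delta> n)" for m n
    using st(5)[of m n] unfolding eps by (simp add: mult.assoc)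
  have bV1: "jn T (\<lambda>t x. V1 m t x - V1 n t x) \<le> (K / sqrt \<alpha>0) * (\<delta> m + \<delta> n)" for m n
    using st(2)[of m n] a unfolding eps by (simp add: field_simps)
  have bUj: "jn T (\<lambda>t x. U m t x - U n t x) \<le> ((1 + T) * (2 * T * K)) * (\<delta> m + \<delta> n)" for m n
  proof -
    have "jn T (\<lambda>t x. U m t x - U n t x) \<le> (1 + T) * ((2 * T * K) * (\<delta> m + \<delta> n))"
      by (rule jmeas_jn_le[OF jmeas_diff[OF J(1) J(1)]]) (use bU AE_space \<open>T > 0\<close> K0 nn in \<open>auto elim: eventually_mono\<close>)
    then show ?thesis by (simp add: mult.assoc)
  qed
  have bVj: "jn T (\<lambda>t x. V m t x - V n t x) \<le> ((1 + T) * K) * (\<delta> m + \<delta> n)" for m n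
  proof -
    have "jn T (\<lambda>t x. V m t x - V n t x) \<le> (1 + T) * (K * (\<delta> m + \<delta> n))"
      by (rule jmeas_jn_le[OF jmeas_diff[OF J(4) J(4)]]) (use bV AE_space \<open>T > 0\<close> K0 nn in \<open>auto elim: eventually_mono\<close>)
    then show ?thesis by (simp add: mult.assoc)
  qed
  \<comment> \<open>Summable increments are the hypothesis of fast convergence, so the whole
    sequences have limits.\<close>
  have summ: "summable (\<lambda>n. c * (\<delta> (Suc n) + \<delta> n))" for c
    by (intro summable_mult summable_add \<delta>(3) summable_Suc_iff[THEN iffD2])

  define u where "u = (\<lambda>t x. lim (\<lambda>n. U n t x))"
  define u1 where "u1 = (\<lambda>t x. lim (\<lambda>n. U1 n t x))"
  define u2 where "u2 = (\<lambda>t x. lim (\<lambda>n. U2 n t x))"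
  define v where "v = (\<lambda>t x. lim (\<lambda>n. V n t x))"
  define v1 where "v1 = (\<lambda>t x. lim (\<lambda>n. V1 n t x))"
  have uj: "jmeas T u" "(\<lambda>n. jn T (\<lambda>t x. U n t x - u t x)) \<longlonglongrightarrow> 0"
    and u1j: "jmeas T u1" "(\<lambda>n. jn T (\<lambda>t x. U1 n t x - u1 t x)) \<longlonglongrightarrow> 0"
    and u2j: "jmeas T u2" "(\<lambda>n. jn T (\<lambda>t x. U2 n t x - u2 t x)) \<longlonglongrightarrow> 0"
    and vj: "jmeas T v" "(\<lambda>n. jn T (\<lambda>t x. V n t x - v t x)) \<longlonglongrightarrow> 0"
    and v1j: "jmeas T v1" "(\<lambda>n. jn T (\<lambda>t x. V1 n t x - v1 t x)) \<longlonglongrightarrow> 0"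
    unfolding u_def u1_def u2_def v_def v1_def
    using jmeas_lim[OF J(1) bUj summ] jmeas_lim[OF J(2) bU1 summ] jmeas_lim[OF J(3) bU2 summ]
      jmeas_lim[OF J(4) bVj summ] jmeas_lim[OF J(5) bV1 summ] by auto
  have su: "L2 (u t)" "nrm (\<lambda>x. U n t x - u t x) \<le> (2 * T * K) * \<delta> n" if t: "t \<in> {0..T}" for t n
    using section_lim[of U t, OF cont_L2_D(1)[OF C(1) t] bU[OF t] summ bU[OF t] \<delta>0] by (auto simp: u_def)
  have sv: "L2 (v t)" "nrm (\<lambda>x. V n t x - v t x) \<le> K * \<delta> n" if t: "t \<in> {0..T}" for t n
    using section_lim[of V t, OF cont_L2_D(1)[OF C(2) t] bV[OF t] summ bV[OF t] \<delta>0] by (auto simp: v_def)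
  have z: "(\<lambda>n. c * \<delta> n) \<longlonglongrightarrow> 0" for c using tendsto_mult_right_zero[OF \<delta>0] .
  have cu: "cont_L2 T u" by (rule cont_L2_uniform_limit[OF C(1) su(1) su(2) z])
  have cv: "cont_L2 T v" by (rule cont_L2_uniform_limit[OF C(2) sv(1) sv(2) z])
  have limu: "(\<lambda>n. nrm (\<lambda>x. U n t x - u t x)) \<longlonglongrightarrow> 0" if t: "t \<in> {0..T}" for t
    by (rule tendsto_sandwich[OF _ _ tendsto_const z[of "2 * T * K"]]) (use su(2)[OF t] in auto)
  have limv: "(\<lambda>n. nrm (\<lambda>x. V n t x - v t x)) \<longlonglongrightarrow> 0" if t: "t \<in> {0..T}" for t
    by (rule tendsto_sandwich[OF _ _ tendsto_const z[of K]]) (use sv(2)[OF t] in auto)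

  \<comment> \<open>The derivatives are known to converge on the cylinder. Their summed squared
    slice norms tend to 0 in L1 of time, so a single subsequence \<open>\<rho>\<close> serves all
    three at almost every time.\<close>
  define g where "g n t = (nrm (\<lambda>x. U1 n t x - u1 t x))\<^sup>2 + (nrm (\<lambda>x. U2 n t x - u2 t x))\<^sup>2 + (nrm (\<lambda>x. V1 n t x - v1 t x))\<^sup>2" for n t
  have sq: "integrable (Lon 0 T) (\<lambda>t. (nrm (f t))\<^sup>2)" "(\<integral>t. (nrm (f t))\<^sup>2 \<partial>Lon 0 T) = (jn T f)\<^sup>2" if "jmeas T f" for f
    using jmeas_nrm[OF that] by (auto simp: sqint_def l2n_sq[of "Lon 0 T", symmetric])
  note sq1 = sq[OF jmeas_diff[OF J(2) u1j(1)]] and sq2 = sq[OF jmeas_diff[OF J(3) u2j(1)]] and sq3 = sq[OF jmeas_diff[OF J(5) v1j(1)]]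
  have gi: "integrable (Lon 0 T) (g n)" for n
    unfolding g_def by (intro Bochner_Integration.integrable_add sq1 sq2 sq3)
  have "(\<integral>t. norm (g n t) \<partial>Lon 0 T)
      = (jn T (\<lambda>t x. U1 n t x - u1 t x))\<^sup>2 + (jn T (\<lambda>t x. U2 n t x - u2 t x))\<^sup>2 + (jn T (\<lambda>t x. V1 n t x - v1 t x))\<^sup>2" for n
    using sq1[of n] sq2[of n] sq3[of n] by (simp add: g_def)
  moreover have "(\<lambda>n. (jn T (\<lambda>t x. U1 n t x - u1 t x))\<^sup>2 + (jn T (\<lambda>t x. U2 n t x - u2 t x))\<^sup>2 + (jn T (\<lambda>t x. V1 n t x - v1 t x))\<^sup>2)
      \<longlonglongrightarrow> 0\<^sup>2 + 0\<^sup>2 + 0\<^sup>2"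
    by (intro tendsto_intros u1j u2j v1j)
  ultimately have "(\<lambda>n. \<integral>t. norm (g n t) \<partial>Lon 0 T) \<longlonglongrightarrow> 0" by simp
  then obtain \<rho> :: "nat \<Rightarrow> nat" where \<rho>: "strict_mono \<rho>" "AE t in Lon 0 T. (\<lambda>n. g (\<rho> n) t) \<longlonglongrightarrow> 0"
    using tendsto_L1_AE_subseq[of "Lon 0 T" g] gi by blast
  have sec: "AE t in Lon 0 T. (\<lambda>n. nrm (\<lambda>x. U1 (\<rho> n) t x - u1 t x)) \<longlonglongrightarrow> 0 \<and>
     (\<lambda>n. nrm (\<lambda>x. U2 (\<rho> n) t x - u2 t x)) \<longlonglongrightarrow> 0 \<and> (\<lambda>n. nrm (\<lambda>x. V1 (\<rho> n) t x - v1 t x)) \<longlonglongrightarrow> 0"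
    using \<rho>(2)
  proof eventually_elim
    case (elim t)
    have "(\<lambda>n. sqrt (g (\<rho> n) t)) \<longlonglongrightarrow> 0" using tendsto_real_sqrt[OF elim] by simp
    note sand = tendsto_sandwich[OF _ _ tendsto_const this]
    show ?case
      by (intro conjI; rule sand) (auto simp: g_def intro!: always_eventually real_le_rsqrt)
  qed
  have secL: "AE t in Lon 0 T. L2 (u1 t) \<and> L2 (u2 t) \<and> L2 (v1 t) \<and> t \<in> {0..T}"
    using jmeas_section[OF u1j(1)] jmeas_section[OF u2j(1)] jmeas_section[OF v1j(1)] AE_space by eventually_elim auto
  have secN: "AE t in Lon 0 T. \<forall>n. H01p (U n t) (U1 n t) \<and> has_weak_deriv (U1 n t) (U2 n t) \<and> L2 (U2 n t) \<and> H01p (V n t) (V1 n t)"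
    unfolding AE_all_countable
  proof
    fix n
    show "AE t in Lon 0 T. H01p (U n t) (U1 n t) \<and> has_weak_deriv (U1 n t) (U2 n t) \<and> L2 (U2 n t) \<and> H01p (V n t) (V1 n t)"
      using H[of n] jmeas_section[OF J(3)[of n]] by eventually_elim auto
  qed
  have Hu: "AE t in Lon 0 T. H01p (u t) (u1 t) \<and> has_weak_deriv (u1 t) (u2 t)"
    using sec secL secN
  proof eventually_elim
    case (elim t)
    then have t: "t \<in> {0..T}" by simp
    have "H01p (u t) (u1 t)"
      by (rule H01p_limit[of "\<lambda>n. U (\<rho> n) t" "\<lambda>n. U1 (\<rho> n) t"])
         (use elim su(1)[OF t] LIMSEQ_subseq_LIMSEQ[OF limu[OF t] \<rho>(1)] in \<open>auto simp: comp_def\<close>)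
    moreover have "has_weak_deriv (u1 t) (u2 t)"
      by (rule weak_deriv_limit[of "\<lambda>n. U1 (\<rho> n) t" "\<lambda>n. U2 (\<rho> n) t"]) (use elim H01p_D(2) in auto)
    ultimately show ?case by simp
  qed
  have Hv: "AE t in Lon 0 T. H01p (v t) (v1 t)"
    using sec secL secN
  proof eventually_elim
    case (elim t)
    then have t: "t \<in> {0..T}" by simp
    show ?case
      by (rule H01p_limit[of "\<lambda>n. V (\<rho> n) t" "\<lambda>n. V1 (\<rho> n) t"])
         (use elim sv(1)[OF t] LIMSEQ_subseq_LIMSEQ[OF limv[OF t] \<rho>(1)] in \<open>auto simp: comp_def\<close>)
  qed
  have A: "L2_V02 T u"
    unfolding L2_V02_def
  proof (intro exI conjI)
    show "AE t in Lon 0 T. has_weak_deriv (u t) (u1 t) \<and> has_weak_deriv (u1 t) (u2 t) \<and> zero_bdry (u t)"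
      using Hu by eventually_elim (auto dest: H01p_D)
  qed (rule uj u1j u2j)+
  have B: "L2_H01 T v"
    unfolding L2_H01_def
  proof (intro exI conjI)
    show "AE t in Lon 0 T. has_weak_deriv (v t) (v1 t) \<and> zero_bdry (v t)"
      using Hv by eventually_elim (auto dest: H01p_D)
  qed (rule vj v1j)+

  \<comment> \<open>The limit functionals are read off from the equations; that they are time
    derivatives is shown afterwards by passing to the limit in the tested identities.\<close>
  define ut where "ut = (\<lambda>t \<phi>. ip (v t) \<phi> - ip (u2 t) (wd (wd \<phi>)))"
  define vt where "vt = (\<lambda>t \<phi>. - ip (\<lambda>x. d x * v1 t x) (wd \<phi>))"
  have dv1: "jmeas T (\<lambda>t x. d x * v1 t x)" by (rule coef_mult_jmeas[OF d v1j(1)])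
  have utb: "\<bar>ip p \<phi> - ip q (wd (wd \<phi>))\<bar> \<le> (nrm p + nrm q) * H2_norm \<phi>" if "V02 \<phi>" "L2 p" "L2 q" for p q \<phi>
  proof -
    note f = V02_facts[OF that(1)]
    have "\<bar>ip p \<phi> - ip q (wd (wd \<phi>))\<bar> \<le> nrm p * nrm \<phi> + nrm q * nrm (wd (wd \<phi>))"
      using ip_CS[OF that(2) H01p_D(1)[OF f(1)]] ip_CS[OF that(3) f(2)] by linarith
    also have "\<dots> \<le> nrm p * H2_norm \<phi> + nrm q * H2_norm \<phi>"
      by (intro add_mono mult_left_mono nrm_le_H2_norm) auto
    finally show ?thesis by (simp add: distrib_right)
  qed
  have vtb: "\<bar>ip p (wd \<phi>)\<bar> \<le> nrm p * H1_norm \<phi>" if "H01 \<phi>" "L2 p" for p \<phi>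
  proof -
    have "\<bar>ip p (wd \<phi>)\<bar> \<le> nrm p * nrm (wd \<phi>)" by (rule ip_CS[OF that(2) H01p_D(2)[OF H01_H01p[OF that(1)]]])
    also have "\<dots> \<le> nrm p * H1_norm \<phi>" by (intro mult_left_mono nrm_le_H1_norm) auto
    finally show ?thesis .
  qed
  have bu: "AE t in Lon 0 T. \<forall>\<phi>. V02 \<phi> \<longrightarrow> \<bar>ut t \<phi>\<bar> \<le> (nrm (v t) + nrm (u2 t)) * H2_norm \<phi>"
    using secL by eventually_elim (auto simp: ut_def intro!: utb sv(1))
  have bv: "AE t in Lon 0 T. \<forall>\<phi>. H01 \<phi> \<longrightarrow> \<bar>vt t \<phi>\<bar> \<le> nrm (\<lambda>x. d x * v1 t x) * H1_norm \<phi>"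
    using secL by eventually_elim (auto simp: vt_def intro!: vtb coef_mult_L2[OF d])
  have blU: "AE t in Lon 0 T. bounded_lin_fun V02 H2_norm (Ut n t)" "integrable (Lon 0 T) (\<lambda>t. (dual_norm V02 H2_norm (Ut n t))\<^sup>2)"
    and blV: "AE t in Lon 0 T. bounded_lin_fun H01 H1_norm (Vt n t)" "integrable (Lon 0 T) (\<lambda>t. (dual_norm H01 H1_norm (Vt n t))\<^sup>2)" for n
    using dual[of n] by (auto simp: L2_dual_def)
  have DU: "integrable (Lon 0 T) (\<lambda>t. (dual_norm V02 H2_norm (ut t))\<^sup>2)"
  proof (rule dual_norm_sq_integrable_limit[where W = "\<lambda>n. Ut (\<rho> n)" and b = "\<lambda>t. nrm (v t) + nrm (u2 t)"
        and e = "\<lambda>n t. nrm (\<lambda>x. V (\<rho> n) t x - v t x) + nrm (\<lambda>x. U2 (\<rho> n) t x - u2 t x)",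
        OF blU(2) V02_nontrivial H2_norm_nonneg _ bu blU(1)])
    show "sqint (Lon 0 T) (\<lambda>t. nrm (v t) + nrm (u2 t))" by (intro sqint_add jmeas_nrm vj u2j)
    show "AE t in Lon 0 T. (\<lambda>n. nrm (\<lambda>x. V (\<rho> n) t x - v t x) + nrm (\<lambda>x. U2 (\<rho> n) t x - u2 t x)) \<longlonglongrightarrow> 0"
      using sec secL
    proof eventually_elim
      case (elim t)
      then have t: "t \<in> {0..T}" by simp
      show ?case using tendsto_add[OF LIMSEQ_subseq_LIMSEQ[OF limv[OF t] \<rho>(1)], of _ 0] elim by (simp add: comp_def)
    qed
    show "AE t in Lon 0 T. \<forall>\<phi>. V02 \<phi> \<longrightarrow> \<bar>Ut (\<rho> n) t \<phi> - ut t \<phi>\<bar>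
        \<le> (nrm (\<lambda>x. V (\<rho> n) t x - v t x) + nrm (\<lambda>x. U2 (\<rho> n) t x - u2 t x)) * H2_norm \<phi>" for n
      using Ut[of "\<rho> n"] secL secN
    proof eventually_elim
      case (elim t)
      then have t: "t \<in> {0..T}" and L: "L2 (u2 t)" "L2 (U2 (\<rho> n) t)" by auto
      note Lv = sv(1)[OF t] cont_L2_D(1)[OF C(2)[of "\<rho> n"] t]
      show ?case
      proof (intro allI impI)
        fix \<phi> assume \<phi>: "V02 \<phi>"
        note f = V02_facts[OF \<phi>]
        have "Ut (\<rho> n) t \<phi> - ut t \<phi> = ip (\<lambda>x. V (\<rho> n) t x - v t x) \<phi> - ip (\<lambda>x. U2 (\<rho> n) t x - u2 t x) (wd (wd \<phi>))"
          using elim(1) \<phi> ip_diff_left[OF Lv(2,1) H01p_D(1)[OF f(1)]] ip_diff_left[OF L(2,1) f(2)] by (simp add: ut_def)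
        then show "\<bar>Ut (\<rho> n) t \<phi> - ut t \<phi>\<bar> \<le> (nrm (\<lambda>x. V (\<rho> n) t x - v t x) + nrm (\<lambda>x. U2 (\<rho> n) t x - u2 t x)) * H2_norm \<phi>"
          using utb[OF \<phi> L2_diff[OF Lv(2,1)] L2_diff[OF L(2,1)]] by simp
      qed
    qed
  qed
  have dvd: "nrm (\<lambda>x. D n x * V1 n t x - d x * v1 t x) \<le> \<alpha>1 * nrm (\<lambda>x. V1 n t x - v1 t x) + \<delta> n * nrm (v1 t)"
    if "L2 (V1 n t)" "L2 (v1 t)" for n t
    by (rule coef_mult_diff[OF D d \<delta>(1) that])
  have DV: "integrable (Lon 0 T) (\<lambda>t. (dual_norm H01 H1_norm (vt t))\<^sup>2)"
  proof (rule dual_norm_sq_integrable_limit[where W = "\<lambda>n. Vt (\<rho> n)" and b = "\<lambda>t. nrm (\<lambda>x. d x * v1 t x)"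
        and e = "\<lambda>n t. \<alpha>1 * nrm (\<lambda>x. V1 (\<rho> n) t x - v1 t x) + \<delta> (\<rho> n) * nrm (v1 t)",
        OF blV(2) H01_nontrivial H1_norm_nonneg _ bv blV(1)])
    show "sqint (Lon 0 T) (\<lambda>t. nrm (\<lambda>x. d x * v1 t x))" by (rule jmeas_nrm(1)[OF dv1])
    show "AE t in Lon 0 T. (\<lambda>n. \<alpha>1 * nrm (\<lambda>x. V1 (\<rho> n) t x - v1 t x) + \<delta> (\<rho> n) * nrm (v1 t)) \<longlonglongrightarrow> 0"
      using sec
    proof eventually_elim
      case (elim t)
      have "(\<lambda>n. \<alpha>1 * nrm (\<lambda>x. V1 (\<rho> n) t x - v1 t x) + \<delta> (\<rho> n) * nrm (v1 t)) \<longlonglongrightarrow> \<alpha>1 * 0 + 0 * nrm (v1 t)"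
        using elim LIMSEQ_subseq_LIMSEQ[OF \<delta>0 \<rho>(1)] by (intro tendsto_intros) (auto simp: comp_def)
      then show ?case by simp
    qed
    show "AE t in Lon 0 T. \<forall>\<phi>. H01 \<phi> \<longrightarrow> \<bar>Vt (\<rho> n) t \<phi> - vt t \<phi>\<bar>
        \<le> (\<alpha>1 * nrm (\<lambda>x. V1 (\<rho> n) t x - v1 t x) + \<delta> (\<rho> n) * nrm (v1 t)) * H1_norm \<phi>" for n
      using Vt[of "\<rho> n"] secL secN
    proof eventually_elim
      case (elim t)
      then have L: "L2 (v1 t)" "L2 (V1 (\<rho> n) t)" by (auto dest: H01p_D(2))
      note Ld = coef_mult_L2[OF D[of "\<rho> n"] L(2)] coef_mult_L2[OF d L(1)]
      show ?case
      proof (intro allI impI)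
        fix \<phi> assume \<phi>: "H01 \<phi>"
        note f = H01p_D(2)[OF H01_H01p[OF \<phi>]]
        have "\<bar>Vt (\<rho> n) t \<phi> - vt t \<phi>\<bar> = \<bar>ip (\<lambda>x. D (\<rho> n) x * V1 (\<rho> n) t x - d x * v1 t x) (wd \<phi>)\<bar>"
          using elim(1) \<phi> ip_diff_left[OF Ld f] by (simp add: vt_def)
        also have "\<dots> \<le> nrm (\<lambda>x. D (\<rho> n) x * V1 (\<rho> n) t x - d x * v1 t x) * H1_norm \<phi>"
          by (rule vtb[OF \<phi> L2_diff[OF Ld]])
        also have "\<dots> \<le> (\<alpha>1 * nrm (\<lambda>x. V1 (\<rho> n) t x - v1 t x) + \<delta> (\<rho> n) * nrm (v1 t)) * H1_norm \<phi>"
          by (intro mult_right_mono dvd L H1_norm_nonneg)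
        finally show "\<bar>Vt (\<rho> n) t \<phi> - vt t \<phi>\<bar> \<le> (\<alpha>1 * nrm (\<lambda>x. V1 (\<rho> n) t x - v1 t x) + \<delta> (\<rho> n) * nrm (v1 t)) * H1_norm \<phi>" .
      qed
    qed
  qed
  have dualU: "L2_dual T V02 H2_norm ut"
    unfolding L2_dual_def
  proof (intro conjI allI impI DU)
    show "AE t in Lon 0 T. bounded_lin_fun V02 H2_norm (ut t)"
      using secL bu
    proof eventually_elim
      case (elim t)
      then have t: "t \<in> {0..T}" and L: "L2 (u2 t)" by auto
      show ?case unfolding bounded_lin_fun_def
      proof (intro conjI allI impI)
        fix \<phi> \<psi> a b assume V: "V02 \<phi> \<and> V02 \<psi>"
        note f = V02_facts[of \<phi>] and g = V02_facts[of \<psi>]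
        have "ip (u2 t) (wd (wd (\<lambda>x. a * \<phi> x + b * \<psi> x))) = ip (u2 t) (\<lambda>x. a * wd (wd \<phi>) x + b * wd (wd \<psi>) x)"
        proof (rule ip_cong_AE[OF L2_measurable[OF L] L2_measurable[OF L] _ _ _ V02_wd_wd_linear])
          have "V02 (\<lambda>x. a * \<phi> x + b * \<psi> x)"
            using V f g H01p_D by (intro V02I[OF H01p_linear[OF f(1) g(1)] _ has_weak_deriv_linear]) (auto intro!: L2_add L2_cmult)
          then show "wd (wd (\<lambda>x. a * \<phi> x + b * \<psi> x)) \<in> borel_measurable (Lon 0 1)"
            using V02_facts(2) L2_measurable by blast
          show "(\<lambda>x. a * wd (wd \<phi>) x + b * wd (wd \<psi>) x) \<in> borel_measurable (Lon 0 1)"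
            using V f(2) g(2) by (intro L2_measurable L2_add L2_cmult) auto
        qed (use V in auto)
        also have "\<dots> = a * ip (u2 t) (wd (wd \<phi>)) + b * ip (u2 t) (wd (wd \<psi>))"
          using V f(2) g(2) L by (simp add: ip_add_right L2_cmult ip_cmult_right)
        finally show "ut t (\<lambda>x. a * \<phi> x + b * \<psi> x) = a * ut t \<phi> + b * ut t \<psi>"
          using V H01p_D(1)[OF f(1)] H01p_D(1)[OF g(1)] sv(1)[OF t]
          by (simp add: ut_def ip_add_right L2_cmult ip_cmult_right algebra_simps)
      next
        show "\<exists>C. \<forall>\<phi>. V02 \<phi> \<longrightarrow> \<bar>ut t \<phi>\<bar> \<le> C * H2_norm \<phi>" using elim(2) by blast
      qed
    qed
    fix \<phi> assume \<phi>: "V02 \<phi>"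
    have "sqint (Lon 0 T) (\<lambda>t. ut t \<phi>)"
      unfolding ut_def by (intro sqint_diff jmeas_ip_sqint vj u2j V02_facts(2)[OF \<phi>] H01p_D(1)[OF V02_facts(1)[OF \<phi>]])
    then show "(\<lambda>t. ut t \<phi>) \<in> borel_measurable (Lon 0 T)" by (rule sqint_measurable)
  qed
  have dualV: "L2_dual T H01 H1_norm vt"
    unfolding L2_dual_def
  proof (intro conjI allI impI DV)
    show "AE t in Lon 0 T. bounded_lin_fun H01 H1_norm (vt t)"
      using secL bv
    proof eventually_elim
      case (elim t)
      then have L: "L2 (\<lambda>x. d x * v1 t x)" by (intro coef_mult_L2[OF d]) auto
      show ?case unfolding bounded_lin_fun_def
      proof (intro conjI allI impI)
        fix \<phi> \<psi> a b assume V: "H01 \<phi> \<and> H01 \<psi>"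
        then have h: "H01 \<phi>" "H01 \<psi>" by auto
        note f = H01p_D(2)[OF H01_H01p[OF h(1)]] and g = H01p_D(2)[OF H01_H01p[OF h(2)]]
        have "ip (\<lambda>x. d x * v1 t x) (wd (\<lambda>x. a * \<phi> x + b * \<psi> x)) = ip (\<lambda>x. d x * v1 t x) (\<lambda>x. a * wd \<phi> x + b * wd \<psi> x)"
          by (rule ip_cong_AE[OF L2_measurable[OF L] L2_measurable[OF L]
               L2_measurable[OF H01p_D(2)[OF H01_H01p[OF H01_wd_linear(2)[OF h]]]] L2_measurable[OF L2_add[OF L2_cmult[OF f] L2_cmult[OF g]]] _
               H01_wd_linear(1)[OF h]]) simp
        also have "\<dots> = a * ip (\<lambda>x. d x * v1 t x) (wd \<phi>) + b * ip (\<lambda>x. d x * v1 t x) (wd \<psi>)"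
          using f g L by (simp add: ip_add_right L2_cmult ip_cmult_right)
        finally show "vt t (\<lambda>x. a * \<phi> x + b * \<psi> x) = a * vt t \<phi> + b * vt t \<psi>"
          by (simp add: vt_def)
      next
        show "\<exists>C. \<forall>\<phi>. H01 \<phi> \<longrightarrow> \<bar>vt t \<phi>\<bar> \<le> C * H1_norm \<phi>" using elim(2) by blast
      qed
    qed
    fix \<phi> assume \<phi>: "H01 \<phi>"
    have "sqint (Lon 0 T) (\<lambda>t. vt t \<phi>)"
      unfolding vt_def by (intro sqint_minus jmeas_ip_sqint dv1 H01p_D(2)[OF H01_H01p[OF \<phi>]])
    then show "(\<lambda>t. vt t \<phi>) \<in> borel_measurable (Lon 0 T)" by (rule sqint_measurable)
  qed
  have tsq: "sqint (Lon 0 T) \<psi>" "sqint (Lon 0 T) (deriv \<psi>)" if \<psi>: "test_fun 0 T \<psi>" for \<psi>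
  proof -
    have "sqint (Lon 0 T) f" if f: "continuous_on {0..T} f" for f :: "real \<Rightarrow> real"
    proof -
      obtain B where B: "\<And>x. x \<in> {0..T} \<Longrightarrow> \<bar>f x\<bar> \<le> B"
        using compact_imp_bounded[OF compact_continuous_image[OF f compact_Icc]] unfolding bounded_iff by fastforce
      show ?thesis
        by (rule finite_measure.sqint_bounded[OF finite_measure_Lon, of _ _ _ B])
           (use B in \<open>auto intro!: continuous_on_measurable_Lon continuous_on_subset[OF f]\<close>)
    qed
    then show "sqint (Lon 0 T) \<psi>" "sqint (Lon 0 T) (deriv \<psi>)"
      using test_funD(2)[OF \<psi>] test_funD(3)[OF \<psi>] by blast+
  qed
  have tdU: "is_time_deriv T V02 u ut"
    unfolding is_time_deriv_def
  proof (intro allI impI)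
    fix \<phi> \<psi> assume "V02 \<phi> \<and> test_fun 0 T \<psi>"
    then have \<phi>: "V02 \<phi>" and \<psi>: "test_fun 0 T \<psi>" by auto
    note f = H01p_D(1)[OF V02_facts(1)[OF \<phi>]] V02_facts(2)[OF \<phi>]
    note ps = tsq[OF \<psi>]
    have l: "(\<lambda>n. \<integral>t. ip (U n t) \<phi> * deriv \<psi> t \<partial>Lon 0 T) \<longlonglongrightarrow> (\<integral>t. ip (u t) \<phi> * deriv \<psi> t \<partial>Lon 0 T)"
      by (rule jn_ip_tendsto[OF J(1) uj f(1) ps(2)])
    have r1: "(\<lambda>n. \<integral>t. ip (V n t) \<phi> * \<psi> t \<partial>Lon 0 T) \<longlonglongrightarrow> (\<integral>t. ip (v t) \<phi> * \<psi> t \<partial>Lon 0 T)"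
      by (rule jn_ip_tendsto[OF J(4) vj f(1) ps(1)])
    have r2: "(\<lambda>n. \<integral>t. ip (U2 n t) (wd (wd \<phi>)) * \<psi> t \<partial>Lon 0 T) \<longlonglongrightarrow> (\<integral>t. ip (u2 t) (wd (wd \<phi>)) * \<psi> t \<partial>Lon 0 T)"
      by (rule jn_ip_tendsto[OF J(3) u2j f(2) ps(1)])
    have split: "(\<integral>t. (ip (p t) \<phi> - ip (q t) (wd (wd \<phi>))) * \<psi> t \<partial>Lon 0 T)
        = (\<integral>t. ip (p t) \<phi> * \<psi> t \<partial>Lon 0 T) - (\<integral>t. ip (q t) (wd (wd \<phi>)) * \<psi> t \<partial>Lon 0 T)"
      if "jmeas T p" "jmeas T q" for p q
      using sqint_mult_integrable[OF jmeas_ip_sqint[OF that(1) f(1)] ps(1)]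
        sqint_mult_integrable[OF jmeas_ip_sqint[OF that(2) f(2)] ps(1)] by (simp add: left_diff_distrib)
    have "(\<integral>t. ip (U n t) \<phi> * deriv \<psi> t \<partial>Lon 0 T)
        = - ((\<integral>t. ip (V n t) \<phi> * \<psi> t \<partial>Lon 0 T) - (\<integral>t. ip (U2 n t) (wd (wd \<phi>)) * \<psi> t \<partial>Lon 0 T))" for n
    proof -
      have "(\<integral>t. ip (U n t) \<phi> * deriv \<psi> t \<partial>Lon 0 T) = - (\<integral>t. Ut n t \<phi> * \<psi> t \<partial>Lon 0 T)"
        using td(1)[of n] \<phi> \<psi> unfolding is_time_deriv_def by blast
      also have "(\<integral>t. Ut n t \<phi> * \<psi> t \<partial>Lon 0 T) = (\<integral>t. (ip (V n t) \<phi> - ip (U2 n t) (wd (wd \<phi>))) * \<psi> t \<partial>Lon 0 T)"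
      proof (rule integral_cong_AE)
        show "(\<lambda>t. Ut n t \<phi> * \<psi> t) \<in> borel_measurable (Lon 0 T)"
          using dual(1)[of n] \<phi> sqint_measurable[OF ps(1)] by (auto simp: L2_dual_def)
        show "(\<lambda>t. (ip (V n t) \<phi> - ip (U2 n t) (wd (wd \<phi>))) * \<psi> t) \<in> borel_measurable (Lon 0 T)"
          using sqint_measurable[OF ps(1)] sqint_measurable[OF jmeas_ip_sqint[OF J(4) f(1)]] sqint_measurable[OF jmeas_ip_sqint[OF J(3) f(2)]]
          by (intro borel_measurable_times borel_measurable_diff)
        show "AE t in Lon 0 T. Ut n t \<phi> * \<psi> t = (ip (V n t) \<phi> - ip (U2 n t) (wd (wd \<phi>))) * \<psi> t"
          using Ut[of n] by eventually_elim (use \<phi> in simp)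
      qed
      finally show ?thesis unfolding split[OF J(4) J(3)] .
    qed
    with l have "(\<lambda>n. - ((\<integral>t. ip (V n t) \<phi> * \<psi> t \<partial>Lon 0 T) - (\<integral>t. ip (U2 n t) (wd (wd \<phi>)) * \<psi> t \<partial>Lon 0 T)))
        \<longlonglongrightarrow> (\<integral>t. ip (u t) \<phi> * deriv \<psi> t \<partial>Lon 0 T)" by simp
    from LIMSEQ_unique[OF this tendsto_minus[OF tendsto_diff[OF r1 r2]]]
    show "(\<integral>t. ip (u t) \<phi> * deriv \<psi> t \<partial>Lon 0 T) = - (\<integral>t. ut t \<phi> * \<psi> t \<partial>Lon 0 T)"
      unfolding ut_def split[OF vj(1) u2j(1)] .
  qed
  \<comment> \<open>The flux is a product of two varying factors: uniform convergence of the
    coefficients and strong convergence of the gradients give its convergence on the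
    cylinder.\<close>
  have DVj: "(\<lambda>n. jn T (\<lambda>t x. D n x * V1 n t x - d x * v1 t x)) \<longlonglongrightarrow> 0"
  proof -
    let ?b = "\<lambda>n t. \<alpha>1 * nrm (\<lambda>x. V1 n t x - v1 t x) + \<delta> n * nrm (v1 t)"
    have sb: "sqint (Lon 0 T) (\<lambda>t. \<alpha>1 * nrm (\<lambda>x. V1 n t x - v1 t x))" "sqint (Lon 0 T) (\<lambda>t. \<delta> n * nrm (v1 t))" for n
      by (intro sqint_cmult jmeas_nrm(1) jmeas_diff J v1j)+
    have lim: "(\<lambda>n. \<bar>\<alpha>1\<bar> * jn T (\<lambda>t x. V1 n t x - v1 t x) + \<delta> n * jn T v1) \<longlonglongrightarrow> \<bar>\<alpha>1\<bar> * 0 + 0 * jn T v1"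
      by (intro tendsto_intros v1j \<delta>0)
    have "jn T (\<lambda>t x. D n x * V1 n t x - d x * v1 t x) \<le> \<bar>\<alpha>1\<bar> * jn T (\<lambda>t x. V1 n t x - v1 t x) + \<delta> n * jn T v1" for n
    proof -
      have Jd: "jmeas T (\<lambda>t x. D n x * V1 n t x - d x * v1 t x)"
        by (intro jmeas_diff coef_mult_jmeas[OF D] J dv1)
      have "jn T (\<lambda>t x. D n x * V1 n t x - d x * v1 t x) = l2n (Lon 0 T) (\<lambda>t. nrm (\<lambda>x. D n x * V1 n t x - d x * v1 t x))"
        using jmeas_nrm(2)[OF Jd] by simp
      also have "\<dots> \<le> l2n (Lon 0 T) (?b n)"
      proof (rule l2n_mono[OF sqint_add[OF sb]])
        show "(\<lambda>t. nrm (\<lambda>x. D n x * V1 n t x - d x * v1 t x)) \<in> borel_measurable (Lon 0 T)"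
          by (rule sqint_measurable[OF jmeas_nrm(1)[OF Jd]])
        show "AE t in Lon 0 T. \<bar>nrm (\<lambda>x. D n x * V1 n t x - d x * v1 t x)\<bar> \<le> \<bar>?b n t\<bar>"
          using jmeas_section[OF J(5)[of n]] jmeas_section[OF v1j(1)]
        proof eventually_elim
          case (elim t)
          show ?case using dvd[OF elim] by simp
        qed
      qed
      also have "\<dots> \<le> l2n (Lon 0 T) (\<lambda>t. \<alpha>1 * nrm (\<lambda>x. V1 n t x - v1 t x)) + l2n (Lon 0 T) (\<lambda>t. \<delta> n * nrm (v1 t))"
        by (rule l2n_triangle[OF sb])
      also have "\<dots> = \<bar>\<alpha>1\<bar> * jn T (\<lambda>t x. V1 n t x - v1 t x) + \<delta> n * jn T v1"
        unfolding l2n_cmult jmeas_nrm(2)[OF jmeas_diff[OF J(5) v1j(1)]] jmeas_nrm(2)[OF v1j(1)] using \<delta>(2) by simp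
      finally show ?thesis .
    qed
    then show ?thesis
      by (intro tendsto_sandwich[OF _ _ tendsto_const lim[simplified]]) auto
  qed
  have tdV: "is_time_deriv T H01 v vt"
    unfolding is_time_deriv_def
  proof (intro allI impI)
    fix \<phi> \<psi> assume "H01 \<phi> \<and> test_fun 0 T \<psi>"
    then have \<phi>: "H01 \<phi>" and \<psi>: "test_fun 0 T \<psi>" by auto
    note f = H01p_D(1,2)[OF H01_H01p[OF \<phi>]]
    note ps = tsq[OF \<psi>]
    have l: "(\<lambda>n. \<integral>t. ip (V n t) \<phi> * deriv \<psi> t \<partial>Lon 0 T) \<longlonglongrightarrow> (\<integral>t. ip (v t) \<phi> * deriv \<psi> t \<partial>Lon 0 T)"
      by (rule jn_ip_tendsto[OF J(4) vj f(1) ps(2)])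
    have r1: "(\<lambda>n. \<integral>t. ip (\<lambda>x. D n x * V1 n t x) (wd \<phi>) * \<psi> t \<partial>Lon 0 T) \<longlonglongrightarrow> (\<integral>t. ip (\<lambda>x. d x * v1 t x) (wd \<phi>) * \<psi> t \<partial>Lon 0 T)"
      by (rule jn_ip_tendsto[where U = "\<lambda>n t x. D n x * V1 n t x", OF coef_mult_jmeas[OF D J(5)] dv1 DVj f(2) ps(1)])
    have "(\<integral>t. ip (V n t) \<phi> * deriv \<psi> t \<partial>Lon 0 T) = (\<integral>t. ip (\<lambda>x. D n x * V1 n t x) (wd \<phi>) * \<psi> t \<partial>Lon 0 T)" for n
    proof -
      have "(\<integral>t. ip (V n t) \<phi> * deriv \<psi> t \<partial>Lon 0 T) = - (\<integral>t. Vt n t \<phi> * \<psi> t \<partial>Lon 0 T)"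
        using td(2)[of n] \<phi> \<psi> unfolding is_time_deriv_def by blast
      also have "(\<integral>t. Vt n t \<phi> * \<psi> t \<partial>Lon 0 T) = (\<integral>t. - (ip (\<lambda>x. D n x * V1 n t x) (wd \<phi>) * \<psi> t) \<partial>Lon 0 T)"
      proof (rule integral_cong_AE)
        show "(\<lambda>t. Vt n t \<phi> * \<psi> t) \<in> borel_measurable (Lon 0 T)"
          using dual(2)[of n] \<phi> sqint_measurable[OF ps(1)] by (auto simp: L2_dual_def)
        show "(\<lambda>t. - (ip (\<lambda>x. D n x * V1 n t x) (wd \<phi>) * \<psi> t)) \<in> borel_measurable (Lon 0 T)"
          using sqint_measurable[OF ps(1)] sqint_measurable[OF jmeas_ip_sqint[OF coef_mult_jmeas[OF D J(5)] f(2)]]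
          by (intro borel_measurable_times borel_measurable_uminus)
        show "AE t in Lon 0 T. Vt n t \<phi> * \<psi> t = - (ip (\<lambda>x. D n x * V1 n t x) (wd \<phi>) * \<psi> t)"
          using Vt[of n] by eventually_elim (use \<phi> in simp)
      qed
      finally show ?thesis by simp
    qed
    with l have "(\<lambda>n. \<integral>t. ip (\<lambda>x. D n x * V1 n t x) (wd \<phi>) * \<psi> t \<partial>Lon 0 T)
        \<longlonglongrightarrow> (\<integral>t. ip (v t) \<phi> * deriv \<psi> t \<partial>Lon 0 T)" by simp
    from LIMSEQ_unique[OF this r1]
    show "(\<integral>t. ip (v t) \<phi> * deriv \<psi> t \<partial>Lon 0 T) = - (\<integral>t. vt t \<phi> * \<psi> t \<partial>Lon 0 T)"
      by (simp add: vt_def)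
  qed
  have eqn: "AE t in Lon 0 T. \<forall>\<phi>. V02 \<phi> \<longrightarrow> ut t \<phi> + ip (wd (wd (u t))) (wd (wd \<phi>)) = ip (v t) \<phi>
        \<and> vt t \<phi> + ip (\<lambda>x. d x * wd (v t) x) (wd \<phi>) = 0"
    using Hu Hv secL
  proof eventually_elim
    case (elim t)
    note p = H01p_D[of "u t" "u1 t"] and q = H01p_D[of "v t" "v1 t"]
    have w: "L2 (wd (wd (u t)))" "AE x in Lon 0 1. wd (wd (u t)) x = u2 t x"
      using wd_wd_weak_deriv[of "u t" "u1 t" "u2 t"] p elim by auto
    have w': "L2 (wd (v t))" "AE x in Lon 0 1. wd (v t) x = v1 t x"
      using wd_weak_deriv[of "v1 t" "v t"] q elim by auto
    show ?case
    proof (intro allI impI)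
      fix \<phi> assume \<phi>: "V02 \<phi>"
      note f = V02_facts[OF \<phi>]
      have "ip (wd (wd (u t))) (wd (wd \<phi>)) = ip (u2 t) (wd (wd \<phi>))"
        by (rule ip_cong_AE[OF L2_measurable[OF w(1)] _ L2_measurable[OF f(2)] L2_measurable[OF f(2)] w(2)])
           (use elim L2_measurable in auto)
      moreover have "AE x in Lon 0 1. d x * wd (v t) x = d x * v1 t x" using w'(2) by eventually_elim simp
      then have "ip (\<lambda>x. d x * wd (v t) x) (wd \<phi>) = ip (\<lambda>x. d x * v1 t x) (wd \<phi>)"
        by (intro ip_cong_AE L2_measurable coef_mult_L2[OF d] w'(1) H01p_D(2)[OF f(1)]) (use elim in auto)
      ultimately show "ut t \<phi> + ip (wd (wd (u t))) (wd (wd \<phi>)) = ip (v t) \<phi>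
        \<and> vt t \<phi> + ip (\<lambda>x. d x * wd (v t) x) (wd \<phi>) = 0" by (simp add: ut_def vt_def)
    qed
  qed
  have zero: "(\<lambda>n. nrm (\<lambda>x. W n x - w0 x)) \<longlonglongrightarrow> 0" if "\<And>n. AE x in Lon 0 1. W n x = w0 x" "\<And>n. L2 (W n)" "L2 w0" for W w0
  proof -
    have "nrm (\<lambda>x. W n x - w0 x) = 0" for n
    proof -
      have "nrm (\<lambda>x. W n x - w0 x) = nrm (\<lambda>x. 0)"
        by (rule l2n_cong_AE[OF L2_measurable[OF L2_diff[OF that(2,3)]]]) (use that(1)[of n] in \<open>auto elim: eventually_mono\<close>)
      then show ?thesis by (simp add: l2n_def)
    qed
    then show ?thesis by simp
  qed
  have i1: "AE x in Lon 0 1. u 0 x = u0 x"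
    by (rule l2n_limit_unique[OF _ _ _ limu[OF T0(1)] zero[OF init(1) _ u0]])
       (use cont_L2_D(1)[OF C(1) T0(1)] su(1)[OF T0(1)] u0 in \<open>auto simp: L2_iff_sqint\<close>)
  have i2: "AE x in Lon 0 1. v 0 x = v0 x"
    by (rule l2n_limit_unique[OF _ _ _ limv[OF T0(1)] zero[OF init(2) _ v0]])
       (use cont_L2_D(1)[OF C(2) T0(1)] sv(1)[OF T0(1)] v0 in \<open>auto simp: L2_iff_sqint\<close>)
  have "weak_sol T u0 v0 d u v"
    unfolding weak_sol_def Omega_def
    using A B cu cv dualU dualV tdU tdV eqn i1 i2 by blast
  then show thesis using that limu[OF T0(2)] limv[OF T0(2)] by blast
qed

section \<open>Weak compactness of the admissible set\<close>

text \<open>Mazur's trick: midpoint-convex combinations of the tail with almost minimal norm form a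
  Cauchy sequence by the parallelogram law, which replaces weak sequential compactness.\<close>

inductive midconv :: "(nat \<Rightarrow> real \<Rightarrow> real) \<Rightarrow> (nat \<Rightarrow> real \<Rightarrow> real) \<Rightarrow> nat \<Rightarrow> (real \<Rightarrow> real) \<Rightarrow> (real \<Rightarrow> real) \<Rightarrow> bool"
  for F G n where
  tail: "n \<le> k \<Longrightarrow> midconv F G n (F k) (G k)"
| mid: "midconv F G n p q \<Longrightarrow> midconv F G n p' q' \<Longrightarrow>
    midconv F G n (\<lambda>x. 1/2 * p x + 1/2 * p' x) (\<lambda>x. 1/2 * q x + 1/2 * q' x)"

lemma midconv_mono: "midconv F G m p q \<Longrightarrow> n \<le> m \<Longrightarrow> midconv F G n p q"
proof (induction rule: midconv.induct)
  case (mid p q p' q')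
  then show ?case by (intro midconv.mid)
qed (auto intro: midconv.tail)

lemma parallelogram:
  assumes "L2 f" "L2 g"
  shows "(nrm (\<lambda>x. f x - g x))\<^sup>2 = 2 * (nrm f)\<^sup>2 + 2 * (nrm g)\<^sup>2 - 4 * (nrm (\<lambda>x. 1/2 * f x + 1/2 * g x))\<^sup>2"
proof -
  note S = assms[unfolded L2_iff_sqint]
  have "(nrm (\<lambda>x. 1/2 * f x + 1/2 * g x))\<^sup>2 = (nrm (\<lambda>x. 1/2 * (f x + g x)))\<^sup>2" by (simp add: distrib_left)
  also have "\<dots> = 1/4 * (nrm (\<lambda>x. f x + g x))\<^sup>2" unfolding l2n_cmult by (simp add: power_mult_distrib power2_eq_square)
  finally show ?thesis
    using l2n_add_sq[OF S] l2n_add_sq[OF S(1) sqint_minus[OF S(2)]] by (simp add: l2n_minus)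
qed

lemma midconv_facts:
  assumes "midconv F G n p q"
    and L: "\<And>k. L2 (F k)" "\<And>k. L2 (G k)" and w: "\<And>k. has_weak_deriv (F k) (G k)"
    and f: "L2 f" and b: "\<And>k. n \<le> k \<Longrightarrow> nrm (\<lambda>x. F k x - f x) \<le> e"
  shows "L2 p \<and> L2 q \<and> has_weak_deriv p q \<and> nrm (\<lambda>x. p x - f x) \<le> e"
  using assms(1)
proof (induction rule: midconv.induct)
  case (mid p q p' q')
  then have L': "L2 p" "L2 q" "L2 p'" "L2 q'" by auto
  have "nrm (\<lambda>x. 1/2 * p x + 1/2 * p' x - f x) = nrm (\<lambda>x. 1/2 * (p x - f x) + 1/2 * (p' x - f x))"
  proof -
    have "1/2 * p x + 1/2 * p' x - f x = 1/2 * (p x - f x) + 1/2 * (p' x - f x)" for x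
      by (simp add: field_simps)
    then show ?thesis by (simp only:)
  qed
  also have "\<dots> \<le> nrm (\<lambda>x. 1/2 * (p x - f x)) + nrm (\<lambda>x. 1/2 * (p' x - f x))"
    using L2_cmult[OF L2_diff[OF L'(1) f], of "1/2"] L2_cmult[OF L2_diff[OF L'(3) f], of "1/2"]
    by (intro l2n_triangle) (auto simp: L2_iff_sqint)
  also have "\<dots> \<le> e" unfolding l2n_cmult using mid.IH by simp
  finally have 1: "nrm (\<lambda>x. 1/2 * p x + 1/2 * p' x - f x) \<le> e" .
  have 2: "has_weak_deriv (\<lambda>x. 1/2 * p x + 1/2 * p' x) (\<lambda>x. 1/2 * q x + 1/2 * q' x)"
    using mid.IH by (intro has_weak_deriv_linear) auto
  show ?case by (intro conjI L2_add L2_cmult L' 1 2)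
qed (use L w b in auto)

text \<open>The infimum \<open>s n\<close> of the squared norms over the n-th tail increases with n
  and is at most \<open>h\<close>, so near-minimal elements approach each other. The functions keep
  converging to \<open>f\<close>, since balls around \<open>f\<close> are convex.\<close>

lemma weak_deriv_lsc:
  assumes L: "\<And>k. L2 (F k)" "\<And>k. L2 (G k)" and w: "\<And>k. has_weak_deriv (F k) (G k)"
    and f: "L2 f" and lim: "(\<lambda>k. nrm (\<lambda>x. F k x - f x)) \<longlonglongrightarrow> 0"
    and h: "(\<lambda>k. (nrm (G k))\<^sup>2) \<longlonglongrightarrow> h"
  obtains g where "L2 g" "has_weak_deriv f g" "(nrm g)\<^sup>2 \<le> h"
proof -
  define S where "S n = {(nrm q)\<^sup>2 | p q. midconv F G n p q}" for n
  define s where "s n = Inf (S n)" for n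
  have bdd: "bdd_below (S n)" for n unfolding S_def by (rule bdd_belowI[of _ 0]) auto
  have tailS: "(nrm (G k))\<^sup>2 \<in> S n" if "n \<le> k" for n k unfolding S_def using midconv.tail[OF that] by blast
  have ne: "S n \<noteq> {}" for n using tailS[OF order_refl] by auto
  have le: "s n \<le> (nrm q)\<^sup>2" if "midconv F G n p q" for n p q
    unfolding s_def by (rule cInf_lower[OF _ bdd]) (use that in \<open>auto simp: S_def\<close>)
  have mono: "s n \<le> s m" if "n \<le> m" for n m
    unfolding s_def by (rule cInf_superset_mono[OF ne bdd]) (unfold S_def, use midconv_mono[OF _ that] in blast)
  have sh: "s n \<le> h" for n
    by (rule LIMSEQ_le_const[OF h]) (intro exI[of _ n] allI impI le[OF midconv.tail])
  have "incseq s" using mono by (simp add: incseq_def)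
  then obtain s' where s': "s \<longlonglongrightarrow> s'" using incseq_convergent[of s h] sh by blast
  have s'h: "s' \<le> h" by (rule LIMSEQ_le_const2[OF s']) (use sh in auto)
  have "\<exists>p q. midconv F G n p q \<and> (nrm q)\<^sup>2 < s n + inverse (real (Suc n))" for n
  proof -
    have "\<exists>y\<in>S n. y < s n + inverse (real (Suc n))"
      by (rule cInf_lessD[OF ne]) (simp add: s_def)
    then show ?thesis by (auto simp: S_def)
  qed
  then obtain P Q where PQ: "\<And>n. midconv F G n (P n) (Q n)" "\<And>n. (nrm (Q n))\<^sup>2 < s n + inverse (real (Suc n))"
    by metis
  have fac: "L2 (P n) \<and> L2 (Q n) \<and> has_weak_deriv (P n) (Q n) \<and> nrm (\<lambda>x. P n x - f x) \<le> e"
    if "\<And>k. n \<le> k \<Longrightarrow> nrm (\<lambda>x. F k x - f x) \<le> e" for n e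
    by (rule midconv_facts[OF PQ(1) L w f that])
  have "Bseq (\<lambda>k. nrm (\<lambda>x. F k x - f x))"
    by (rule convergent_imp_Bseq, rule convergentI, rule lim)
  then obtain B where B: "\<And>k. nrm (\<lambda>x. F k x - f x) \<le> B" unfolding Bseq_def by auto
  have LP: "L2 (P n)" "L2 (Q n)" "has_weak_deriv (P n) (Q n)" for n using fac[of n B] B by auto
  have limP: "(\<lambda>n. nrm (\<lambda>x. P n x - f x)) \<longlonglongrightarrow> 0"
  proof (rule LIMSEQ_I)
    fix e :: real assume "e > 0"
    then obtain N where N: "\<And>k. k \<ge> N \<Longrightarrow> nrm (\<lambda>x. F k x - f x) < e / 2"
      using LIMSEQ_D[OF lim, of "e / 2"] by auto
    have "nrm (\<lambda>x. P n x - f x) \<le> e / 2" if "n \<ge> N" for n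
      using fac[of n "e / 2"] N that by (meson less_imp_le order_trans)
    then show "\<exists>no. \<forall>n\<ge>no. norm (nrm (\<lambda>x. P n x - f x) - 0) < e"
      using \<open>e > 0\<close> by (intro exI[of _ N]) fastforce
  qed
  have par: "(nrm (\<lambda>x. Q n x - Q m x))\<^sup>2 \<le> 2 * (s m - s n) + 2 * inverse (real (Suc n)) + 2 * inverse (real (Suc m))"
    if "n \<le> m" for n m
  proof -
    \<comment> \<open>The midpoint belongs to the n-th tail because m is at least n; its norm,
      bounded below by the infimum, is the term subtracted in the parallelogram law.\<close>
    have "s n \<le> (nrm (\<lambda>x. 1/2 * Q n x + 1/2 * Q m x))\<^sup>2"
      by (rule le[OF midconv.mid[OF PQ(1) midconv_mono[OF PQ(1) that]]])
    then show ?thesis unfolding parallelogram[OF LP(2) LP(2)] using PQ(2)[of n] PQ(2)[of m] by argo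
  qed
  obtain g where g: "sqint (Lon 0 1) g" "(\<lambda>n. nrm (\<lambda>x. Q n x - g x)) \<longlonglongrightarrow> 0"
  proof (rule riesz_fischer[of "Lon 0 1" Q])
    show "sqint (Lon 0 1) (Q n)" for n using LP(2) by (simp add: L2_iff_sqint)
    fix e :: real assume "e > 0"
    \<comment> \<open>With thresholds e^2/8 the three terms of \<open>par\<close> stay below e^2/2,
      e^2/4 and e^2/4.\<close>
    have "e\<^sup>2 / 8 > 0" using \<open>e > 0\<close> by simp
    note q = this
    obtain N1 where "\<forall>n\<ge>N1. norm (s n - s') < e\<^sup>2 / 8" using LIMSEQ_D[OF s' q] by blast
    then have N1: "\<bar>s n - s'\<bar> < e\<^sup>2 / 8" if "n \<ge> N1" for n using that by simp
    obtain N2 where "\<forall>n\<ge>N2. norm (inverse (real (Suc n)) - 0) < e\<^sup>2 / 8"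
      using LIMSEQ_D[OF LIMSEQ_inverse_real_of_nat q] by blast
    then have N2: "inverse (real (Suc n)) < e\<^sup>2 / 8" if "n \<ge> N2" for n using that by fastforce
    have half: "nrm (\<lambda>x. Q n x - Q m x) < e" if "n \<ge> max N1 N2" "n \<le> m" for n m
    proof (rule power2_less_imp_less)
      show "(nrm (\<lambda>x. Q n x - Q m x))\<^sup>2 < e\<^sup>2"
      proof -
        have "n \<ge> N1" "n \<ge> N2" "m \<ge> N1" "m \<ge> N2" using that by auto
        from N1[OF this(1)] N1[OF this(3)] N2[OF this(2)] N2[OF this(4)] par[OF that(2)]
        show ?thesis by argo
      qed
    qed (use \<open>e > 0\<close> in simp)
    have "nrm (\<lambda>x. Q m x - Q n x) < e" if "m \<ge> max N1 N2" "n \<ge> max N1 N2" for m n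
      using half[of n m] half[of m n] that l2n_minus_commute[of "Lon 0 1" "Q m" "Q n"] by (cases "n \<le> m") auto
    then show "\<exists>N. \<forall>m\<ge>N. \<forall>n\<ge>N. nrm (\<lambda>x. Q m x - Q n x) < e" by blast
  qed blast
  have Lg: "L2 g" using g(1) by (simp add: L2_iff_sqint)
  have "(\<lambda>n. nrm (Q n)) \<longlonglongrightarrow> nrm g"
    by (rule l2n_tendsto[OF _ g]) (use LP(2) in \<open>simp add: L2_iff_sqint\<close>)
  then have "(\<lambda>n. (nrm (Q n))\<^sup>2) \<longlonglongrightarrow> (nrm g)\<^sup>2" by (rule tendsto_power)
  moreover have "(\<lambda>n. s n + inverse (real (Suc n))) \<longlonglongrightarrow> s' + 0"
    by (intro tendsto_add s' LIMSEQ_inverse_real_of_nat)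
  ultimately have "(nrm g)\<^sup>2 \<le> s' + 0" by (rule LIMSEQ_le) (use PQ(2) less_imp_le in blast)
  then have "(nrm g)\<^sup>2 \<le> h" using s'h by simp
  moreover have "has_weak_deriv f g" by (rule weak_deriv_limit[OF LP(1) LP(2) f Lg LP(3) limP g(2)])
  ultimately show thesis using that Lg by blast
qed

section \<open>Equicontinuity and the Arzela-Ascoli theorem\<close>

text \<open>Cauchy-Schwarz with the indicator of (x, y), whose norm is the square root of y - x. An
  H1 bound thus yields a common Hoelder modulus.\<close>

lemma prim_hoelder:
  assumes g: "L2 g" and xy: "0 \<le> x" "x \<le> y" "y \<le> 1"
  shows "\<bar>integral\<^sup>L (Lon 0 y) g - integral\<^sup>L (Lon 0 x) g\<bar> \<le> sqrt (y - x) * nrm g"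
proof -
  let ?I = "\<lambda>s. if x < s \<and> s < y then 1 else (0::real)"
  have I: "L2 ?I" by (rule L2_bounded[of _ 1]) auto
  have "integral\<^sup>L (Lon 0 y) g = integral\<^sup>L (Lon 0 x) g + integral\<^sup>L (Lon x y) g"
    by (rule Lint_split[OF integrable_Lon_sub[OF L2_integrable[OF g]]]) (use xy in auto)
  then have "integral\<^sup>L (Lon 0 y) g - integral\<^sup>L (Lon 0 x) g = ip ?I g"
    unfolding ip_Lon using Lint_sub[of 0 x y 1 g] xy by (simp add: if_distribR if_distrib cong: if_cong)
  moreover have "\<bar>ip ?I g\<bar> \<le> nrm ?I * nrm g" by (rule ip_CS[OF I g])
  moreover have "nrm ?I = sqrt (y - x)"
  proof -
    have "(\<integral>s. (?I s)\<^sup>2 \<partial>Lon 0 1) = (\<integral>s. (if x < s \<and> s < y then (\<lambda>_. 1) s else 0) \<partial>Lon 0 1)"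
      by (rule Bochner_Integration.integral_cong) auto
    also have "\<dots> = integral\<^sup>L (Lon x y) (\<lambda>_. 1::real)" by (rule Lint_sub) (use xy in auto)
    also have "\<dots> = y - x" using xy by (simp add: measure_restrict_space)
    finally show ?thesis by (simp add: l2n_def)
  qed
  ultimately show ?thesis by simp
qed

lemma Dset_coef:
  assumes "d \<in> Dset \<alpha>0 \<alpha>1 \<alpha>2" "0 < \<alpha>0"
  shows "coef \<alpha>0 \<alpha>1 d"
proof -
  have "H1 d" and b: "\<And>x. x \<in> {0<..<1} \<Longrightarrow> \<alpha>0 \<le> d x \<and> d x \<le> \<alpha>1"
    using assms(1) by (auto simp: Dset_def Omega_def)
  then have "d \<in> borel_measurable (Lon 0 1)" by (intro L2_measurable H1_wd(1))
  moreover have "AE x in Lon 0 1. \<alpha>0 \<le> d x \<and> d x \<le> \<alpha>1" by (rule AE_I2) (use b in simp)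
  ultimately show ?thesis using assms(2) by (simp add: coef_def)
qed

text \<open>\<open>r\<close> agrees almost everywhere with its truncation to the range from
  \<open>\<alpha>\<close> to \<open>\<beta>\<close>. Both are continuous, so they agree everywhere,
  the end points included.\<close>

lemma continuous_AE_bounds:
  assumes c: "continuous_on {0..1} r" and b: "AE x in Lon 0 1. \<alpha> \<le> r x \<and> r x \<le> \<beta>" and x: "x \<in> {0..1}"
  shows "\<alpha> \<le> r x \<and> r x \<le> (\<beta>::real)"
proof -
  have "r x = min \<beta> (max \<alpha> (r x))"
    by (rule continuous_AE_eq[OF c _ _ _ x])
       (use b in \<open>auto intro!: continuous_intros c elim: eventually_mono\<close>)
  moreover have "\<alpha> \<le> \<beta>"
  proof -
    have ae: "AE x in Lon 0 1. \<alpha> \<le> \<beta>" using b by (auto elim: eventually_mono)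
    have "ae_filter (Lon 0 1) \<noteq> bot" by (simp add: ae_filter_eq_bot_iff emeasure_restrict_space)
    from iffD1[OF eventually_const[OF this] ae] show ?thesis .
  qed
  ultimately show ?thesis by linarith
qed

text \<open>A member of \<open>Dset\<close> may be altered on null sets within its bounds, so the
  Hoelder modulus belongs to the representative built from the primitive of its derivative.\<close>

lemma Dset_continuous_rep:
  assumes d: "d \<in> Dset \<alpha>0 \<alpha>1 \<alpha>2"
  obtains r where "continuous_on {0..1} r" "AE x in Lon 0 1. d x = r x"
    "\<And>x. x \<in> {0..1} \<Longrightarrow> \<alpha>0 \<le> r x \<and> r x \<le> \<alpha>1"
    "\<And>x y. x \<in> {0..1} \<Longrightarrow> y \<in> {0..1} \<Longrightarrow> \<bar>r x - r y\<bar> \<le> sqrt \<bar>x - y\<bar> * \<alpha>2"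
proof -
  have H: "H1 d" and n: "H1_norm d \<le> \<alpha>2" and b: "\<And>x. x \<in> {0<..<1} \<Longrightarrow> \<alpha>0 \<le> d x \<and> d x \<le> \<alpha>1"
    using d by (auto simp: Dset_def Omega_def)
  note w = H1_wd[OF H]
  obtain C where C: "AE x in Lon 0 1. d x = C + integral\<^sup>L (Lon 0 x) (wd d)"
    using weak_deriv_prim[OF w] .
  let ?r = "\<lambda>x. C + integral\<^sup>L (Lon 0 x) (wd d)"
  have c: "continuous_on {0..1} ?r" by (rule L2_prim_continuous[OF w(2)])
  have "AE x in Lon 0 1. \<alpha>0 \<le> ?r x \<and> ?r x \<le> \<alpha>1"
    using C AE_space by eventually_elim (use b in force)
  note bnd = continuous_AE_bounds[OF c this]
  have ho: "\<bar>?r y - ?r x\<bar> \<le> sqrt (y - x) * \<alpha>2" if "0 \<le> x" "x \<le> y" "y \<le> 1" for x y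
  proof -
    have "\<bar>?r y - ?r x\<bar> \<le> sqrt (y - x) * nrm (wd d)" using prim_hoelder[OF w(2) that] by simp
    also have "\<dots> \<le> sqrt (y - x) * \<alpha>2"
      using nrm_le_H1_norm(2)[of d] n that by (intro mult_left_mono) auto
    finally show ?thesis .
  qed
  have "\<bar>?r x - ?r y\<bar> \<le> sqrt \<bar>x - y\<bar> * \<alpha>2" if "x \<in> {0..1}" "y \<in> {0..1}" for x y
    using ho[of x y] ho[of y x] that by (cases "x \<le> y") (auto simp: abs_minus_commute)
  then show thesis using that c C bnd by blast
qed

text \<open>Arzela-Ascoli for the continuous representatives. A second extraction makes the
  distances geometric, hence summable as \<open>weak_sol_limit\<close> requires.\<close>

lemma Dset_compact:
  assumes d: "\<And>n. D n \<in> Dset \<alpha>0 \<alpha>1 \<alpha>2" and a: "0 < \<alpha>0" "0 < \<alpha>2"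
  obtains g \<rho> where "continuous_on {0..1} g" "\<And>x. x \<in> {0..1} \<Longrightarrow> \<alpha>0 \<le> g x \<and> g x \<le> \<alpha>1" "strict_mono (\<rho> :: nat \<Rightarrow> nat)"
    "\<And>n. AE x in Lon 0 1. \<bar>D (\<rho> n) x - g x\<bar> \<le> (1/2) ^ n"
proof -
  define P where "P n r \<longleftrightarrow> continuous_on {0..1} r \<and> (AE x in Lon 0 1. D n x = r x) \<and>
    (\<forall>x\<in>{0..1}. \<alpha>0 \<le> r x \<and> r x \<le> \<alpha>1) \<and> (\<forall>x\<in>{0..1}. \<forall>y\<in>{0..1}. \<bar>r x - r y\<bar> \<le> sqrt \<bar>x - y\<bar> * \<alpha>2)" for n r
  have "\<exists>r. P n r" for n
    unfolding P_def by (rule Dset_continuous_rep[OF d[of n]]) blast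
  then obtain R where P: "\<And>n. P n (R n)" by metis
  have R: "continuous_on {0..1} (R n)" "AE x in Lon 0 1. D n x = R n x"
    "x \<in> {0..1} \<Longrightarrow> \<alpha>0 \<le> R n x \<and> R n x \<le> \<alpha>1"
    "x \<in> {0..1} \<Longrightarrow> y \<in> {0..1} \<Longrightarrow> \<bar>R n x - R n y\<bar> \<le> sqrt \<bar>x - y\<bar> * \<alpha>2" for n x y
    using P[of n] unfolding P_def by blast+
  obtain g k where g: "continuous_on {0..1} g" "strict_mono (k :: nat \<Rightarrow> nat)"
    "\<And>e. 0 < e \<Longrightarrow> \<exists>N. \<forall>n x. n \<ge> N \<and> x \<in> {0..1} \<longrightarrow> norm (R (k n) x - g x) < e"
  proof (rule Arzela_Ascoli[of "{0..1::real}" R "\<alpha>1"])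
    show "norm (R n x) \<le> \<alpha>1" if "x \<in> {0..1}" for n x using R(3)[OF that, of n] a by simp
    fix x e :: real assume x: "x \<in> {0..1}" and "0 < e"
    \<comment> \<open>The radius inverts the Hoelder modulus
      \<open>sqrt \<bar>x - y\<bar> * \<alpha>2\<close>.\<close>
    have "\<bar>R n x - R n y\<bar> < e" if y: "y \<in> {0..1}" "\<bar>x - y\<bar> < (e / \<alpha>2)\<^sup>2" for n y
    proof -
      have "sqrt \<bar>x - y\<bar> < e / \<alpha>2" using y(2) \<open>0 < e\<close> a by (intro real_less_lsqrt) auto
      then have "sqrt \<bar>x - y\<bar> * \<alpha>2 < e" using a by (simp add: pos_less_divide_eq)
      then show ?thesis using R(4)[OF x y(1), of n] by linarith
    qed
    then show "\<exists>d. 0 < d \<and> (\<forall>n y. y \<in> {0..1} \<and> norm (x - y) < d \<longrightarrow> norm (R n x - R n y) < e)"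
      using \<open>0 < e\<close> a by (intro exI[of _ "(e / \<alpha>2)\<^sup>2"]) auto
  qed (use that in auto)
  have "\<forall>n. \<exists>N. \<forall>m\<ge>N. \<forall>x\<in>{0..1}. \<bar>R (k m) x - g x\<bar> < (1/2) ^ n"
  proof
    fix n
    show "\<exists>N. \<forall>m\<ge>N. \<forall>x\<in>{0..1}. \<bar>R (k m) x - g x\<bar> < (1/2) ^ n"
      using g(3)[of "(1/2) ^ n"] unfolding real_norm_def by (simp del: atLeastAtMost_iff) blast
  qed
  from choice[OF this] obtain M where
    M: "\<And>n m x. m \<ge> M n \<Longrightarrow> x \<in> {0..1} \<Longrightarrow> \<bar>R (k m) x - g x\<bar> < (1/2) ^ n" by blast
  \<comment> \<open>Summing the thresholds, each raised by one, makes the indices strictly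
    increasing while the n-th still exceeds \<open>M n\<close>.\<close>
  define j where "j n = (\<Sum>i\<le>n. Suc (M i))" for n
  have j: "strict_mono j" by (rule strict_monoI_Suc) (simp add: j_def)
  have Mj: "M n \<le> j n" for n
  proof -
    have "Suc (M n) \<le> j n" unfolding j_def by (rule member_le_sum) auto
    then show ?thesis by simp
  qed
  have lim: "(\<lambda>n. R (k n) x) \<longlonglongrightarrow> g x" if "x \<in> {0..1}" for x
    by (rule LIMSEQ_I) (use g(3) that in blast)
  show thesis
  proof (rule that[OF g(1), of "k \<circ> j"])
    show "\<alpha>0 \<le> g x \<and> g x \<le> \<alpha>1" if "x \<in> {0..1}" for x
      using LIMSEQ_le_const[OF lim[OF that], of \<alpha>0] LIMSEQ_le_const2[OF lim[OF that], of \<alpha>1] R(3)[OF that] by blast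
    show "strict_mono (k \<circ> j)" using g(2) j by (rule strict_mono_o)
    show "AE x in Lon 0 1. \<bar>D ((k \<circ> j) n) x - g x\<bar> \<le> (1/2) ^ n" for n
      using R(2)[of "k (j n)"] AE_space
    proof eventually_elim
      case (elim x)
      then show ?case using M[OF Mj, of x n] by auto
    qed
  qed
qed

section \<open>Existence of a minimiser\<close>

definition Jval :: "real \<Rightarrow> (real \<Rightarrow> real) \<Rightarrow> (real \<Rightarrow> real) \<Rightarrow> real \<Rightarrow> (real \<Rightarrow> real) \<Rightarrow>
    (real \<Rightarrow> real \<Rightarrow> real) \<Rightarrow> (real \<Rightarrow> real \<Rightarrow> real) \<Rightarrow> real" where
  "Jval T m1 m2 \<gamma> d u v = 1/2 * (nrm (\<lambda>x. u T x - m1 x))\<^sup>2 + 1/2 * (nrm (\<lambda>x. v T x - m2 x))\<^sup>2 + \<gamma>/2 * (H1_norm d)\<^sup>2"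

lemma Jgam_Jval: "Jgam T u0 v0 m1 m2 \<gamma> d = (THE j. \<exists>u v. weak_sol T u0 v0 d u v \<and> j = Jval T m1 m2 \<gamma> d u v)"
  by (simp add: Jgam_def Jval_def l2n_sq Omega_def)

text \<open>Stability with equal coefficients and \<delta> = 0 makes all differences vanish at time
  \<open>T\<close>.\<close>

lemma Jval_unique:
  assumes "T > 0" "coef \<alpha>0 \<alpha>1 d" "weak_sol T u0 v0 d u v" "weak_sol T u0 v0 d u' v'" "L2 m1" "L2 m2"
  shows "Jval T m1 m2 \<gamma> d u v = Jval T m1 m2 \<gamma> d u' v'"
proof -
  obtain u1 u2 v1 where r: "rsol T d u v u1 u2 v1" by (rule weak_sol_unfold[OF assms(1-3)])
  obtain u1' u2' v1' where r': "rsol T d u' v' u1' u2' v1'" by (rule weak_sol_unfold[OF assms(1,2,4)])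
  have "AE x in Lon 0 1. u 0 x = u0 x" "AE x in Lon 0 1. u' 0 x = u0 x"
    "AE x in Lon 0 1. v 0 x = v0 x" "AE x in Lon 0 1. v' 0 x = v0 x"
    using assms(3,4) unfolding weak_sol_def Omega_def by blast+
  then have i: "AE x in Lon 0 1. u 0 x = u' 0 x" "AE x in Lon 0 1. v 0 x = v' 0 x"
    by (eventually_elim, simp)+
  have T: "T \<in> {0..T}" using \<open>T > 0\<close> by simp
  have z: "AE x in Lon 0 1. \<bar>d x - d x\<bar> \<le> 0" by simp
  note st = stability[OF assms(1,2,2) z order_refl r r' i]
  have L: "L2 (u T)" "L2 (v T)" "L2 (u' T)" "L2 (v' T)"
    using assms(3,4) T cont_L2_D(1) unfolding weak_sol_def by blast+
  have "nrm (\<lambda>x. u T x - u' T x) = 0" "nrm (\<lambda>x. v T x - v' T x) = 0"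
    using st(1)[OF T] st(3)[OF T] l2n_nonneg[of "Lon 0 1"] by (auto intro: antisym)
  then have ae: "AE x in Lon 0 1. u T x = u' T x" "AE x in Lon 0 1. v T x = v' T x"
    using l2n_eq_0_AE[OF L2_diff[OF L(1,3), unfolded L2_iff_sqint]] l2n_eq_0_AE[OF L2_diff[OF L(2,4), unfolded L2_iff_sqint]]
    by auto
  have "nrm (\<lambda>x. p x - m x) = nrm (\<lambda>x. q x - m x)"
    if "AE x in Lon 0 1. p x = q x" "L2 p" "L2 q" "L2 m" for p q m
    using that by (intro l2n_cong_AE L2_measurable L2_diff) (auto elim: eventually_mono)
  then show ?thesis using ae L assms(5,6) by (simp add: Jval_def)
qed

lemma Jgam_eq_Jval:
  assumes "T > 0" "coef \<alpha>0 \<alpha>1 d" "weak_sol T u0 v0 d u v" "L2 m1" "L2 m2"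
  shows "Jgam T u0 v0 m1 m2 \<gamma> d = Jval T m1 m2 \<gamma> d u v"
  unfolding Jgam_Jval
proof (rule the_equality)
  show "\<exists>u' v'. weak_sol T u0 v0 d u' v' \<and> Jval T m1 m2 \<gamma> d u v = Jval T m1 m2 \<gamma> d u' v'"
    using assms(3) by blast
  show "j = Jval T m1 m2 \<gamma> d u v" if "\<exists>u v. weak_sol T u0 v0 d u v \<and> j = Jval T m1 m2 \<gamma> d u v" for j
    using that Jval_unique[OF assms(1,2) _ assms(3-5)] by blast
qed

text \<open>On solvable coefficients the functional has its intended value, and
  \<open>weak_sol_limit\<close> makes the limit of a minimising sequence solvable again.\<close>

lemma minimiser_among_solvable:
  fixes \<alpha>1 :: real
  assumes "0 < \<alpha>0" "0 < \<alpha>2" "T > 0" "L2 u0" "L2 v0" "L2 m1" "L2 m2" "\<gamma> > 0"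
  defines "E \<equiv> {d \<in> Dset \<alpha>0 \<alpha>1 \<alpha>2. \<exists>u v. weak_sol T u0 v0 d u v}"
  assumes "E \<noteq> {}"
  obtains d where "d \<in> E" "\<And>d'. d' \<in> E \<Longrightarrow> Jgam T u0 v0 m1 m2 \<gamma> d \<le> Jgam T u0 v0 m1 m2 \<gamma> d'"
proof -
  let ?J = "Jgam T u0 v0 m1 m2 \<gamma>"
  have T: "T \<in> {0..T}" using \<open>T > 0\<close> by simp
  have coefE: "coef \<alpha>0 \<alpha>1 d" if "d \<in> E" for d using that Dset_coef \<open>0 < \<alpha>0\<close> by (auto simp: E_def)
  have pos: "0 \<le> ?J d" if d: "d \<in> E" for d
  proof -
    obtain u v where "weak_sol T u0 v0 d u v" using d by (auto simp: E_def)
    from Jgam_eq_Jval[OF \<open>T > 0\<close> coefE[OF d] this \<open>L2 m1\<close> \<open>L2 m2\<close>] show ?thesis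
      using \<open>\<gamma> > 0\<close> by (simp add: Jval_def)
  qed
  define m where "m = Inf (?J ` E)"
  have bdd: "bdd_below (?J ` E)" using pos by (intro bdd_belowI[of _ 0]) auto
  have m_le: "m \<le> ?J d" if "d \<in> E" for d unfolding m_def by (rule cInf_lower[OF _ bdd]) (use that in auto)
  have "\<exists>d\<in>E. ?J d < m + inverse (real (Suc n))" for n
  proof -
    have "\<exists>y\<in>?J ` E. y < m + inverse (real (Suc n))"
      by (rule cInf_lessD) (use \<open>E \<noteq> {}\<close> in \<open>auto simp: m_def\<close>)
    then show ?thesis by blast
  qed
  then obtain X where X: "\<And>n. X n \<in> E" "\<And>n. ?J (X n) < m + inverse (real (Suc n))" by metis
  have XD: "X n \<in> Dset \<alpha>0 \<alpha>1 \<alpha>2" for n using X(1)[of n] by (simp add: E_def)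
  obtain g \<rho> where g: "continuous_on {0..1} g" "\<And>x. x \<in> {0..1} \<Longrightarrow> \<alpha>0 \<le> g x \<and> g x \<le> \<alpha>1"
    "strict_mono (\<rho> :: nat \<Rightarrow> nat)" "\<And>n. AE x in Lon 0 1. \<bar>X (\<rho> n) x - g x\<bar> \<le> (1/2) ^ n"
    by (rule Dset_compact[where D = X, OF XD \<open>0 < \<alpha>0\<close> \<open>0 < \<alpha>2\<close>]) (rule that)
  define D where "D n = X (\<rho> n)" for n
  have DE: "D n \<in> E" and DD: "D n \<in> Dset \<alpha>0 \<alpha>1 \<alpha>2" for n using X(1) XD by (auto simp: D_def)
  have Jm: "(\<lambda>n. ?J (D n)) \<longlonglongrightarrow> m"
  proof -
    have "(\<lambda>n. ?J (X n)) \<longlonglongrightarrow> m"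
    proof (rule tendsto_sandwich[of "\<lambda>_. m" _ _ "\<lambda>n. m + inverse (real (Suc n))"])
      show "(\<lambda>n. m + inverse (real (Suc n))) \<longlonglongrightarrow> m"
        using tendsto_add[OF tendsto_const LIMSEQ_inverse_real_of_nat, of m] by simp
      show "\<forall>\<^sub>F n in sequentially. ?J (X n) \<le> m + inverse (real (Suc n))"
        using X(2) by (intro always_eventually allI less_imp_le)
    qed (use X(1) m_le in auto)
    from LIMSEQ_subseq_LIMSEQ[OF this g(3)] show ?thesis by (simp add: D_def comp_def)
  qed
  have Lg: "L2 g" by (rule L2_continuous[OF g(1)])
  have cg: "coef \<alpha>0 \<alpha>1 g"
    unfolding coef_def using \<open>0 < \<alpha>0\<close> L2_measurable[OF Lg] g(2) by (auto intro!: AE_I2)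
  have dg: "AE x in Lon 0 1. \<bar>D n x - g x\<bar> \<le> (1/2) ^ n" for n using g(4) by (simp add: D_def)
  have "\<exists>u v. weak_sol T u0 v0 (D n) u v" for n using DE[of n] by (simp add: E_def)
  then obtain U V where UV: "\<And>n. weak_sol T u0 v0 (D n) (U n) (V n)" by metis
  have geo: "summable (\<lambda>n. (1/2::real) ^ n)" by (rule summable_geometric) simp
  obtain u v where uv: "weak_sol T u0 v0 g u v"
    "(\<lambda>n. nrm (\<lambda>x. U n T x - u T x)) \<longlonglongrightarrow> 0" "(\<lambda>n. nrm (\<lambda>x. V n T x - v T x)) \<longlonglongrightarrow> 0"
    by (rule weak_sol_limit[OF \<open>T > 0\<close> coefE[OF DE] cg dg _ geo UV \<open>L2 u0\<close> \<open>L2 v0\<close>]) auto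
  have LT: "L2 (u T)" "L2 (v T)" "L2 (U n T)" "L2 (V n T)" for n
    using uv(1) UV[of n] T cont_L2_D(1) unfolding weak_sol_def by blast+
  have shift: "(\<lambda>n. nrm (\<lambda>x. W n x - p x)) \<longlonglongrightarrow> nrm (\<lambda>x. w x - p x)"
    if "(\<lambda>n. nrm (\<lambda>x. W n x - w x)) \<longlonglongrightarrow> 0" "\<And>n. L2 (W n)" "L2 w" "L2 p" for W w p
    by (rule l2n_tendsto) (use that L2_diff in \<open>auto simp: L2_iff_sqint\<close>)
  let ?A = "1/2 * (nrm (\<lambda>x. u T x - m1 x))\<^sup>2 + 1/2 * (nrm (\<lambda>x. v T x - m2 x))\<^sup>2"
  let ?An = "\<lambda>n. 1/2 * (nrm (\<lambda>x. U n T x - m1 x))\<^sup>2 + 1/2 * (nrm (\<lambda>x. V n T x - m2 x))\<^sup>2"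
  have A: "?An \<longlonglongrightarrow> ?A"
    by (intro tendsto_add tendsto_mult tendsto_const tendsto_power shift uv LT assms)
  have JD: "?J (D n) = ?An n + \<gamma>/2 * (H1_norm (D n))\<^sup>2" for n
    using Jgam_eq_Jval[OF \<open>T > 0\<close> coefE[OF DE] UV \<open>L2 m1\<close> \<open>L2 m2\<close>] by (simp add: Jval_def)
  \<comment> \<open>Values and tracking terms converge along the sequence, so the squared H1 norms
    converge as well, to the number found by solving for them; this divides by \<gamma>.\<close>
  define h where "h = (m - ?A) * (2 / \<gamma>)"
  have hlim: "(\<lambda>n. (H1_norm (D n))\<^sup>2) \<longlonglongrightarrow> h"
  proof -
    have "(\<lambda>n. (?J (D n) - ?An n) * (2 / \<gamma>)) \<longlonglongrightarrow> h"
      unfolding h_def by (intro tendsto_mult tendsto_diff Jm A tendsto_const)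
    moreover have "(?J (D n) - ?An n) * (2 / \<gamma>) = (H1_norm (D n))\<^sup>2" for n
      unfolding JD using \<open>\<gamma> > 0\<close> by simp
    ultimately show ?thesis by simp
  qed
  have DL: "L2 (D n)" "L2 (wd (D n))" "has_weak_deriv (D n) (wd (D n))" for n
    using H1_wd[of "D n"] DD[of n] by (auto simp: Dset_def)
  have Dlim: "(\<lambda>n. nrm (\<lambda>x. D n x - g x)) \<longlonglongrightarrow> 0"
  proof (rule tendsto_sandwich[OF _ _ tendsto_const LIMSEQ_power_zero[of "1/2::real"]])
    have "nrm (\<lambda>x. D n x - g x) \<le> (1/2) ^ n" for n
    proof -
      have c: "L2 (\<lambda>_. (1/2) ^ n)" by (rule L2_continuous) simp
      have "nrm (\<lambda>x. D n x - g x) \<le> nrm (\<lambda>_. (1/2) ^ n)"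
        by (rule l2n_mono[OF c[unfolded L2_iff_sqint] L2_measurable[OF L2_diff[OF DL(1) Lg]]]) (use dg in simp)
      then show ?thesis by (simp add: l2n_def[of _ "\<lambda>_. (1/2) ^ n"] measure_restrict_space)
    qed
    then show "\<forall>\<^sub>F n in sequentially. nrm (\<lambda>x. D n x - g x) \<le> (1/2) ^ n" by simp
  qed auto
  have "(\<lambda>n. nrm (D n)) \<longlonglongrightarrow> nrm g"
    by (rule l2n_tendsto[OF _ _ Dlim]) (use DL(1) Lg in \<open>auto simp: L2_iff_sqint\<close>)
  then have "(\<lambda>n. (H1_norm (D n))\<^sup>2 - (nrm (D n))\<^sup>2) \<longlonglongrightarrow> h - (nrm g)\<^sup>2"
    by (intro tendsto_diff hlim tendsto_power)
  moreover have "(H1_norm (D n))\<^sup>2 - (nrm (D n))\<^sup>2 = (nrm (wd (D n)))\<^sup>2" for n by (simp add: H1_norm_nrm)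
  ultimately have "(\<lambda>n. (nrm (wd (D n)))\<^sup>2) \<longlonglongrightarrow> h - (nrm g)\<^sup>2" by simp
  then obtain g' where g': "L2 g'" "has_weak_deriv g g'" "(nrm g')\<^sup>2 \<le> h - (nrm g)\<^sup>2"
    by (rule weak_deriv_lsc[OF DL Lg Dlim])
  have "nrm (wd g) = nrm g'"
    by (rule l2n_cong_AE[OF L2_measurable[OF wd_weak_deriv(1)[OF g'(1,2)]] L2_measurable[OF g'(1)] wd_weak_deriv(3)[OF g'(1,2)]])
  \<comment> \<open>This bound gives both membership in \<open>Dset\<close> and optimality:
    \<open>h\<close> is at most the square of \<open>\<alpha>2\<close>, and the tracking terms plus
    \<gamma>/2 times \<open>h\<close> make up \<open>m\<close>.\<close>
  then have Hg: "(H1_norm g)\<^sup>2 \<le> h" using g'(3) by (simp add: H1_norm_nrm)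
  have "(H1_norm (D n))\<^sup>2 \<le> \<alpha>2\<^sup>2" for n
    using DD[of n] H1_norm_nonneg by (intro power_mono) (auto simp: Dset_def)
  then have "h \<le> \<alpha>2\<^sup>2" by (intro LIMSEQ_le_const2[OF hlim]) auto
  then have "(H1_norm g)\<^sup>2 \<le> \<alpha>2\<^sup>2" using Hg by simp
  then have "H1_norm g \<le> \<alpha>2" by (rule power2_le_imp_le) (use \<open>0 < \<alpha>2\<close> in simp)
  moreover have "H1 g" unfolding H1_def using Lg g'(1,2) by blast
  moreover have "\<forall>x\<in>Omega. \<alpha>0 \<le> g x \<and> g x \<le> \<alpha>1" using g(2) by (simp add: Omega_def)
  ultimately have "g \<in> Dset \<alpha>0 \<alpha>1 \<alpha>2" by (simp add: Dset_def)
  then have gE: "g \<in> E" using uv(1) by (auto simp: E_def)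
  have "?J g = ?A + \<gamma>/2 * (H1_norm g)\<^sup>2"
    using Jgam_eq_Jval[OF \<open>T > 0\<close> cg uv(1) \<open>L2 m1\<close> \<open>L2 m2\<close>] by (simp add: Jval_def)
  also have "\<dots> \<le> ?A + \<gamma>/2 * h" using Hg \<open>\<gamma> > 0\<close> by simp
  also have "\<dots> = m" unfolding h_def using \<open>\<gamma> > 0\<close> by (simp add: field_simps)
  finally have "?J g \<le> ?J d'" if "d' \<in> E" for d' using m_le[OF that] by linarith
  with gE show thesis using that by blast
qed

theorem theorem3p1:
  fixes T \<gamma> \<alpha>0 \<alpha>1 \<alpha>2 :: real and u0 v0 m1 m2 :: "real \<Rightarrow> real"
  assumes "0 < \<alpha>0" and "\<alpha>0 \<le> \<alpha>1" and "0 < \<alpha>2"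
    and "Dset \<alpha>0 \<alpha>1 \<alpha>2 \<noteq> {}"
    and "T > 0" and "L2 u0" and "L2 v0" and "L2 m1" and "L2 m2" and "\<gamma> > 0"
  shows "\<exists>d\<in>Dset \<alpha>0 \<alpha>1 \<alpha>2. \<forall>d'\<in>Dset \<alpha>0 \<alpha>1 \<alpha>2.
           Jgam T u0 v0 m1 m2 \<gamma> d \<le> Jgam T u0 v0 m1 m2 \<gamma> d'"
proof -
  let ?J = "Jgam T u0 v0 m1 m2 \<gamma>" and ?D = "Dset \<alpha>0 \<alpha>1 \<alpha>2"
  define E where "E = {d \<in> ?D. \<exists>u v. weak_sol T u0 v0 d u v}"
  define c :: real where "c = (THE j. False)"
  have out: "?J d = c" if "d \<in> ?D - E" for d
  proof -
    have "\<not> (\<exists>u v. weak_sol T u0 v0 d u v)" using that by (simp add: E_def)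
    then show ?thesis by (simp add: Jgam_Jval c_def)
  qed
  show ?thesis
  proof (cases "E = {}")
    case True
    then show ?thesis using assms(4) out by force
  next
    case False
    obtain d where d: "d \<in> E" "\<And>d'. d' \<in> E \<Longrightarrow> ?J d \<le> ?J d'"
      using minimiser_among_solvable[OF assms(1,3,5-10) False[unfolded E_def]] unfolding E_def by blast
    show ?thesis
    \<comment> \<open>Nothing is known about \<open>c\<close>. If it is attained and undercuts the
      best solvable value, any coefficient outside \<open>E\<close> is a minimiser; otherwise
      \<open>d\<close> is.\<close>
    proof (cases "\<exists>d'\<in>?D - E. c < ?J d")
      case True
      then obtain e where e: "e \<in> ?D - E" "c < ?J d" by blast
      have "?J e \<le> ?J d'" if "d' \<in> ?D" for d'
        using out[OF e(1)] out[of d'] d(2)[of d'] e(2) that by (cases "d' \<in> E") auto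
      then show ?thesis using e(1) by blast
    next
      case False
      have "?J d \<le> ?J d'" if "d' \<in> ?D" for d'
        using False out[of d'] d(2)[of d'] that by (cases "d' \<in> E") auto
      moreover have "d \<in> ?D" using d(1) by (simp add: E_def)
      ultimately show ?thesis by blast
    qed
  qed
qed

end
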